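(* Let $T>0$ be fixed, let $X=(X_t)_{t\ge 0}$ be a Lévy process without positive jumps such that $\mathbb{P}(X_T>0)>0$, and let $\sigma=\sup\{t\in[0,T]: X_t\le 0\}$. Then on the event $\{X_T>0\}$ (that is, under the conditional law $\mathbb{P}(\,\cdot\mid X_T>0)$) the random times $\overrightarrow{F}$, $\overleftarrow{F}$, $\overrightarrow{G}$, $\overleftarrow{G}$, $N^-$, $N^+$ associated with $X$ and $\sigma$ all have the same distribution.
   Context: $X$ is a real-valued Lévy process (càdlàg, $X_0=0$). Write $\overline{X}_t=\sup\{X_s: s\in[0,t]\}$ and $\underline{X}_t=\inf\{X_s: s\in[0,t]\}$ for the running supremum and running infimum. The random times are $$N^-=\int_0^\sigma \mathbf{1}_{\{X_s\le 0\}}\,ds,\qquad N^+=\int_0^\sigma \mathbf{1}_{\{X_s\ge 0\}}\,ds,$$ $$\overrightarrow{F}=\sup\{t\in[0,\sigma): X_t=\underline{X}_t\},\qquad \overrightarrow{G}=\sup\{t\in[0,\sigma): X_t=\overline{X}_t\},$$ $$\overleftarrow{F}=\sigma-\overrightarrow{F},\qquad \overleftarrow{G}=\sigma-\overrightarrow{G}.$$ When $\sigma=0$, all these times are set equal to $0$. *)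

theory Defs
  imports "HOL-Probability.Probability"
begin

section \<open>Path functionals\<close>

text \<open>Paths are functions on the reals of which only the restriction to the nonnegative half-line
  matters.\<close>

definition cadlag :: "(real \<Rightarrow> real) \<Rightarrow> bool" where
  "cadlag x \<longleftrightarrow>
     (\<forall>t\<ge>0. continuous (at_right t) x) \<and> (\<forall>t>0. \<exists>l. (x \<longlongrightarrow> l) (at_left t))"

definition jump :: "(real \<Rightarrow> real) \<Rightarrow> real \<Rightarrow> real" where
  "jump x t = x t - Lim (at_left t) x"

definition running_sup :: "(real \<Rightarrow> real) \<Rightarrow> real \<Rightarrow> real" where
  "running_sup x t = (SUP s\<in>{0..t}. x s)"

definition running_inf :: "(real \<Rightarrow> real) \<Rightarrow> real \<Rightarrow> real" where
  "running_inf x t = (INF s\<in>{0..t}. x s)"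

text \<open>In the following functionals of a path \<open>x\<close> and an end time \<open>s \<ge> 0\<close>, the convention
  that all times vanish for \<open>s = 0\<close> has to be imposed explicitly for \<open>F_right\<close> and \<open>G_right\<close>
  (where the supremum would be over the empty set); for the others it then holds
  automatically.\<close>

definition N_minus :: "(real \<Rightarrow> real) \<Rightarrow> real \<Rightarrow> real" where
  "N_minus x s = (LINT u:{0..s}|lborel. indicator {v. x v \<le> 0} u)"

definition N_plus :: "(real \<Rightarrow> real) \<Rightarrow> real \<Rightarrow> real" where
  "N_plus x s = (LINT u:{0..s}|lborel. indicator {v. x v \<ge> 0} u)"

definition F_right :: "(real \<Rightarrow> real) \<Rightarrow> real \<Rightarrow> real" where
  "F_right x s = (if s = 0 then 0 else Sup {t\<in>{0..<s}. x t = running_inf x t})"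

definition G_right :: "(real \<Rightarrow> real) \<Rightarrow> real \<Rightarrow> real" where
  "G_right x s = (if s = 0 then 0 else Sup {t\<in>{0..<s}. x t = running_sup x t})"

definition F_left :: "(real \<Rightarrow> real) \<Rightarrow> real \<Rightarrow> real" where
  "F_left x s = s - F_right x s"

definition G_left :: "(real \<Rightarrow> real) \<Rightarrow> real \<Rightarrow> real" where
  "G_left x s = s - G_right x s"


section \<open>Levy processes\<close>

text \<open>The path properties are required almost surely only.\<close>

locale levy_process = prob_space M for M :: "'a measure" +
  fixes X :: "real \<Rightarrow> 'a \<Rightarrow> real"
  assumes measurable_X: "\<And>t. t \<ge> 0 \<Longrightarrow> X t \<in> borel_measurable M"
    and start_zero: "AE \<omega> in M. X 0 \<omega> = 0"
    and cadlag_paths: "AE \<omega> in M. cadlag (\<lambda>t. X t \<omega>)"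
    and indep_increments:
      "\<And>(n::nat) (t::nat \<Rightarrow> real). 0 \<le> t 0 \<Longrightarrow> (\<And>i. i < n \<Longrightarrow> t i < t (Suc i)) \<Longrightarrow>
         indep_vars (\<lambda>_. borel) (\<lambda>i \<omega>. X (t (Suc i)) \<omega> - X (t i) \<omega>) {..<n}"
    and stationary_increments:
      "\<And>s t. s \<ge> 0 \<Longrightarrow> t \<ge> 0 \<Longrightarrow> distr M borel (\<lambda>\<omega>. X (s + t) \<omega> - X s \<omega>) = distr M borel (X t)"

definition no_positive_jumps :: "'a measure \<Rightarrow> (real \<Rightarrow> 'a \<Rightarrow> real) \<Rightarrow> bool" where
  "no_positive_jumps M X \<longleftrightarrow> (AE \<omega> in M. \<forall>t>0. jump (\<lambda>s. X s \<omega>) t \<le> 0)"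

text \<open>Since the path properties hold only almost surely, path functionals such as \<open>F_right\<close> are in
  general random variables only with respect to the completion of the underlying probability
  space. The conditional law given an event is therefore taken on the completion; for functionals
  that are already measurable with respect to \<open>M\<close> this makes no difference.\<close>

definition cond_law :: "'a measure \<Rightarrow> 'a set \<Rightarrow> ('a \<Rightarrow> real) \<Rightarrow> real measure" where
  "cond_law M A Y = distr (uniform_measure (completion M) A) borel Y"

end

theory Submission
  imports Defs
begin

text \<open>
  On the event \<open>X\<^sub>T > 0\<close> the path on \<open>[0, \<sigma>]\<close> is a loop: it starts at 0, and it ends at 0 because there are no
  positive jumps. Permuting increments before \<open>\<sigma>\<close> changes neither \<open>\<sigma>\<close> nor the event, and the increments of a
  Levy process are exchangeable. Hence the joint law of \<open>\<sigma>\<close> and the loop is invariant under moving the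
  starting point along the loop, and the starting point may be chosen uniformly at random. For a fixed loop,
  however, each of the times then becomes uniform on \<open>[0, \<sigma>]\<close>. The location of the minimum, or of the
  maximum, is the distance on a circle from a uniform point to a fixed one (\<open>cyclic_distance_uniform\<close>), and the
  time spent below the starting level is the rank of the value at a uniform point
  (\<open>occupation_rank_uniform\<close>). So \<open>N_minus\<close>, \<open>F_right\<close> and \<open>G_right\<close> have the law of \<open>\<sigma>\<close> times an independent
  uniform variable, and the other three times are their differences from \<open>\<sigma>\<close>.

  Two regularity properties of the paths are behind this. First, levels carry no occupation time
  (\<open>no_atoms\<close>): if the level \<open>c\<close> carried some, then by the strong Markov property at the first passage over
  \<open>y\<close>, where the path equals \<open>y\<close> exactly, so would \<open>y + c\<close>, for uncountably many \<open>y\<close>. Second, the minimum and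
  the maximum are unique (\<open>no_ties_exists\<close>, \<open>AE_well_posed\<close>): equality of the infima over two separate windows
  prescribes the increment over the gap between them, and by the first property this has probability zero
  for almost every length of the gap.

  The invariance itself is exact on every grid (\<open>cyclic_exchange\<close>). It is not stated for the loop in
  continuous time; instead each functional is followed along refining grids, together with its average
  over all shifts (\<open>cyclic_limit\<close>). The grid loops close up only approximately, with an error that vanishes
  because the path is continuous at \<open>\<sigma>\<close>.
\<close>

section \<open>Paths without positive jumps\<close>

definition right_cont :: "(real \<Rightarrow> real) \<Rightarrow> bool" where
  "right_cont x \<longleftrightarrow> (\<forall>t. (x \<longlongrightarrow> x t) (at_right t))"

text \<open>Paths are continued by 0 to the negative half-line, so that right-continuity, left limits and the
  sign of the jumps can be required at every real time.\<close>

definition sn_path :: "(real \<Rightarrow> real) \<Rightarrow> bool" where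
  "sn_path x \<longleftrightarrow> (\<forall>t\<le>0. x t = 0) \<and> right_cont x \<and> (\<forall>t. \<exists>l\<ge>x t. (x \<longlongrightarrow> l) (at_left t))"

lemma right_contD:
  assumes "right_cont x" "e > 0"
  obtains d where "d > 0" "\<And>s. t \<le> s \<Longrightarrow> s < t + d \<Longrightarrow> \<bar>x s - x t\<bar> < e"
proof -
  have "\<forall>\<^sub>F s in at_right t. dist (x s) (x t) < e"
    using assms by (auto simp: right_cont_def dest: tendstoD)
  then obtain b where b: "b > t" "\<And>s. s > t \<Longrightarrow> s < b \<Longrightarrow> dist (x s) (x t) < e"
    by (auto simp: eventually_at_right_field)
  show ?thesis
  proof (rule that[of "b - t"])
    show "b - t > 0" using b by simp
    fix s assume "t \<le> s" "s < t + (b - t)"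
    then show "\<bar>x s - x t\<bar> < e"
      using b(2)[of s] assms(2) by (cases "s = t") (auto simp: dist_real_def)
  qed
qed

lemma left_limD:
  fixes x :: "real \<Rightarrow> real"
  assumes "(x \<longlongrightarrow> l) (at_left t)" "e > 0"
  obtains d where "d > 0" "\<And>s. t - d < s \<Longrightarrow> s < t \<Longrightarrow> \<bar>x s - l\<bar> < e"
proof -
  have "\<forall>\<^sub>F s in at_left t. dist (x s) l < e"
    using assms by (auto dest: tendstoD)
  then obtain b where b: "b < t" "\<And>s. s > b \<Longrightarrow> s < t \<Longrightarrow> dist (x s) l < e"
    unfolding eventually_at_left_field by blast
  show ?thesis
    by (rule that[of "t - b"]) (use b in \<open>auto simp: dist_real_def\<close>)
qed

lemma right_cont_uminus: "right_cont x \<Longrightarrow> right_cont (\<lambda>t. - x t)"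
  by (auto simp: right_cont_def intro: tendsto_minus)

lemma sn_path_right_cont: "sn_path x \<Longrightarrow> right_cont x"
  by (auto simp: sn_path_def)

lemma right_cont_tendsto:
  assumes "right_cont x" "f \<longlonglongrightarrow> t" "\<forall>\<^sub>F n in sequentially. f n \<ge> t"
  shows "(\<lambda>n. x (f n)) \<longlonglongrightarrow> x t"
proof (rule tendstoI)
  fix e :: real assume "e > 0"
  from right_contD[OF assms(1) this] obtain d where d: "d > 0" "\<And>s. t \<le> s \<Longrightarrow> s < t + d \<Longrightarrow> \<bar>x s - x t\<bar> < e"
    by blast
  have "\<forall>\<^sub>F n in sequentially. f n < t + d"
    using assms(2) d(1) by (intro order_tendstoD(2)[of f t]) auto
  with assms(3) show "\<forall>\<^sub>F n in sequentially. dist (x (f n)) (x t) < e"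
    by eventually_elim (use d in \<open>auto simp: dist_real_def\<close>)
qed

lemma sn_path_bounded:
  assumes "sn_path x"
  shows "\<exists>B. \<forall>t\<in>{a..b}. \<bar>x t\<bar> \<le> B"
proof -
  have "\<exists>d>0. \<exists>B. \<forall>s\<in>{t-d<..<t+d}. \<bar>x s\<bar> \<le> B" for t
  proof -
    obtain l where l: "(x \<longlongrightarrow> l) (at_left t)" using assms by (auto simp: sn_path_def)
    obtain d1 where d1: "d1 > 0" "\<And>s. t \<le> s \<Longrightarrow> s < t + d1 \<Longrightarrow> \<bar>x s - x t\<bar> < 1"
      using right_contD[OF sn_path_right_cont[OF assms], of 1] by (metis zero_less_one)
    obtain d2 where d2: "d2 > 0" "\<And>s. t - d2 < s \<Longrightarrow> s < t \<Longrightarrow> \<bar>x s - l\<bar> < 1"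
      using left_limD[OF l, of 1] by (metis zero_less_one)
    have "\<bar>x s\<bar> \<le> \<bar>l\<bar> + \<bar>x t\<bar> + 1" if "s \<in> {t - min d1 d2<..<t + min d1 d2}" for s
    proof (cases "s < t")
      case True
      moreover have "t - d2 < s" using that by (auto simp: min_def split: if_splits)
      ultimately show ?thesis using d2(2)[of s] by linarith
    next
      case False
      moreover have "s < t + d1" using that by (auto simp: min_def split: if_splits)
      ultimately show ?thesis using d1(2)[of s] by linarith
    qed
    then have "\<exists>B. \<forall>s\<in>{t - min d1 d2<..<t + min d1 d2}. \<bar>x s\<bar> \<le> B" by blast
    then show ?thesis using d1(1) d2(1) by (intro exI[of _ "min d1 d2"]) auto
  qed
  then obtain d B where dB: "\<And>t. d t > 0" "\<And>t s. s \<in> {t-d t<..<t+d t} \<Longrightarrow> \<bar>x s\<bar> \<le> B t"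
    by metis
  obtain C where C: "C \<subseteq> {a..b}" "finite C" "{a..b} \<subseteq> (\<Union>t\<in>C. {t-d t<..<t+d t})"
    by (rule compactE_image[of "{a..b}" "{a..b}" "\<lambda>t. {t-d t<..<t+d t}"]) (use dB(1) in \<open>auto\<close>)
  have "\<bar>x s\<bar> \<le> Max (insert 0 (B ` C))" if s: "s \<in> {a..b}" for s
  proof -
    obtain t where "t \<in> C" "s \<in> {t-d t<..<t+d t}" using C(3) s by auto
    then show ?thesis using dB(2)[of s t] C(2) by (meson Max_ge finite_imageI finite_insert image_eqI insertI2 order_trans)
  qed
  then show ?thesis by blast
qed

lemma sn_path_bdd_below: "sn_path x \<Longrightarrow> bdd_below (x ` {a..b})"
  using sn_path_bounded[of x a b] by (auto simp: bdd_below_def abs_le_iff) (metis minus_le_iff)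

lemma sn_path_bdd_above: "sn_path x \<Longrightarrow> bdd_above (x ` {a..b})"
  using sn_path_bounded[of x a b] by (auto simp: bdd_above_def abs_le_iff)

text \<open>At a downward jump the left limit lies above the value. Hence such paths are lower semicontinuous
  and attain their infima on compact intervals; suprema may be approached only from the left.\<close>

lemma sn_path_lsc:
  assumes "sn_path x" "e > 0"
  obtains d where "d > 0" "\<And>s. \<bar>s - t\<bar> < d \<Longrightarrow> x s > x t - e"
proof -
  obtain l where l: "(x \<longlongrightarrow> l) (at_left t)" "l \<ge> x t" using assms by (auto simp: sn_path_def)
  obtain d1 where d1: "d1 > 0" "\<And>s. t \<le> s \<Longrightarrow> s < t + d1 \<Longrightarrow> \<bar>x s - x t\<bar> < e"
    using right_contD[OF sn_path_right_cont[OF assms(1)] assms(2)] by metis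
  obtain d2 where d2: "d2 > 0" "\<And>s. t - d2 < s \<Longrightarrow> s < t \<Longrightarrow> \<bar>x s - l\<bar> < e"
    using left_limD[OF l(1) assms(2)] by metis
  show ?thesis
  proof (rule that[of "min d1 d2"])
    show "min d1 d2 > 0" using d1(1) d2(1) by simp
    fix s assume "\<bar>s - t\<bar> < min d1 d2"
    then show "x s > x t - e" using d1(2)[of s] d2(2)[of s] l(2) by (cases "s < t") auto
  qed
qed

lemma sn_path_attains_Inf:
  assumes "sn_path x" "a \<le> b"
  obtains t where "t \<in> {a..b}" "x t = Inf (x ` {a..b})"
proof -
  let ?I = "Inf (x ` {a..b})"
  have "\<exists>t\<in>{a..b}. x t = ?I"
  proof (rule ccontr)
    assume "\<not> ?thesis"
    then have gt: "x t > ?I" if "t \<in> {a..b}" for t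
      using that cINF_lower[OF sn_path_bdd_below[OF assms(1)], of t a b] by force
    have "\<exists>d>0. \<forall>s. \<bar>s - t\<bar> < d \<longrightarrow> x s > x t - (x t - ?I) / 2" if "t \<in> {a..b}" for t
      using sn_path_lsc[OF assms(1), of "(x t - ?I) / 2" t] gt[OF that] by (metis diff_gt_0_iff_gt half_gt_zero)
    then obtain d where d: "\<And>t. t \<in> {a..b} \<Longrightarrow> d t > 0"
      "\<And>t s. t \<in> {a..b} \<Longrightarrow> \<bar>s - t\<bar> < d t \<Longrightarrow> x s > x t - (x t - ?I) / 2"
      by metis
    obtain C where C: "C \<subseteq> {a..b}" "finite C" "{a..b} \<subseteq> (\<Union>t\<in>C. {t-d t<..<t+d t})"
      by (rule compactE_image[of "{a..b}" "{a..b}" "\<lambda>t. {t-d t<..<t+d t}"]) (use d(1) in \<open>auto\<close>)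
    have "C \<noteq> {}" using C(3) assms(2) by auto
    define e where "e = Min ((\<lambda>t. (x t - ?I) / 2) ` C)"
    have "e > 0" using C(1,2) \<open>C \<noteq> {}\<close> gt by (auto simp: e_def)
    then obtain s where s: "s \<in> {a..b}" "x s < ?I + e"
      using cInf_lessD[of "x ` {a..b}" "?I + e"] assms(2) by auto
    obtain t where t: "t \<in> C" "s \<in> {t-d t<..<t+d t}" using C(3) s(1) by auto
    have "x s > x t - (x t - ?I) / 2" using d(2)[of t s] t C(1) by auto
    moreover have "e \<le> (x t - ?I) / 2"
      unfolding e_def using t C(2) by (intro Min_le) auto
    ultimately show False using s(2) by argo
  qed
  then show ?thesis using that by blast
qed

text \<open>Levels are crossed upwards without a gap: at the first passage \<open>r\<close> over \<open>y\<close> the left limit is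
  at most \<open>y\<close>, right-continuity gives \<open>x r \<ge> y\<close>, and the jump at \<open>r\<close> is not positive.\<close>

lemma sn_path_first_passage:
  assumes "sn_path x" "s \<le> t" "x s < y" "y < x t"
  obtains r where "s < r" "r \<le> t" "x r = y" "\<And>u. s \<le> u \<Longrightarrow> u < r \<Longrightarrow> x u \<le> y"
    "\<And>d. d > 0 \<Longrightarrow> \<exists>u. r < u \<and> u < r + d \<and> x u > y"
proof -
  define A where "A = {u\<in>{s..t}. x u > y}"
  define r where "r = Inf A"
  have tA: "t \<in> A" using assms by (auto simp: A_def)
  have bdd: "bdd_below A" by (auto simp: A_def bdd_below_def)
  have r: "s \<le> r" "r \<le> t"
    unfolding r_def using tA bdd by (auto intro!: cInf_greatest cInf_lower simp: A_def)
  have before: "x u \<le> y" if "s \<le> u" "u < r" for u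
  proof (rule ccontr)
    assume "\<not> x u \<le> y"
    then have "u \<in> A" using that r by (auto simp: A_def)
    then show False using that cInf_lower[OF _ bdd, of u] by (auto simp: r_def)
  qed
  have near: "\<exists>u. u \<in> A \<and> r \<le> u \<and> u < r + d" if "d > 0" for d
    using cInf_lessD[of A "r + d"] tA that cInf_lower[OF _ bdd] by (fastforce simp: r_def)
  have ge: "x r \<ge> y"
  proof (rule ccontr)
    assume "\<not> ?thesis"
    then obtain d where d: "d > 0" "\<And>u. r \<le> u \<Longrightarrow> u < r + d \<Longrightarrow> \<bar>x u - x r\<bar> < y - x r"
      using right_contD[OF sn_path_right_cont[OF assms(1)], of "y - x r" r] by (metis diff_gt_0_iff_gt not_le)
    from near[OF d(1)] obtain u where "u \<in> A" "r \<le> u" "u < r + d" by blast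
    then show False using d(2)[of u] by (auto simp: A_def)
  qed
  with assms(3) r have sr: "s < r" by (cases "s = r") auto
  have le: "x r \<le> y"
  proof -
    obtain l where l: "(x \<longlongrightarrow> l) (at_left r)" "l \<ge> x r" using assms by (auto simp: sn_path_def)
    have "l \<le> y"
    proof (rule tendsto_upperbound[OF l(1)])
      show "\<forall>\<^sub>F u in at_left r. x u \<le> y"
        using before sr by (auto simp: eventually_at_left_field intro!: exI[of _ s])
    qed auto
    with l(2) show ?thesis by simp
  qed
  show ?thesis
  proof (rule that[of r])
    show "x r = y" using ge le by simp
    fix d :: real assume "d > 0"
    from near[OF this] obtain u where "u \<in> A" "r \<le> u" "u < r + d" by blast
    with le show "\<exists>u. r < u \<and> u < r + d \<and> x u > y"
      by (intro exI[of _ u]) (auto simp: A_def order_le_less)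
  qed (use sr r before in auto)
qed

text \<open>To the right of a point where \<open>y\<close> is close to its infimum there is an interval on which it stays
  close; every sufficiently fine grid meets that interval.\<close>

lemma grid_Min_tendsto_Inf:
  assumes "right_cont y" "bdd_below (y ` {a..b})" "a \<le> b"
  shows "(\<lambda>n. Min ((\<lambda>i. y (a + real i * (b - a) / real (Suc n))) ` {..Suc n})) \<longlonglongrightarrow> Inf (y ` {a..b})"
proof (rule tendstoI)
  fix e :: real assume e: "e > 0"
  let ?I = "Inf (y ` {a..b})"
  let ?p = "\<lambda>n i. a + real i * (b - a) / real (Suc n)"
  have p: "?p n i \<in> {a..b}" if "i \<le> Suc n" for n i
  proof -
    have "real i * (b - a) \<le> real (Suc n) * (b - a)" using that assms(3) by (intro mult_right_mono) auto
    then have "real i * (b - a) / real (Suc n) \<le> b - a"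
      by (subst pos_divide_le_eq) (auto simp: mult.commute)
    then show ?thesis using assms(3) by auto
  qed
  have lower: "?I \<le> Min ((\<lambda>i. y (?p n i)) ` {..Suc n})" for n
    using p assms(2) by (auto intro!: cINF_lower)
  obtain t where t: "t \<in> {a..b}" "y t < ?I + e / 2"
    using cInf_lessD[of "y ` {a..b}" "?I + e / 2"] assms(3) e by auto
  have "\<forall>\<^sub>F n in sequentially. \<exists>i\<le>Suc n. y (?p n i) < ?I + e"
  proof (cases "t = b")
    case True
    show ?thesis
    proof (intro always_eventually allI)
      fix n show "\<exists>i\<le>Suc n. y (?p n i) < ?I + e"
        using t(2) e True by (intro exI[of _ "Suc n"]) (auto simp del: of_nat_Suc)
    qed
  next
    case False
    then have tb: "t < b" "a < b" using t by auto
    obtain d where d: "d > 0" "\<And>s. t \<le> s \<Longrightarrow> s < t + d \<Longrightarrow> \<bar>y s - y t\<bar> < e / 2"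
      using right_contD[OF assms(1), of "e/2" t] e by (metis half_gt_zero)
    have "\<forall>\<^sub>F n in sequentially. (b - a) / real (Suc n) < min d (b - t)"
    proof (rule order_tendstoD)
      show "(\<lambda>n. (b - a) / real (Suc n)) \<longlonglongrightarrow> 0"
        by (rule LIMSEQ_Suc[OF lim_const_over_n])
    qed (use d tb in auto)
    then show ?thesis
    proof eventually_elim
      case (elim n)
      define h where "h = (b - a) / real (Suc n)"
      have h: "h > 0" "h < d" "h < b - t" using elim tb by (auto simp: h_def)
      define i where "i = nat \<lceil>(t - a) / h\<rceil>"
      have i: "real i \<ge> (t - a) / h" "real i < (t - a) / h + 1"
        using h t by (auto simp: i_def) linarith+
      have i1: "real i * h \<ge> t - a" "real i * h < t - a + h" using h i by (auto simp: field_simps)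
      have "real i * h < b - a" using i1 h by auto
      also have "b - a = real (Suc n) * h" by (simp add: h_def)
      finally have *: "i \<le> Suc n" using h by (simp only: mult_less_cancel_right_pos of_nat_less_iff)
      have "\<bar>y (a + real i * h) - y t\<bar> < e / 2" using i1 h by (intro d(2)) auto
      then have "y (a + real i * h) < ?I + e" using t(2) by linarith
      then show ?case using * by (intro exI[of _ i]) (simp add: h_def)
    qed
  qed
  then show "\<forall>\<^sub>F n in sequentially. dist (Min ((\<lambda>i. y (?p n i)) ` {..Suc n})) ?I < e"
  proof eventually_elim
    case (elim n)
    then have "Min ((\<lambda>i. y (?p n i)) ` {..Suc n}) < ?I + e"
      by (subst Min_less_iff) auto
    with lower[of n] show ?case by (simp add: dist_real_def)
  qed
qed

section \<open>Records and well-posed minima\<close>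

text \<open>Infima and suprema of a path \<open>x\<close> without positive jumps are treated together, as infima of \<open>x\<close> and of
  \<open>- x\<close>. The assumption \<open>new_record\<close> is the one property of the absence of positive jumps that both
  share: a window in which the infimum drops contains a time at which the running infimum is attained.\<close>

locale record_path =
  fixes y :: "real \<Rightarrow> real"
  assumes zero: "\<And>t. t \<le> 0 \<Longrightarrow> y t = 0"
    and rc: "right_cont y"
    and bdd: "\<And>a b. bdd_below (y ` {a..b})"
    and new_record: "\<And>a b. 0 \<le> a \<Longrightarrow> a \<le> b \<Longrightarrow> Inf (y ` {a..b}) < Inf (y ` {0..a}) \<Longrightarrow>
       \<exists>t\<in>{a..b}. y t = Inf (y ` {0..t})"

text \<open>The infimum over the later window is attained, and the point where this happens is a record.\<close>

lemma sn_path_record_path: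
  assumes "sn_path x"
  shows "record_path x"
proof
  show "x t = 0" if "t \<le> 0" for t using assms that by (auto simp: sn_path_def)
  show "right_cont x" using assms by (rule sn_path_right_cont)
  show bdd: "bdd_below (x ` {a..b})" for a b using assms by (rule sn_path_bdd_below)
  fix a b :: real assume ab: "0 \<le> a" "a \<le> b" "Inf (x ` {a..b}) < Inf (x ` {0..a})"
  obtain t where t: "t \<in> {a..b}" "x t = Inf (x ` {a..b})" using sn_path_attains_Inf[OF assms ab(2)] .
  have "x t \<le> x u" if "u \<in> {0..t}" for u
  proof (cases "u \<le> a")
    case True
    then have "Inf (x ` {0..a}) \<le> x u" using that bdd by (intro cINF_lower) auto
    then show ?thesis using ab t by simp
  next
    case False
    then show ?thesis unfolding t(2) using that t bdd by (intro cINF_lower) auto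
  qed
  moreover have "x t \<in> x ` {0..t}" using t(1) ab by auto
  ultimately have "Inf (x ` {0..t}) = x t" by (intro cInf_eq_minimum) auto
  then show "\<exists>t\<in>{a..b}. x t = Inf (x ` {0..t})" using t(1) by metis
qed

text \<open>The supremum of \<open>x\<close> over the later window may fail to be attained. The first passage of \<open>x\<close> over a level
  between the two suprema is a record all the same.\<close>

lemma sn_path_record_path_uminus:
  assumes "sn_path x"
  shows "record_path (\<lambda>t. - x t)"
proof
  show "- x t = 0" if "t \<le> 0" for t using assms that by (auto simp: sn_path_def)
  show "right_cont (\<lambda>t. - x t)" using assms by (intro right_cont_uminus sn_path_right_cont)
  show bdd: "bdd_below ((\<lambda>t. - x t) ` {a..b})" for a b
    using sn_path_bdd_above[OF assms, of a b] by (auto simp: bdd_above_def bdd_below_def) (metis neg_le_iff_le)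
  fix a b :: real assume ab: "0 \<le> a" "a \<le> b" "Inf ((\<lambda>t. - x t) ` {a..b}) < Inf ((\<lambda>t. - x t) ` {0..a})"
  let ?I = "Inf ((\<lambda>t. - x t) ` {0..a})"
  obtain u where u: "u \<in> {a..b}" "- x u < ?I"
    using cInf_lessD[of "(\<lambda>t. - x t) ` {a..b}" ?I] ab by auto
  have low: "?I \<le> - x v" if "v \<in> {0..a}" for v using that bdd by (intro cINF_lower) auto
  define l where "l = (x u - ?I) / 2"
  have l: "x a < l" "l < x u" "- l < ?I" using u(2) low[of a] ab by (auto simp: l_def field_simps)
  obtain r where r: "a < r" "r \<le> u" "x r = l" "\<And>v. a \<le> v \<Longrightarrow> v < r \<Longrightarrow> x v \<le> l"
    using sn_path_first_passage[OF assms _ l(1,2)] u(1) by (metis atLeastAtMost_iff)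
  have "- x r \<le> - x v" if "v \<in> {0..r}" for v
    using low[of v] r(3) r(4)[of v] that l by (cases "v \<le> a"; cases "v = r") auto
  then have "Inf ((\<lambda>t. - x t) ` {0..r}) = - x r" using r ab by (intro cInf_eq_minimum) auto
  then show "\<exists>t\<in>{a..b}. - x t = Inf ((\<lambda>t. - x t) ` {0..t})" using r u by (intro bexI[of _ r]) auto
qed

text \<open>This identity is what allows the maximum to be handled as the minimum of the negative path.\<close>

lemma G_right_eq_F_right: "G_right x s = F_right (\<lambda>t. - x t) s"
proof -
  have "running_sup x t = - running_inf (\<lambda>t. - x t) t" for t
    by (auto simp: running_sup_def running_inf_def Inf_real_def image_image)
  then have "x t = running_sup x t \<longleftrightarrow> - x t = running_inf (\<lambda>t. - x t) t" for t
    by (metis minus_minus)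
  then show ?thesis by (simp only: G_right_def F_right_def)
qed

definition dense_times :: "real set \<Rightarrow> bool" where
  "dense_times B \<longleftrightarrow> (\<forall>u v. 0 \<le> u \<longrightarrow> u < v \<longrightarrow> (\<exists>b\<in>B. u < b \<and> b < v))"

lemma dense_timesE:
  assumes "dense_times B" "0 \<le> u" "u < v"
  obtains b where "b \<in> B" "u < b" "b < v"
  using assms by (auto simp: dense_times_def)

text \<open>The windows have rational lengths, while their common end point \<open>b\<close> ranges over a set of times: almost
  every end point avoids ties with probability one, but a given one need not.\<close>

definition no_ties :: "real set \<Rightarrow> (real \<Rightarrow> real) \<Rightarrow> bool" where
  "no_ties B y \<longleftrightarrow> (\<forall>b\<in>B. \<forall>q\<in>\<rat>. \<forall>l\<in>\<rat>. 0 \<le> q \<longrightarrow> 0 < l \<longrightarrow> q + l < b \<longrightarrow>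
      Inf (y ` {0..q}) \<noteq> Inf (y ` {b - l..b}))"

text \<open>All minimising sequences converge to \<open>m\<close>. In this form uniqueness of the minimiser passes to grids, and
  it covers an infimum that is only approached at a left limit.\<close>

definition well_posed :: "(real \<Rightarrow> real) \<Rightarrow> real \<Rightarrow> real \<Rightarrow> bool" where
  "well_posed y b m \<longleftrightarrow> m \<in> {0..b} \<and>
     (\<forall>e>0. \<exists>d>0. \<forall>t\<in>{0..b}. y t < Inf (y ` {0..b}) + d \<longrightarrow> \<bar>t - m\<bar> < e)"

context record_path
begin

lemma Inf_mono: "a' \<le> a \<Longrightarrow> a \<le> b \<Longrightarrow> b \<le> b' \<Longrightarrow> Inf (y ` {a'..b'}) \<le> Inf (y ` {a..b})"
  by (intro cINF_superset_mono bdd) auto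

lemma Inf_le: "t \<in> {a..b} \<Longrightarrow> Inf (y ` {a..b}) \<le> y t"
  by (intro cINF_lower bdd)

lemma near_Inf:
  assumes "a \<le> b" "d > 0"
  obtains t where "t \<in> {a..b}" "y t < Inf (y ` {a..b}) + d"
  using cInf_lessD[of "y ` {a..b}" "Inf (y ` {a..b}) + d"] assms by auto

text \<open>If minimising sequences accumulated at two points \<open>a < c\<close>, the infimum over \<open>[0, b]\<close> would be the infimum
  both over a window \<open>[0, q]\<close> containing \<open>a\<close> and over a window \<open>[b - l, b]\<close> containing \<open>c\<close>, a tie.\<close>

lemma well_posed_exists:
  assumes "no_ties B y" "b \<in> B" "0 < b"
  shows "\<exists>m. well_posed y b m"
proof -
  let ?I = "Inf (y ` {0..b})"
  define acc where "acc c \<longleftrightarrow> c \<in> {0..b} \<and> (\<forall>e>0. \<forall>d>0. \<exists>t\<in>{0..b}. \<bar>t - c\<bar> < e \<and> y t < ?I + d)" for c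
  have acc_unique: "\<not> a < c" if "acc a" "acc c" for a c
  proof
    assume ac: "a < c"
    have ab: "0 \<le> a" "c \<le> b" using that by (auto simp: acc_def)
    obtain q where q: "q \<in> \<rat>" "a < q" "q < (a + c) / 2"
      using Rats_dense_in_real[of a "(a+c)/2"] ac by auto
    obtain l where l: "l \<in> \<rat>" "b - c < l" "l < b - (a + c) / 2"
      using Rats_dense_in_real[of "b - c" "b - (a+c)/2"] ac by auto
    have "Inf (y ` {0..q}) \<le> ?I + d" if d: "d > 0" for d
    proof -
      obtain t where "t \<in> {0..b}" "\<bar>t - a\<bar> < q - a" "y t < ?I + d"
        using \<open>acc a\<close>[unfolded acc_def, THEN conjunct2, rule_format, of "q - a" d] q(2) d by auto
      then show ?thesis using Inf_le[of t 0 q] by (auto simp: abs_less_iff)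
    qed
    then have 1: "Inf (y ` {0..q}) \<le> ?I" by (rule field_le_epsilon)
    have "Inf (y ` {b - l..b}) \<le> ?I + d" if d: "d > 0" for d
    proof -
      obtain t where "t \<in> {0..b}" "\<bar>t - c\<bar> < c - (b - l)" "y t < ?I + d"
        using \<open>acc c\<close>[unfolded acc_def, THEN conjunct2, rule_format, of "c - (b - l)" d] l(2) d by auto
      then show ?thesis using Inf_le[of t "b - l" b] by (auto simp: abs_less_iff)
    qed
    then have 2: "Inf (y ` {b - l..b}) \<le> ?I" by (rule field_le_epsilon)
    have "q + l < b" "0 \<le> q" "0 < l" "q \<le> b" "0 \<le> b - l" using q(2,3) l(2,3) ab ac by argo+
    moreover from this have "Inf (y ` {0..q}) = ?I" "Inf (y ` {b - l..b}) = ?I"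
      using 1 2 by (auto intro!: antisym Inf_mono)
    ultimately show False
      using assms(1)[unfolded no_ties_def, rule_format, OF assms(2) q(1) l(1)] by simp
  qed
  have acc_limit: "acc c" if "\<And>n. s n \<in> {0..b}" "\<And>n. y (s n) < ?I + 1 / real (Suc n)" "strict_mono r"
    "(s \<circ> r) \<longlonglongrightarrow> c" for s r c
    unfolding acc_def
  proof (intro conjI allI impI)
    show "c \<in> {0..b}"
      using closed_sequentially[OF closed_real_atLeastAtMost _ that(4), of 0 b] that(1) by auto
    fix e d :: real assume "e > 0" "d > 0"
    have "\<forall>\<^sub>F n in sequentially. dist ((s \<circ> r) n) c < e" using that(4) \<open>e > 0\<close> by (rule tendstoD)
    moreover have "\<forall>\<^sub>F n in sequentially. 1 / real (Suc n) < d"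
      using order_tendstoD(2)[OF LIMSEQ_Suc[OF lim_const_over_n[of 1]] \<open>d > 0\<close>] by simp
    ultimately have "\<forall>\<^sub>F n in sequentially. dist ((s \<circ> r) n) c < e \<and> 1 / real (Suc n) < d"
      by eventually_elim auto
    then obtain n where n: "dist ((s \<circ> r) n) c < e" "1 / real (Suc n) < d"
      by (auto simp: eventually_sequentially)
    have "1 / real (Suc (r n)) \<le> 1 / real (Suc n)"
      using seq_suble[OF that(3), of n] by (intro divide_left_mono) auto
    then show "\<exists>t\<in>{0..b}. \<bar>t - c\<bar> < e \<and> y t < ?I + d"
      using that(1)[of "r n"] that(2)[of "r n"] n by (intro bexI[of _ "s (r n)"]) (auto simp: dist_real_def)
  qed
  have "\<exists>t. t \<in> {0..b} \<and> y t < ?I + 1 / real (Suc n)" for n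
    using near_Inf[of 0 b "1 / real (Suc n)"] assms(3) by (metis less_eq_real_def of_nat_0_less_iff zero_less_Suc zero_less_divide_1_iff)
  then obtain s where s: "\<And>n. s n \<in> {0..b}" "\<And>n. y (s n) < ?I + 1 / real (Suc n)" by metis
  have cpt: "seq_compact {0..b}" by (simp add: compact_imp_seq_compact)
  obtain m r where mr: "strict_mono r" "(s \<circ> r) \<longlonglongrightarrow> m"
    using seq_compactE[OF cpt, of s] s(1) by metis
  have am: "acc m" using acc_limit[OF s mr] .
  have "well_posed y b m"
  proof (rule ccontr)
    assume "\<not> well_posed y b m"
    moreover have "m \<in> {0..b}" using am by (auto simp: acc_def)
    ultimately have "\<exists>e>0. \<forall>d>0. \<exists>t. t \<in> {0..b} \<and> y t < ?I + d \<and> \<bar>t - m\<bar> \<ge> e"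
      unfolding well_posed_def by (meson not_le)
    then obtain e where e: "e > 0" "\<And>d. d > 0 \<Longrightarrow> \<exists>t. t \<in> {0..b} \<and> y t < ?I + d \<and> \<bar>t - m\<bar> \<ge> e"
      by blast
    have "\<exists>t. t \<in> {0..b} \<and> y t < ?I + 1 / real (Suc n) \<and> \<bar>t - m\<bar> \<ge> e" for n by (rule e(2)) auto
    then obtain s' where s': "\<And>n. s' n \<in> {0..b}" "\<And>n. y (s' n) < ?I + 1 / real (Suc n)"
      "\<And>n. \<bar>s' n - m\<bar> \<ge> e" by metis
    obtain m' r' where mr': "strict_mono r'" "(s' \<circ> r') \<longlonglongrightarrow> m'"
      using seq_compactE[OF cpt, of s'] s'(1) by metis
    have am': "acc m'" using acc_limit[OF s'(1,2) mr'] .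
    have "(\<lambda>n. \<bar>(s' \<circ> r') n - m\<bar>) \<longlonglongrightarrow> \<bar>m' - m\<bar>" by (intro tendsto_intros mr')
    then have "\<bar>m' - m\<bar> \<ge> e" using s'(3) by (intro tendsto_lowerbound[of _ "\<bar>m' - m\<bar>" sequentially]) auto
    then show False using acc_unique[OF am am'] acc_unique[OF am' am] e(1) by auto
  qed
  then show ?thesis by blast
qed

text \<open>The end point \<open>s\<close> will be random. Since the path is close to 0 near \<open>s\<close>, and so away from its negative
  infimum, a fixed end point \<open>b < s\<close> close to \<open>s\<close> gives the same minimiser.\<close>

lemma well_posed_bridge:
  assumes B: "dense_times B" "no_ties B y" and s: "0 < s" "y s = 0" "(y \<longlongrightarrow> 0) (at_left s)"
    and neg: "Inf (y ` {0..s}) < 0"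
  obtains m where "0 < m" "m < s" "well_posed y s m"
proof -
  let ?I = "Inf (y ` {0..s})"
  obtain d where d: "d > 0" "\<And>t. s - d < t \<Longrightarrow> t < s \<Longrightarrow> \<bar>y t - 0\<bar> < - ?I / 2"
    using left_limD[OF s(3), of "- ?I / 2"] neg by auto
  obtain b where b: "b \<in> B" "max (s - d) 0 < b" "b < s"
    using dense_timesE[OF B(1), of "max (s - d) 0" s] d(1) s(1) by (metis diff_less_eq less_add_same_cancel1 max.cobounded2 max_less_iff_conj)
  have tail: "y t > ?I / 2" if "b \<le> t" "t \<le> s" for t
    using d(2)[of t] s(2) neg b that by (cases "t = s") auto
  have near_b: "t \<in> {0..b}" if "t \<in> {0..s}" "y t < ?I / 2" for t
    using tail[of t] that by force
  have Ib: "Inf (y ` {0..b}) = ?I"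
  proof (rule antisym)
    show "?I \<le> Inf (y ` {0..b})" using b by (intro Inf_mono) auto
    show "Inf (y ` {0..b}) \<le> ?I"
    proof (rule field_le_epsilon)
      fix e :: real assume "e > 0"
      then have "min e (- ?I / 2) > 0" using neg by auto
      then obtain t where t: "t \<in> {0..s}" "y t < ?I + min e (- ?I / 2)" using near_Inf[of 0 s] s(1) by (metis less_imp_le)
      then have "t \<in> {0..b}" by (intro near_b) auto
      then show "Inf (y ` {0..b}) \<le> ?I + e" using Inf_le[of t 0 b] t by auto
    qed
  qed
  obtain m where m: "well_posed y b m" using well_posed_exists[OF B(2) b(1)] b(2) by auto
  have "well_posed y s m"
    unfolding well_posed_def
  proof (intro conjI allI impI)
    show "m \<in> {0..s}" using m b by (auto simp: well_posed_def)
    fix e :: real assume "e > 0"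
    then obtain d where d: "d > 0" "\<And>t. t\<in>{0..b} \<Longrightarrow> y t < Inf (y ` {0..b}) + d \<Longrightarrow> \<bar>t - m\<bar> < e"
      using m unfolding well_posed_def by metis
    show "\<exists>d>0. \<forall>t\<in>{0..s}. y t < ?I + d \<longrightarrow> \<bar>t - m\<bar> < e"
    proof (intro exI[of _ "min d (- ?I / 2)"] conjI ballI impI)
      show "0 < min d (- ?I / 2)" using d neg by auto
      fix t assume t: "t \<in> {0..s}" "y t < ?I + min d (- ?I / 2)"
      then have "t \<in> {0..b}" by (intro near_b) auto
      then show "\<bar>t - m\<bar> < e" using d(2)[of t] t Ib by auto
    qed
  qed
  moreover have "m \<noteq> 0"
  proof
    assume [simp]: "m = 0"
    obtain d where d: "d > 0" "\<And>t. 0 \<le> t \<Longrightarrow> t < 0 + d \<Longrightarrow> \<bar>y t - y 0\<bar> < - ?I / 2"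
      using right_contD[OF rc, of "- ?I / 2" 0] neg by (metis divide_pos_pos neg_0_less_iff_less zero_less_numeral)
    obtain d' where d': "d' > 0" "\<And>t. t\<in>{0..s} \<Longrightarrow> y t < ?I + d' \<Longrightarrow> \<bar>t\<bar> < d"
      using \<open>well_posed y s m\<close> d(1) unfolding well_posed_def by (metis \<open>m = 0\<close> diff_zero)
    have "min d' (- ?I / 2) > 0" using d' neg by auto
    then obtain t where t: "t \<in> {0..s}" "y t < ?I + min d' (- ?I / 2)" using near_Inf[of 0 s] s(1) by (metis less_imp_le)
    then show False using d'(2)[of t] d(2)[of t] zero[of 0] by auto
  qed
  moreover have "0 \<le> m" "m \<le> b" using m by (auto simp: well_posed_def)
  ultimately show ?thesis using b by (intro that[of m]) auto
qed

text \<open>A record after \<open>m\<close> would again have the value of the infimum, against well-posedness. Before \<open>m\<close> the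
  infimum is not yet reached, so it drops on every interval around \<open>m\<close> and creates records there.\<close>

lemma F_right_eq_argmin:
  assumes m: "0 < m" "m < s" "well_posed y s m"
  shows "F_right y s = m"
proof -
  let ?I = "Inf (y ` {0..s})"
  let ?R = "{t\<in>{0..<s}. y t = Inf (y ` {0..t})}"
  have wp: "\<exists>d>0. \<forall>t\<in>{0..s}. y t < ?I + d \<longrightarrow> \<bar>t - m\<bar> < e" if "e > 0" for e
    using m(3) that by (auto simp: well_posed_def)
  have Inf_after: "Inf (y ` {a..b}) = ?I" if ab: "0 \<le> a" "a < m" "m < b" "b \<le> s" for a b
  proof (rule antisym)
    show "?I \<le> Inf (y ` {a..b})" using that by (intro Inf_mono) auto
    show "Inf (y ` {a..b}) \<le> ?I"
    proof (rule field_le_epsilon)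
      fix e :: real assume "e > 0"
      obtain d where d: "d > 0" "\<And>t. t\<in>{0..s} \<Longrightarrow> y t < ?I + d \<Longrightarrow> \<bar>t - m\<bar> < min (m - a) (b - m)"
        using wp[of "min (m - a) (b - m)"] ab by auto
      have "min e d > 0" using d \<open>e > 0\<close> by auto
      then obtain t where t: "t \<in> {0..s}" "y t < ?I + min e d" using near_Inf[of 0 s] m by (metis less_imp_le less_trans)
      then have "\<bar>t - m\<bar> < min (m - a) (b - m)" by (intro d(2)) auto
      then have "t \<in> {a..b}" by auto
      then show "Inf (y ` {a..b}) \<le> ?I + e" using Inf_le[of t a b] t by auto
    qed
  qed
  have upper: "t \<le> m" if "t \<in> ?R" for t
  proof (rule ccontr)
    assume "\<not> t \<le> m"
    then have "y t = ?I" using that Inf_after[of 0 t] m by auto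
    moreover obtain d where "d > 0" "\<And>u. u\<in>{0..s} \<Longrightarrow> y u < ?I + d \<Longrightarrow> \<bar>u - m\<bar> < t - m"
      using wp[of "t - m"] \<open>\<not> t \<le> m\<close> by force
    ultimately show False using that \<open>\<not> t \<le> m\<close> by force
  qed
  have lower: "\<exists>t\<in>?R. t > m - e" if "e > 0" for e
  proof -
    define a where "a = max (m / 2) (m - e / 2)"
    define b where "b = (m + s) / 2"
    have ab: "0 \<le> a" "a < m" "m < b" "b < s" "m - e < a" using m \<open>e > 0\<close> by (auto simp: a_def b_def)
    obtain d where d: "d > 0" "\<And>t. t\<in>{0..s} \<Longrightarrow> y t < ?I + d \<Longrightarrow> \<bar>t - m\<bar> < m - a"
      using wp[of "m - a"] ab by auto
    have "?I + d \<le> Inf (y ` {0..a})"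
    proof (rule cINF_greatest)
      fix t assume t: "t \<in> {0..a}"
      then show "?I + d \<le> y t" using d(2)[of t] ab by (cases "y t < ?I + d") (auto simp: abs_less_iff)
    qed (use ab in auto)
    then have "Inf (y ` {a..b}) < Inf (y ` {0..a})" using Inf_after[of a b] ab d(1) by auto
    from new_record[OF ab(1) _ this] obtain t where "t\<in>{a..b}" "y t = Inf (y ` {0..t})" using ab by auto
    then show ?thesis using ab by (intro bexI[of _ t]) auto
  qed
  have "Sup ?R = m"
  proof (rule cSup_eq_non_empty)
    show "?R \<noteq> {}" using lower[of 1] by auto
    show "\<And>t. t \<in> ?R \<Longrightarrow> t \<le> m" by (rule upper)
    show "m \<le> u" if "\<And>t. t \<in> ?R \<Longrightarrow> t \<le> u" for u
    proof (rule ccontr)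
      assume "\<not> m \<le> u"
      then obtain t where "t \<in> ?R" "t > m - (m - u)" using lower[of "m - u"] by auto
      then show False using that by force
    qed
  qed
  then show ?thesis using m by (simp add: F_right_def running_inf_def)
qed

lemma F_right_bounds:
  assumes "0 \<le> s"
  shows "F_right y s \<in> {0..s}"
proof (cases "s = 0")
  case False
  have "y 0 = Inf (y ` {0..0})" by simp
  then have "0 \<in> {t\<in>{0..<s}. y t = Inf (y ` {0..t})}" using False assms by auto
  then have "0 \<le> Sup {t\<in>{0..<s}. y t = Inf (y ` {0..t})}"
    by (intro cSup_upper) (auto simp: bdd_above_def intro!: exI[of _ s])
  moreover have "Sup {t\<in>{0..<s}. y t = Inf (y ` {0..t})} \<le> s"
    using \<open>0 \<in> _\<close> by (intro cSup_least) auto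
  ultimately show ?thesis using False by (auto simp: F_right_def running_inf_def)
qed (auto simp: F_right_def)

text \<open>Measurability of \<open>F_right\<close> rests on this description by countably many infima. A record only yields a weak
  inequality between the infima of two windows; the absence of ties makes it strict.\<close>

lemma F_right_gt_iff:
  assumes B: "dense_times B" "no_ties B y" and c: "0 \<le> c" and s: "0 \<le> s"
  shows "F_right y s > c \<longleftrightarrow> (\<exists>a\<in>\<rat>. \<exists>b\<in>B. c < a \<and> a \<le> b \<and> b < s \<and> Inf (y ` {a..b}) < Inf (y ` {0..a}))"
    (is "_ \<longleftrightarrow> ?rhs")
proof (cases "s = 0")
  case True
  then show ?thesis using c by (auto simp: F_right_def)
next
  case False
  let ?R = "{t\<in>{0..<s}. y t = Inf (y ` {0..t})}"
  have F: "F_right y s = Sup ?R" using False by (simp add: F_right_def running_inf_def)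
  have bddR: "bdd_above ?R" by (auto simp: bdd_above_def intro!: exI[of _ s])
  have "0 \<in> ?R" using False s by auto
  show ?thesis
  proof
    assume "F_right y s > c"
    then obtain t where t: "t \<in> ?R" "c < t"
      unfolding F using \<open>0 \<in> ?R\<close> less_cSup_iff[OF _ bddR, of c] by blast
    obtain a where a: "a \<in> \<rat>" "c < a" "a < t" using Rats_dense_in_real[of c t] t by auto
    obtain b where b: "b \<in> B" "t < b" "b < s" using dense_timesE[OF B(1), of t s] t(1) by auto
    obtain l where l: "l \<in> \<rat>" "b - t < l" "l < b - a" using Rats_dense_in_real[of "b - t" "b - a"] a by auto
    have "Inf (y ` {0..a}) \<noteq> Inf (y ` {b - l..b})"
      using B(2) a(1) b(1) l t a b c unfolding no_ties_def by auto
    moreover have "Inf (y ` {b - l..b}) \<le> y t" using l b by (intro Inf_le) auto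
    moreover have "y t \<le> Inf (y ` {0..a})" using t(1) a c Inf_mono[of 0 0 a t] by auto
    moreover have "Inf (y ` {a..b}) \<le> Inf (y ` {b - l..b})" using l a b t by (intro Inf_mono) auto
    ultimately show ?rhs using a b by (intro bexI[of _ a] bexI[of _ b]) auto
  next
    assume ?rhs
    then obtain a b where ab: "c < a" "a \<le> b" "b < s" "Inf (y ` {a..b}) < Inf (y ` {0..a})" by auto
    from new_record[OF _ ab(2,4)] obtain t where "t\<in>{a..b}" "y t = Inf (y ` {0..t})" using c ab by auto
    then have "t \<le> Sup ?R" using ab c bddR by (intro cSup_upper) auto
    then show "F_right y s > c" using F \<open>t \<in> _\<close> ab by auto
  qed
qed

end

text \<open>A positive value at \<open>s\<close> would contradict lower semicontinuity, a negative one right-continuity.\<close>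

lemma last_nonpos:
  assumes "sn_path x" "0 < T" "x T > 0" and s: "s = Sup {t \<in> {0..T}. x t \<le> 0}"
  shows "0 \<le> s" "s < T" "x s = 0" "\<And>t. s < t \<Longrightarrow> t \<le> T \<Longrightarrow> x t > 0"
proof -
  let ?S = "{t \<in> {0..T}. x t \<le> 0}"
  have x0: "x 0 = 0" using assms(1) by (auto simp: sn_path_def)
  have S0: "0 \<in> ?S" using x0 assms by auto
  have bdd: "bdd_above ?S" by (auto simp: bdd_above_def)
  show s0: "0 \<le> s" unfolding s using S0 bdd by (rule cSup_upper)
  show after: "x t > 0" if "s < t" "t \<le> T" for t
  proof (rule ccontr)
    assume "\<not> x t > 0"
    then have "t \<le> s" unfolding s using that s0 bdd by (intro cSup_upper) auto
    then show False using that by simp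
  qed
  have sT: "s \<le> T" unfolding s using S0 by (intro cSup_least) auto
  have le: "x s \<le> 0"
  proof (rule ccontr)
    assume *: "\<not> x s \<le> 0"
    obtain d where d: "d > 0" "\<And>u. \<bar>u - s\<bar> < d \<Longrightarrow> x u > x s - x s"
      using sn_path_lsc[OF assms(1), of "x s" s] * by (metis not_le)
    obtain u where "u \<in> ?S" "s - d < u" using less_cSup_iff[of ?S "s - d"] S0 bdd d(1) s by auto
    moreover have "u \<le> s" using \<open>u \<in> ?S\<close> bdd unfolding s by (intro cSup_upper) auto
    ultimately show False using d(2)[of u] by auto
  qed
  then show sT': "s < T" using sT assms(3) by (cases "s = T") auto
  show "x s = 0"
  proof (rule ccontr)
    assume "x s \<noteq> 0"
    then have "x s < 0" using le by simp
    then obtain d where d: "d > 0" "\<And>u. s \<le> u \<Longrightarrow> u < s + d \<Longrightarrow> \<bar>x u - x s\<bar> < - x s"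
      using right_contD[OF sn_path_right_cont[OF assms(1)], of "- x s" s] by (metis neg_0_less_iff_less)
    define u where "u = min T (s + d / 2)"
    have "s < u" "u \<le> T" "u < s + d" using d sT' by (auto simp: u_def)
    then show False using after[of u] d(2)[of u] by auto
  qed
qed

text \<open>If the path were nonnegative just before \<open>s\<close>, its infimum over a window around \<open>s\<close> would be 0, which is
  also the infimum over \<open>[0, 0]\<close>. In particular \<open>s\<close> is not reached by a jump.\<close>

lemma last_nonpos_left:
  assumes x: "sn_path x" "0 < T" "x T > 0" and s: "s = Sup {t \<in> {0..T}. x t \<le> 0}" and "0 < s"
    and B: "dense_times B" "no_ties B x"
  shows "\<And>e. e > 0 \<Longrightarrow> \<exists>t. s - e < t \<and> t < s \<and> 0 \<le> t \<and> x t < 0" "(x \<longlongrightarrow> 0) (at_left s)"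
proof -
  interpret record_path x using x(1) by (rule sn_path_record_path)
  note l = last_nonpos[OF x s]
  show neg: "\<exists>t. s - e < t \<and> t < s \<and> 0 \<le> t \<and> x t < 0" if e: "e > 0" for e
  proof -
    obtain b where b: "b \<in> B" "s < b" "b < T" using dense_timesE[OF B(1) l(1,2)] by blast
    obtain k where k: "k \<in> \<rat>" "b - s < k" "k < b - max 0 (s - e)"
      using Rats_dense_in_real[of "b - s" "b - max 0 (s - e)"] e \<open>0 < s\<close> by auto
    have "Inf (x ` {0..0}) \<noteq> Inf (x ` {b - k..b})"
      using B(2) b(1) k b l(1) unfolding no_ties_def by (intro B(2)[unfolded no_ties_def, rule_format]) auto
    moreover have "Inf (x ` {b - k..b}) \<le> x s" using k b by (intro Inf_le) auto
    ultimately have "Inf (x ` {b - k..b}) < 0" using zero[of 0] l(3) by auto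
    then obtain t where t: "t \<in> {b - k..b}" "x t < 0"
      using near_Inf[of "b - k" b "- Inf (x ` {b - k..b})"] k b by auto
    have "t < s" using l(4)[of t] l(3) t b by (cases t s rule: linorder_cases) auto
    then show ?thesis using t k by (intro exI[of _ t]) auto
  qed
  obtain L where L: "L \<ge> x s" "(x \<longlongrightarrow> L) (at_left s)" using x(1) unfolding sn_path_def by blast
  have "L \<le> 0"
  proof (rule ccontr)
    assume "\<not> L \<le> 0"
    then obtain d where d: "d > 0" "\<And>t. s - d < t \<Longrightarrow> t < s \<Longrightarrow> \<bar>x t - L\<bar> < L"
      using left_limD[OF L(2), of L] by auto
    obtain t where "s - d < t" "t < s" "x t < 0" using neg[OF d(1)] by auto
    then show False using d(2)[of t] by auto
  qed
  then have "L = 0" using L(1) l(3) by auto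
  then show "(x \<longlongrightarrow> 0) (at_left s)" using L(2) by simp
qed

section \<open>The past, the gap and the future of two windows\<close>

lemma char_convolution:
  assumes "real_distribution A" "real_distribution B"
  shows "char (distr (A \<Otimes>\<^sub>M B) borel (\<lambda>(a, b). a + b)) t = char A t * char B t"
proof -
  interpret A: real_distribution A by fact
  interpret B: real_distribution B by fact
  interpret pair_prob_space A B ..
  have [measurable]: "(\<lambda>x. iexp (t * x)) \<in> borel_measurable borel" by measurable
  have int: "integrable (A \<Otimes>\<^sub>M B) (\<lambda>(a, b). iexp (t * (a + b)))"
    by (intro integrable_const_bound[of _ 1]) (auto simp: split_beta)
  have "char (distr (A \<Otimes>\<^sub>M B) borel (\<lambda>(a, b). a + b)) t = (CLINT z|A \<Otimes>\<^sub>M B. (case z of (a, b) \<Rightarrow> iexp (t * (a + b))))"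
    by (simp add: char_def integral_distr split_beta)
  also have "\<dots> = (CLINT a|A. CLINT b|B. iexp (t * (a + b)))"
    using integral_fst[OF int] by simp
  also have "\<dots> = (CLINT a|A. iexp (t * a) * char B t)"
    by (simp add: char_def distrib_left exp_add)
  also have "\<dots> = char A t * char B t"
    by (simp add: char_def)
  finally show ?thesis .
qed

lemma (in prob_space) char_tendsto:
  assumes [measurable]: "\<And>n. W n \<in> borel_measurable M" "V \<in> borel_measurable M"
    and lim: "\<And>\<omega>. \<omega> \<in> space M \<Longrightarrow> (\<lambda>n. W n \<omega>) \<longlonglongrightarrow> V \<omega>"
  shows "(\<lambda>n. char (distr M borel (W n)) t) \<longlonglongrightarrow> char (distr M borel V) t"
proof -
  have "(\<lambda>n. CLINT \<omega>|M. iexp (t * W n \<omega>)) \<longlonglongrightarrow> (CLINT \<omega>|M. iexp (t * V \<omega>))"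
  proof (rule integral_dominated_convergence[where w = "\<lambda>_. 1"])
    show "AE x in M. (\<lambda>i. iexp (t * W i x)) \<longlonglongrightarrow> iexp (t * V x)"
      by (intro AE_I2 tendsto_intros lim)
  qed auto
  then show ?thesis by (simp add: char_def integral_distr)
qed

locale sn_levy = levy_process M X for M :: "'a measure" and X :: "real \<Rightarrow> 'a \<Rightarrow> real" +
  assumes paths: "\<And>\<omega>. \<omega> \<in> space M \<Longrightarrow> sn_path (\<lambda>t. X t \<omega>)"
begin

lemma X_nonpos: "\<omega> \<in> space M \<Longrightarrow> t \<le> 0 \<Longrightarrow> X t \<omega> = 0"
  using paths by (auto simp: sn_path_def)

lemma X_measurable [measurable]: "X t \<in> borel_measurable M"
proof (cases "t \<ge> 0")
  case False
  have "X t \<in> borel_measurable M \<longleftrightarrow> (\<lambda>_. 0::real) \<in> borel_measurable M"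
    using X_nonpos False by (intro measurable_cong) auto
  then show ?thesis by simp
qed (rule measurable_X)

lemma path_right_cont: "\<omega> \<in> space M \<Longrightarrow> right_cont (\<lambda>t. X t \<omega>)"
  using paths sn_path_right_cont by auto

text \<open>By right-continuity, \<open>X u\<close> is the limit of the values at the grid times next to the right of \<open>u\<close>.\<close>

lemma X_joint_measurable: "(\<lambda>(u, \<omega>). X u \<omega>) \<in> borel_measurable (borel \<Otimes>\<^sub>M M)"
proof -
  define r where "r n u = real_of_int (\<lfloor>u * real (Suc n)\<rfloor> + 1) / real (Suc n)" for n u
  have "(\<lambda>z. X (r n (fst z)) (snd z)) \<in> borel_measurable (borel \<Otimes>\<^sub>M M)" for n
    unfolding r_def
    by (rule measurable_compose_countable[where f = "\<lambda>i z. X (real_of_int (i + 1) / real (Suc n)) (snd z)"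
          and g = "\<lambda>z. \<lfloor>fst z * real (Suc n)\<rfloor>"]) measurable
  moreover have "(\<lambda>n. X (r n (fst z)) (snd z)) \<longlonglongrightarrow> X (fst z) (snd z)" if "z \<in> space (borel \<Otimes>\<^sub>M M)" for z
  proof (rule right_cont_tendsto[OF path_right_cont])
    show "snd z \<in> space M" using that by (auto simp: space_pair_measure)
    have lo: "fst z \<le> r n (fst z)" and up: "r n (fst z) \<le> fst z + 1 / real (Suc n)" for n
    proof -
      have "fst z * real (Suc n) \<le> real_of_int (\<lfloor>fst z * real (Suc n)\<rfloor> + 1)" by linarith
      then show "fst z \<le> r n (fst z)" unfolding r_def by (subst pos_le_divide_eq) auto
      have "real_of_int (\<lfloor>fst z * real (Suc n)\<rfloor> + 1) \<le> (fst z + 1 / real (Suc n)) * real (Suc n)"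
        by (simp add: distrib_right del: of_nat_Suc)
      then show "r n (fst z) \<le> fst z + 1 / real (Suc n)" unfolding r_def by (subst pos_divide_le_eq) auto
    qed
    show "(\<lambda>n. r n (fst z)) \<longlonglongrightarrow> fst z"
    proof (rule tendsto_sandwich[OF _ _ tendsto_const])
      show "(\<lambda>n. fst z + 1 / real (Suc n)) \<longlonglongrightarrow> fst z"
        using tendsto_add[OF tendsto_const LIMSEQ_Suc[OF lim_const_over_n[of 1]], of "fst z"] by simp
    qed (use lo up in auto)
    show "\<forall>\<^sub>F n in sequentially. fst z \<le> r n (fst z)" using lo by simp
  qed
  ultimately have "(\<lambda>z. X (fst z) (snd z)) \<in> borel_measurable (borel \<Otimes>\<^sub>M M)"
    by (rule borel_measurable_LIMSEQ_metric)
  then show ?thesis by (simp add: split_beta')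
qed

lemma X_compose_measurable [measurable (raw)]:
  assumes [measurable]: "f \<in> borel_measurable N" "g \<in> measurable N M"
  shows "(\<lambda>x. X (f x) (g x)) \<in> borel_measurable N"
proof -
  have "(\<lambda>x. (f x, g x)) \<in> measurable N (borel \<Otimes>\<^sub>M M)" by measurable
  from measurable_compose[OF this X_joint_measurable] show ?thesis by simp
qed

lemma signed_record_path:
  assumes "c = 1 \<or> c = -1" "\<omega> \<in> space M"
  shows "record_path (\<lambda>t. c * X t \<omega>)"
  using assms sn_path_record_path[OF paths] sn_path_record_path_uminus[OF paths] by auto

lemma grid_Min_X:
  assumes "c = 1 \<or> c = -1" "\<omega> \<in> space M" "a \<le> b"
  shows "(\<lambda>n. Min ((\<lambda>i. c * X (a + real i * (b - a) / real (Suc n)) \<omega>) ` {..Suc n})) \<longlonglongrightarrow> Inf ((\<lambda>t. c * X t \<omega>) ` {a..b})"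
proof -
  interpret record_path "\<lambda>t. c * X t \<omega>" using assms by (intro signed_record_path)
  show ?thesis by (rule grid_Min_tendsto_Inf[OF rc bdd assms(3)])
qed

lemma Inf_measurable [measurable]:
  assumes "c = 1 \<or> c = -1"
  shows "(\<lambda>\<omega>. Inf ((\<lambda>t. c * X t \<omega>) ` {a..b})) \<in> borel_measurable M"
proof (cases "a \<le> b")
  case True
  show ?thesis
  proof (rule borel_measurable_LIMSEQ_metric[OF _ grid_Min_X[OF assms _ True]])
    show "(\<lambda>\<omega>. Min ((\<lambda>i. c * X (a + real i * (b - a) / real (Suc n)) \<omega>) ` {..Suc n})) \<in> borel_measurable M" for n
      by (intro borel_measurable_Max2 borel_measurable_Min) measurable
  qed
qed auto

definition inc_law :: "real \<Rightarrow> real measure" where "inc_law h = distr M borel (X h)"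

lemma inc_law_distribution [simp, intro]: "real_distribution (inc_law h)"
  by (auto simp: inc_law_def)

lemma increment_law: "s \<ge> 0 \<Longrightarrow> t \<ge> 0 \<Longrightarrow> distr M borel (\<lambda>\<omega>. X (s + t) \<omega> - X s \<omega>) = inc_law t"
  by (simp add: inc_law_def stationary_increments)

lemma indep_blocks:
  assumes t: "0 \<le> t 0" "\<And>i. i < N \<Longrightarrow> t i < t (Suc i)"
    and K: "\<And>j. j \<in> L \<Longrightarrow> K j \<subseteq> {..<N::nat}" "disjoint_family_on K L"
    and F: "\<And>j. j \<in> L \<Longrightarrow> F j \<in> borel_measurable (PiM (K j) (\<lambda>_. borel))"
  shows "indep_vars (\<lambda>_. borel) (\<lambda>j \<omega>. F j (\<lambda>i\<in>K j. X (t (Suc i)) \<omega> - X (t i) \<omega>)) L"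
  using indep_vars_compose2[OF indep_vars_restrict[OF indep_increments[of t N] K] F] t by simp

lemma grid_increments_iid:
  assumes "p \<ge> 0" "h > 0" "n > 0"
  shows "distr M (PiM {..<n} (\<lambda>_. borel)) (\<lambda>\<omega>. \<lambda>i\<in>{..<n}. X (p + real (Suc i) * h) \<omega> - X (p + real i * h) \<omega>)
     = PiM {..<n} (\<lambda>_. inc_law h)"
proof -
  let ?t = "\<lambda>i. p + real i * h"
  have "indep_vars (\<lambda>_. borel) (\<lambda>i \<omega>. X (?t (Suc i)) \<omega> - X (?t i) \<omega>) {..<n}"
    using assms by (intro indep_increments) (auto simp: algebra_simps)
  then have "distr M (PiM {..<n} (\<lambda>_. borel)) (\<lambda>\<omega>. \<lambda>i\<in>{..<n}. X (?t (Suc i)) \<omega> - X (?t i) \<omega>)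
     = PiM {..<n} (\<lambda>i. distr M borel (\<lambda>\<omega>. X (?t (Suc i)) \<omega> - X (?t i) \<omega>))"
    using assms by (subst (asm) indep_vars_iff_distr_eq_PiM') auto
  also have "\<dots> = PiM {..<n} (\<lambda>_. inc_law h)"
  proof (intro PiM_cong refl)
    fix i
    have "X (?t (Suc i)) = X (?t i + h)" by (simp add: algebra_simps)
    then show "distr M borel (\<lambda>\<omega>. X (?t (Suc i)) \<omega> - X (?t i) \<omega>) = inc_law h"
      using increment_law[of "?t i" h] assms by simp
  qed
  finally show ?thesis .
qed

text \<open>The infima over \<open>[0, q]\<close> and \<open>[p, p + l]\<close> agree if and only if the drop before \<open>q\<close>, the increment over the
  gap \<open>[q, p]\<close> and the dip after \<open>p\<close> add up to zero. On grids these three quantities are functions of disjoint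
  blocks of increments.\<close>

definition drop_before :: "real \<Rightarrow> real \<Rightarrow> 'a \<Rightarrow> real" where
  "drop_before c q \<omega> = c * X q \<omega> - Inf ((\<lambda>t. c * X t \<omega>) ` {0..q})"

definition dip_after :: "real \<Rightarrow> real \<Rightarrow> real \<Rightarrow> 'a \<Rightarrow> real" where
  "dip_after c p l \<omega> = Inf ((\<lambda>t. c * X t \<omega>) ` {p..p + l}) - c * X p \<omega>"

lemma drop_before_measurable [measurable]: "c = 1 \<or> c = -1 \<Longrightarrow> drop_before c q \<in> borel_measurable M"
  and dip_after_measurable [measurable]: "c = 1 \<or> c = -1 \<Longrightarrow> dip_after c p l \<in> borel_measurable M"
  unfolding drop_before_def[abs_def] dip_after_def[abs_def] by measurable

definition drop_grid :: "real \<Rightarrow> real \<Rightarrow> nat \<Rightarrow> 'a \<Rightarrow> real" where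
  "drop_grid c q n \<omega> = c * X q \<omega> - Min ((\<lambda>i. c * X (0 + real i * (q - 0) / real (Suc n)) \<omega>) ` {..Suc n})"

definition dip_grid :: "real \<Rightarrow> real \<Rightarrow> real \<Rightarrow> nat \<Rightarrow> 'a \<Rightarrow> real" where
  "dip_grid c p l n \<omega> = Min ((\<lambda>i. c * X (p + real i * (p + l - p) / real (Suc n)) \<omega>) ` {..Suc n}) - c * X p \<omega>"

lemma drop_grid_measurable [measurable]: "drop_grid c q n \<in> borel_measurable M"
  and dip_grid_measurable [measurable]: "dip_grid c p l n \<in> borel_measurable M"
  unfolding drop_grid_def[abs_def] dip_grid_def[abs_def] by measurable

lemma drop_grid_tendsto: "c = 1 \<or> c = -1 \<Longrightarrow> 0 \<le> q \<Longrightarrow> \<omega> \<in> space M \<Longrightarrow> (\<lambda>n. drop_grid c q n \<omega>) \<longlonglongrightarrow> drop_before c q \<omega>"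
  unfolding drop_grid_def drop_before_def by (intro tendsto_intros grid_Min_X)

lemma dip_grid_tendsto: "c = 1 \<or> c = -1 \<Longrightarrow> 0 \<le> l \<Longrightarrow> \<omega> \<in> space M \<Longrightarrow> (\<lambda>n. dip_grid c p l n \<omega>) \<longlonglongrightarrow> dip_after c p l \<omega>"
  unfolding dip_grid_def dip_after_def by (intro tendsto_intros grid_Min_X) auto

lemma Min_diff_const:
  fixes f :: "nat \<Rightarrow> real"
  shows "Min (f ` {..n}) - a = Min ((\<lambda>i. f i - a) ` {..n})"
  using Min_add_commute[of "{..n}" f "- a"] by simp

lemma dip_grid_law:
  assumes "p \<ge> 0" "l > 0"
  shows "distr M borel (dip_grid c p l n) = distr M borel (dip_grid c 0 l n)"
proof -
  define h where "h = l / real (Suc n)"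
  have h: "h > 0" using assms by (simp add: h_def)
  define H where "H v = Min ((\<lambda>i. c * (\<Sum>j<i. v j)) ` {..Suc n})" for v :: "nat \<Rightarrow> real"
  have [measurable]: "H \<in> borel_measurable (PiM {..<Suc n} (\<lambda>_. borel))"
    unfolding H_def by (intro borel_measurable_Min borel_measurable_times borel_measurable_const borel_measurable_sum) (auto intro!: measurable_component_singleton)
  have *: "distr M borel (dip_grid c p l n) = distr (PiM {..<Suc n} (\<lambda>_. inc_law h)) borel H" if p: "p \<ge> 0" for p
  proof -
    let ?xi = "\<lambda>\<omega>. \<lambda>i\<in>{..<Suc n}. X (p + real (Suc i) * h) \<omega> - X (p + real i * h) \<omega>"
    have "dip_grid c p l n \<omega> = H (?xi \<omega>)" for \<omega>
    proof -
      have "c * X (p + real i * h) \<omega> - c * X p \<omega> = c * (\<Sum>j<i. ?xi \<omega> j)" if "i \<le> Suc n" for i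
      proof -
        have "(\<Sum>j<i. ?xi \<omega> j) = (\<Sum>j\<in>{0..<i}. X (p + real (Suc j) * h) \<omega> - X (p + real j * h) \<omega>)"
          using that by (intro sum.cong) auto
        also have "\<dots> = X (p + real i * h) \<omega> - X p \<omega>"
          using sum_Suc_diff'[of 0 i "\<lambda>j. X (p + real j * h) \<omega>"] by simp
        finally show ?thesis by (simp add: right_diff_distrib)
      qed
      then show ?thesis
        unfolding dip_grid_def H_def Min_diff_const
        by (intro arg_cong[where f = Min] image_cong) (auto simp: h_def)
    qed
    then have "dip_grid c p l n = H \<circ> ?xi" by (auto simp: comp_def)
    moreover have "distr M borel (H \<circ> ?xi) = distr (distr M (PiM {..<Suc n} (\<lambda>_. borel)) ?xi) borel H"
      by (rule distr_distr[symmetric]) (auto intro!: measurable_restrict)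
    ultimately have "distr M borel (dip_grid c p l n) = distr (distr M (PiM {..<Suc n} (\<lambda>_. borel)) ?xi) borel H"
      by simp
    then show ?thesis using grid_increments_iid[OF p h, of "Suc n"] by simp
  qed
  from *[OF assms(1)] *[of 0] show ?thesis by simp
qed

text \<open>The grid minima have the same law by stationarity of the increments, and characteristic functions carry
  this over to their limit.\<close>

lemma dip_after_law:
  assumes c: "c = 1 \<or> c = -1" and "p \<ge> 0" "l > 0"
  shows "distr M borel (dip_after c p l) = distr M borel (dip_after c 0 l)"
proof (rule Levy_uniqueness)
  show "char (distr M borel (dip_after c p l)) = char (distr M borel (dip_after c 0 l))"
  proof
    fix t
    have "(\<lambda>n. char (distr M borel (dip_grid c p l n)) t) \<longlonglongrightarrow> char (distr M borel (dip_after c p l)) t" for p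
      by (intro char_tendsto dip_grid_tendsto) (use assms in auto)
    from this[of p] this[of 0] show "char (distr M borel (dip_after c p l)) t = char (distr M borel (dip_after c 0 l)) t"
      by (intro LIMSEQ_unique) (auto simp: dip_grid_law[OF assms(2,3)])
  qed
qed (use c in auto)

lemma char_drop_mid_dip_grid:
  assumes c: "c = 1 \<or> c = -1" and q: "0 \<le> q" and h: "0 < h" and l: "0 < l"
  defines "p \<equiv> q + h"
  shows "char (distr M borel (\<lambda>\<omega>. drop_grid c q n \<omega> + (c * X p \<omega> - c * X q \<omega>) + dip_grid c p l n \<omega>)) t =
    char (distr M borel (drop_grid c q n)) t * char (distr M borel (\<lambda>\<omega>. c * X p \<omega> - c * X q \<omega>)) t
      * char (distr M borel (dip_grid c p l n)) t"
proof -
  (* The grid times have to increase strictly, so for q = 0 the first block of increments is empty. *)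
  define m where "m = (if q = 0 then 0 else Suc n)"
  define N where "N = m + 1 + Suc n"
  define T where "T i = (if i \<le> m then real i * q / real (Suc n) else p + real (i - m - 1) * l / real (Suc n))" for i
  have Tm: "T m = q" "T 0 = 0" by (auto simp: T_def m_def)
  have T0: "T i < T (Suc i)" if "i < N" for i
  proof -
    consider "i < m" | "i = m" | "i > m" by linarith
    then show ?thesis
    proof cases
      case 1
      then have "q > 0" using q by (auto simp: m_def split: if_splits)
      then have "real i * q / real (Suc n) < real (Suc i) * q / real (Suc n)"
        by (intro divide_strict_right_mono mult_strict_right_mono) auto
      then show ?thesis using 1 by (simp add: T_def del: of_nat_Suc)
    next
      case 2
      then show ?thesis using Tm h by (simp add: T_def[of "Suc m"] p_def)
    next
      case 3
      have "real (i - m - 1) * l / real (Suc n) < real (Suc i - m - 1) * l / real (Suc n)"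
        using 3 l by (intro divide_strict_right_mono mult_strict_right_mono) auto
      then show ?thesis using 3 by (simp add: T_def del: of_nat_Suc)
    qed
  qed
  define K :: "nat \<Rightarrow> nat set" where "K j = (if j = 0 then {..<m} else if j = 1 then {m} else {m+1..<N})" for j
  define F where "F j v = (if j = 0 then - Min ((\<lambda>i. - c * (\<Sum>k\<in>{i..<m}. v k)) ` {..m})
     else if j = 1 then c * v m else Min ((\<lambda>i. c * (\<Sum>k\<in>{m+1..<m+1+i}. v k)) ` {..Suc n}))" for j :: nat and v :: "nat \<Rightarrow> real"
  let ?xi = "\<lambda>i \<omega>. X (T (Suc i)) \<omega> - X (T i) \<omega>"
  define Y where "Y j \<omega> = F j (\<lambda>i\<in>K j. ?xi i \<omega>)" for j \<omega>
  have "indep_vars (\<lambda>_. borel) Y {0, 1, 2}"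
    unfolding Y_def[abs_def]
  proof (rule indep_blocks[where N = N])
    show "disjoint_family_on K {0, 1, 2}" by (auto simp: disjoint_family_on_def K_def)
    show "F j \<in> borel_measurable (Pi\<^sub>M (K j) (\<lambda>_. borel))" if "j \<in> {0,1,2}" for j
    proof -
      have m1: "(\<lambda>v. v k) \<in> borel_measurable (Pi\<^sub>M (K j) (\<lambda>_. borel))" if "k \<in> K j" for k
        using that by (rule measurable_component_singleton)
      consider "j = 0" | "j = 1" | "j = 2" using \<open>j \<in> _\<close> by auto
      then show ?thesis
      proof cases
        case 1
        have "F j = (\<lambda>v. - Min ((\<lambda>i. - c * (\<Sum>k\<in>{i..<m}. v k)) ` {..m}))"
          using 1 by (simp add: F_def fun_eq_iff)
        also have "\<dots> \<in> borel_measurable (Pi\<^sub>M (K j) (\<lambda>_. borel))"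
          by (rule borel_measurable_uminus, rule borel_measurable_Min)
             (auto intro!: borel_measurable_times borel_measurable_const borel_measurable_sum m1 simp: K_def 1)
        finally show ?thesis .
      next
        case 2
        have "F j = (\<lambda>v. c * v m)" using 2 by (simp add: F_def fun_eq_iff)
        also have "\<dots> \<in> borel_measurable (Pi\<^sub>M (K j) (\<lambda>_. borel))"
          by (intro borel_measurable_times borel_measurable_const m1) (simp add: K_def 2)
        finally show ?thesis .
      next
        case 3
        have "F j = (\<lambda>v. Min ((\<lambda>i. c * (\<Sum>k\<in>{m+1..<m+1+i}. v k)) ` {..Suc n}))"
          using 3 by (simp add: F_def fun_eq_iff)
        also have "\<dots> \<in> borel_measurable (Pi\<^sub>M (K j) (\<lambda>_. borel))"
          by (rule borel_measurable_Min, simp, rule borel_measurable_times[OF borel_measurable_const borel_measurable_sum], rule m1)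
             (auto simp: K_def N_def 3)
        finally show ?thesis .
      qed
    qed
  qed (use T0 Tm in \<open>auto simp: K_def N_def\<close>)
  then have "char (distr M borel (\<lambda>\<omega>. \<Sum>j\<in>{0,1,2}. Y j \<omega>)) t = (\<Prod>j\<in>{0,1,2}. char (distr M borel (Y j)) t)"
    by (rule char_distr_sum)
  moreover have "Y 0 = drop_grid c q n"
  proof
    fix \<omega>
    have "(\<Sum>k\<in>{i..<m}. (\<lambda>k\<in>K 0. ?xi k \<omega>) k) = X q \<omega> - X (T i) \<omega>" if "i \<le> m" for i
    proof -
      have "(\<Sum>k\<in>{i..<m}. (\<lambda>k\<in>K 0. ?xi k \<omega>) k) = (\<Sum>k\<in>{i..<m}. ?xi k \<omega>)"
        by (intro sum.cong) (auto simp: K_def)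
      then show ?thesis using sum_Suc_diff'[OF that, of "\<lambda>k. X (T k) \<omega>"] Tm by simp
    qed
    then have "(\<lambda>i. - c * (\<Sum>k\<in>{i..<m}. (\<lambda>k\<in>K 0. ?xi k \<omega>) k)) ` {..m} = (\<lambda>i. c * X (T i) \<omega> - c * X q \<omega>) ` {..m}"
      by (intro image_cong refl) (simp only: atMost_iff, simp add: algebra_simps)
    then have "Y 0 \<omega> = - Min ((\<lambda>i. c * X (T i) \<omega> - c * X q \<omega>) ` {..m})"
      unfolding Y_def F_def by simp
    also have "\<dots> = c * X q \<omega> - Min ((\<lambda>i. c * X (T i) \<omega>) ` {..m})"
      by (simp add: Min_diff_const[symmetric])
    also have "(\<lambda>i. c * X (T i) \<omega>) ` {..m} = (\<lambda>i. c * X (0 + real i * (q - 0) / real (Suc n)) \<omega>) ` {..Suc n}"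
    proof (cases "q = 0")
      case True
      then show ?thesis using Tm by (auto simp: m_def)
    next
      case False
      then show ?thesis by (intro image_cong) (auto simp: m_def T_def)
    qed
    finally show "Y 0 \<omega> = drop_grid c q n \<omega>" by (simp add: drop_grid_def)
  qed
  moreover have "Y 1 = (\<lambda>\<omega>. c * X p \<omega> - c * X q \<omega>)"
    using Tm by (auto simp: Y_def F_def K_def T_def[of "Suc m"] right_diff_distrib)
  moreover have "Y 2 = dip_grid c p l n"
  proof
    fix \<omega>
    have "(\<Sum>k\<in>{m+1..<m+1+i}. (\<lambda>k\<in>K 2. ?xi k \<omega>) k) = X (p + real i * (p + l - p) / real (Suc n)) \<omega> - X p \<omega>"
      if "i \<le> Suc n" for i
    proof -
      have "(\<Sum>k\<in>{m+1..<m+1+i}. (\<lambda>k\<in>K 2. ?xi k \<omega>) k) = (\<Sum>k\<in>{m+1..<m+1+i}. ?xi k \<omega>)"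
        using that by (intro sum.cong) (auto simp: K_def N_def)
      also have "\<dots> = X (T (m + 1 + i)) \<omega> - X (T (m + 1)) \<omega>"
        using sum_Suc_diff'[of "m + 1" "m + 1 + i" "\<lambda>k. X (T k) \<omega>"] by simp
      finally show ?thesis by (simp add: T_def)
    qed
    then have "Y 2 \<omega> = Min ((\<lambda>i. c * X (p + real i * (p + l - p) / real (Suc n)) \<omega> - c * X p \<omega>) ` {..Suc n})"
      unfolding Y_def F_def by (simp add: right_diff_distrib cong: image_cong_simp)
    then show "Y 2 \<omega> = dip_grid c p l n \<omega>" by (simp only: dip_grid_def Min_diff_const)
  qed
  ultimately show ?thesis by (simp add: add.assoc mult.assoc)
qed

lemma char_drop_mid_dip:
  assumes c: "c = 1 \<or> c = -1" and q: "0 \<le> q" and h: "0 < h" and l: "0 < l"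
  defines "p \<equiv> q + h"
  shows "char (distr M borel (\<lambda>\<omega>. drop_before c q \<omega> + (c * X p \<omega> - c * X q \<omega>) + dip_after c p l \<omega>)) t =
    char (distr M borel (drop_before c q)) t * char (distr M borel (\<lambda>\<omega>. c * X h \<omega>)) t
      * char (distr M borel (dip_after c 0 l)) t"
proof -
  note [measurable] = drop_before_measurable[OF c] dip_after_measurable[OF c]
  have 1: "(\<lambda>n. char (distr M borel (\<lambda>\<omega>. drop_grid c q n \<omega> + (c * X p \<omega> - c * X q \<omega>) + dip_grid c p l n \<omega>)) t) \<longlonglongrightarrow>
     char (distr M borel (\<lambda>\<omega>. drop_before c q \<omega> + (c * X p \<omega> - c * X q \<omega>) + dip_after c p l \<omega>)) t"
    using assms by (intro char_tendsto tendsto_intros drop_grid_tendsto dip_grid_tendsto) auto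
  have 2: "(\<lambda>n. char (distr M borel (drop_grid c q n)) t * char (distr M borel (\<lambda>\<omega>. c * X p \<omega> - c * X q \<omega>)) t
      * char (distr M borel (dip_grid c p l n)) t) \<longlonglongrightarrow>
      char (distr M borel (drop_before c q)) t * char (distr M borel (\<lambda>\<omega>. c * X p \<omega> - c * X q \<omega>)) t
      * char (distr M borel (dip_after c p l)) t"
    using assms by (intro tendsto_intros char_tendsto drop_grid_tendsto dip_grid_tendsto) auto
  have "distr M borel (\<lambda>\<omega>. c * X p \<omega> - c * X q \<omega>) = distr (distr M borel (\<lambda>\<omega>. X p \<omega> - X q \<omega>)) borel (\<lambda>x. c * x)"
    by (subst distr_distr) (auto simp: comp_def right_diff_distrib)
  also have "\<dots> = distr (distr M borel (X h)) borel (\<lambda>x. c * x)"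
    unfolding p_def using increment_law[OF q, of h] h by (simp add: inc_law_def)
  also have "\<dots> = distr M borel (\<lambda>\<omega>. c * X h \<omega>)"
    by (subst distr_distr) (auto simp: comp_def)
  finally have 3: "distr M borel (\<lambda>\<omega>. c * X p \<omega> - c * X q \<omega>) = distr M borel (\<lambda>\<omega>. c * X h \<omega>)" .
  have "distr M borel (dip_after c p l) = distr M borel (dip_after c 0 l)"
    using assms by (intro dip_after_law) auto
  with LIMSEQ_unique[OF 1 2[folded char_drop_mid_dip_grid[OF c q h l, folded p_def]]] 3
  show ?thesis by simp
qed

text \<open>The sum behaves as if its three terms were independent: on grids its characteristic function is a
  product, and the product form survives the passage to the limit.\<close>

lemma law_drop_mid_dip:
  assumes c: "c = 1 \<or> c = -1" and q: "0 \<le> q" and h: "0 < h" and l: "0 < l"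
  defines "p \<equiv> q + h"
  defines "R \<equiv> distr (distr M borel (drop_before c q) \<Otimes>\<^sub>M distr M borel (dip_after c 0 l)) borel (\<lambda>(a, b). a + b)"
  shows "distr M borel (\<lambda>\<omega>. drop_before c q \<omega> + (c * X p \<omega> - c * X q \<omega>) + dip_after c p l \<omega>) =
    distr (R \<Otimes>\<^sub>M distr M borel (\<lambda>\<omega>. c * X h \<omega>)) borel (\<lambda>(a, b). a + b)"
    and "real_distribution R"
proof -
  note [measurable] = drop_before_measurable[OF c] dip_after_measurable[OF c]
  have conv: "real_distribution (distr (A \<Otimes>\<^sub>M B) borel (\<lambda>(a, b). a + b))"
    if "real_distribution A" "real_distribution B" for A B
  proof -
    interpret A: real_distribution A by fact
    interpret B: real_distribution B by fact
    interpret pair_prob_space A B ..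
    show ?thesis by (rule real_distribution_distr) measurable
  qed
  show R: "real_distribution R" unfolding R_def by (intro conv real_distribution_distr) auto
  show "distr M borel (\<lambda>\<omega>. drop_before c q \<omega> + (c * X p \<omega> - c * X q \<omega>) + dip_after c p l \<omega>) =
    distr (R \<Otimes>\<^sub>M distr M borel (\<lambda>\<omega>. c * X h \<omega>)) borel (\<lambda>(a, b). a + b)"
  proof (rule Levy_uniqueness)
    show "char (distr M borel (\<lambda>\<omega>. drop_before c q \<omega> + (c * X p \<omega> - c * X q \<omega>) + dip_after c p l \<omega>)) =
      char (distr (R \<Otimes>\<^sub>M distr M borel (\<lambda>\<omega>. c * X h \<omega>)) borel (\<lambda>(a, b). a + b))"
    proof
      fix t
      show "char (distr M borel (\<lambda>\<omega>. drop_before c q \<omega> + (c * X p \<omega> - c * X q \<omega>) + dip_after c p l \<omega>)) t =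
        char (distr (R \<Otimes>\<^sub>M distr M borel (\<lambda>\<omega>. c * X h \<omega>)) borel (\<lambda>(a, b). a + b)) t"
        unfolding p_def char_drop_mid_dip[OF c q h l]
        by (subst char_convolution[OF R], simp, unfold R_def, subst char_convolution) auto
    qed
  qed (auto intro!: conv R)
qed

end

section \<open>Levels carry no occupation time\<close>

locale sn_levy_up = sn_levy +
  fixes T :: real
  assumes T_pos: "T > 0" and up: "measure M {\<omega> \<in> space M. X T \<omega> > 0} > 0"
begin

text \<open>The first grid time above the level lies to the right of the true first passage, so that
  right-continuity applies to the values there.\<close>

lemma first_passage_grid_tendsto:
  assumes \<omega>: "\<omega> \<in> space M" and y: "0 < y" and t0: "t0 \<in> {0..T}" "X t0 \<omega> > y"
  defines "k \<equiv> \<lambda>n. LEAST k. X (real k * T / real (Suc n)) \<omega> > y"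
  shows "\<exists>r. 0 \<le> r \<and> r \<le> T \<and> X r \<omega> = y \<and>
    (\<forall>\<^sub>F n in sequentially. \<exists>k\<le>Suc n. X (real k * T / real (Suc n)) \<omega> > y) \<and>
    (\<forall>\<^sub>F n in sequentially. r \<le> real (k n) * T / real (Suc n)) \<and>
    (\<lambda>n. real (k n) * T / real (Suc n)) \<longlonglongrightarrow> r"
proof -
  have path: "sn_path (\<lambda>t. X t \<omega>)" using \<omega> by (rule paths)
  have X0: "X 0 \<omega> < y" using X_nonpos[OF \<omega>, of 0] y by simp
  have "0 \<le> t0" using t0 by simp
  obtain r where r: "0 < r" "r \<le> t0" "X r \<omega> = y" "\<And>u. 0 \<le> u \<Longrightarrow> u < r \<Longrightarrow> X u \<omega> \<le> y"
    "\<And>d. d > 0 \<Longrightarrow> \<exists>u. r < u \<and> u < r + d \<and> X u \<omega> > y"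
    using sn_path_first_passage[OF path \<open>0 \<le> t0\<close> X0 t0(2)] by metis
  have "r < t0" using r t0 by (cases "r = t0") auto
  then have rT: "r < T" using t0 by auto
  have near: "\<forall>\<^sub>F n in sequentially. \<exists>k\<le>Suc n. X (real k * T / real (Suc n)) \<omega> > y \<and> real k * T / real (Suc n) < r + e"
    if e: "e > 0" for e
  proof -
    obtain u where u: "r < u" "u < r + min e (T - r)" "X u \<omega> > y" using r(5)[of "min e (T - r)"] e rT by auto
    obtain d where d: "d > 0" "\<And>s. u \<le> s \<Longrightarrow> s < u + d \<Longrightarrow> \<bar>X s \<omega> - X u \<omega>\<bar> < X u \<omega> - y"
      using right_contD[OF path_right_cont[OF \<omega>], of "X u \<omega> - y" u] u by auto
    define D where "D = min d (r + min e (T - r) - u)"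
    have D: "D > 0" "D \<le> d" "u + D \<le> r + e" "u + D \<le> T" using d u by (auto simp: D_def)
    have "\<forall>\<^sub>F n in sequentially. T / real (Suc n) < D"
      using order_tendstoD(2)[OF LIMSEQ_Suc[OF lim_const_over_n[of T]] D(1)] by simp
    then show ?thesis
    proof eventually_elim
      case (elim n)
      define h where "h = T / real (Suc n)"
      have h: "0 < h" "h < D" using elim T_pos by (auto simp: h_def)
      define j where "j = nat \<lceil>u / h\<rceil>"
      have "0 < u / h" using u r(1) h by auto
      then have j: "real j \<ge> u / h" "real j < u / h + 1" by (auto simp: j_def) linarith+
      have j1: "real j * h \<ge> u" "real j * h < u + h" using h j by (auto simp: field_simps)
      have "real j * h < real (Suc n) * h" using j1 h D by (auto simp: h_def)
      then have "j \<le> Suc n" using h by (simp only: mult_less_cancel_right_pos of_nat_less_iff)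
      moreover have "real j * T / real (Suc n) = real j * h" by (simp add: h_def)
      moreover have "X (real j * h) \<omega> > y" using d(2)[of "real j * h"] j1 h D by auto
      ultimately show ?case using j1 h D by (intro exI[of _ j]) auto
    qed
  qed
  have after: "r < real k' * T / real (Suc n)" if "X (real k' * T / real (Suc n)) \<omega> > y" for k' n
  proof (rule ccontr)
    assume "\<not> ?thesis"
    moreover have "0 \<le> real k' * T / real (Suc n)" using T_pos by auto
    ultimately show False using r(3) r(4)[of "real k' * T / real (Suc n)"] that
      by (cases "real k' * T / real (Suc n) = r") auto
  qed
  have k: "X (real (k n) * T / real (Suc n)) \<omega> > y" "k n \<le> k'" if "X (real k' * T / real (Suc n)) \<omega> > y" for k' n
    using that unfolding k_def by (rule LeastI, rule Least_le)
  show ?thesis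
  proof (intro exI[of _ r] conjI)
    show "\<forall>\<^sub>F n in sequentially. \<exists>k\<le>Suc n. X (real k * T / real (Suc n)) \<omega> > y"
      using near[of 1] by (auto elim: eventually_mono)
    show ge: "\<forall>\<^sub>F n in sequentially. r \<le> real (k n) * T / real (Suc n)"
      using near[OF zero_less_one]
    proof eventually_elim
      case (elim n)
      then show ?case using k(1) after by (metis less_imp_le)
    qed
    show "(\<lambda>n. real (k n) * T / real (Suc n)) \<longlonglongrightarrow> r"
    proof (rule tendstoI)
      fix e :: real assume "e > 0"
      from near[OF this] ge show "\<forall>\<^sub>F n in sequentially. dist (real (k n) * T / real (Suc n)) r < e"
      proof eventually_elim
        case (elim n)
        then obtain k' where k': "X (real k' * T / real (Suc n)) \<omega> > y" "real k' * T / real (Suc n) < r + e" by auto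
        have "real (k n) * T / real (Suc n) \<le> real k' * T / real (Suc n)"
          using k(2)[OF k'(1)] T_pos by (intro divide_right_mono mult_right_mono) auto
        then show ?case using k' elim(2) by (auto simp: dist_real_def)
      qed
    qed
  qed (use r rT in auto)
qed

lemma first_passage_grid_indep:
  fixes \<phi> :: "real \<Rightarrow> real" and n k :: nat
  assumes u: "u > 0" and [measurable]: "\<phi> \<in> borel_measurable borel" and \<phi>: "\<And>x. \<bar>\<phi> x\<bar> \<le> 1" and y: "0 < y"
  defines "t \<equiv> \<lambda>i. real i * T / real (Suc n)"
  defines "H \<equiv> \<lambda>\<omega>. if (\<forall>i<k. X (t i) \<omega> \<le> y) \<and> X (t k) \<omega> > y then 1 else (0::real)"
  shows "(\<integral>\<omega>. H \<omega> * \<phi> (X (t k + u) \<omega> - X (t k) \<omega>) \<partial>M) = (\<integral>\<omega>. H \<omega> \<partial>M) * (\<integral>x. \<phi> x \<partial>inc_law u)"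
proof -
  define s where "s i = (if i \<le> k then t i else t k + u)" for i
  have t: "t 0 = 0" "0 \<le> t k" by (auto simp: t_def T_pos less_imp_le)
  have s: "s 0 = 0" by (simp add: s_def t_def)
  have s_mono: "s i < s (Suc i)" if "i < Suc k" for i
    using that u T_pos by (cases "i = k") (auto simp: s_def t_def intro!: divide_strict_right_mono mult_strict_right_mono)
  define K where "K j = (if j = 0 then {..<k} else {k})" for j :: nat
  define F where "F j v = (if j = 0 then (if (\<forall>i<k. (\<Sum>l<i. v l) \<le> y) \<and> (\<Sum>l<k. v l) > y then 1 else 0) else \<phi> (v k))"
    for j :: nat and v :: "nat \<Rightarrow> real"
  let ?xi = "\<lambda>i \<omega>. X (s (Suc i)) \<omega> - X (s i) \<omega>"
  have Fm: "F j \<in> borel_measurable (Pi\<^sub>M (K j) (\<lambda>_. borel))" for j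
  proof -
    have m1: "(\<lambda>v. v i) \<in> borel_measurable (Pi\<^sub>M (K j) (\<lambda>_. borel))" if "i \<in> K j" for i
      using that by (rule measurable_component_singleton)
    show ?thesis
    proof (cases "j = 0")
      case True
      have [measurable]: "(\<lambda>v. \<Sum>l<i. v l :: real) \<in> borel_measurable (Pi\<^sub>M (K j) (\<lambda>_. borel))" if "i \<le> k" for i
        by (rule borel_measurable_sum[where f = "\<lambda>l v. v l" and S = "{..<i}"], rule m1) (use that in \<open>auto simp: K_def True\<close>)
      have "F j = (\<lambda>v. if (\<forall>i\<in>{..<k}. (\<Sum>l<i. v l) \<le> y) \<and> (\<Sum>l<k. v l) > y then 1 else 0)"
        using True by (auto simp: F_def fun_eq_iff)
      also have "\<dots> \<in> borel_measurable (Pi\<^sub>M (K j) (\<lambda>_. borel))"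
        by (intro measurable_If measurable_const pred_intros_logic pred_intros_finite(2)) (auto intro!: borel_measurable_le borel_measurable_less)
      finally show ?thesis .
    next
      case False
      have "(\<lambda>v. \<phi> (v k)) \<in> borel_measurable (Pi\<^sub>M (K j) (\<lambda>_. borel))"
        using m1[of k] False by (auto simp: K_def)
      then show ?thesis using False by (simp add: F_def[abs_def])
    qed
  qed
  define Y where "Y j \<omega> = F j (\<lambda>i\<in>K j. ?xi i \<omega>)" for j \<omega>
  have ind: "indep_vars (\<lambda>_. borel) Y {0, 1}"
    unfolding Y_def[abs_def]
    by (rule indep_blocks[where N = "Suc k"]) (use s s_mono Fm in \<open>auto simp: K_def disjoint_family_on_def\<close>)
  have Y0: "Y 0 \<omega> = H \<omega>" if \<omega>: "\<omega> \<in> space M" for \<omega>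
  proof -
    have "(\<Sum>l<i. (\<lambda>i\<in>K 0. ?xi i \<omega>) l) = X (t i) \<omega>" if "i \<le> k" for i
    proof -
      have "(\<Sum>l<i. (\<lambda>i\<in>K 0. ?xi i \<omega>) l) = (\<Sum>l\<in>{0..<i}. ?xi l \<omega>)"
        using that by (intro sum.cong) (auto simp: K_def)
      then show ?thesis
        using sum_Suc_diff'[of 0 i "\<lambda>l. X (s l) \<omega>"] that X_nonpos[OF \<omega>, of 0] by (simp add: s s_def[of i])
    qed
    then show ?thesis by (simp add: Y_def F_def H_def cong: conj_cong imp_cong)
  qed
  have Y1: "Y 1 = (\<lambda>\<omega>. \<phi> (X (t k + u) \<omega> - X (t k) \<omega>))"
    by (auto simp: Y_def F_def K_def s_def)
  have int: "integrable M (Y j)" if "j \<in> {0, 1}" for j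
  proof (rule integrable_const_bound[of _ 1])
    show "Y j \<in> borel_measurable M" using ind that by (auto simp: indep_vars_def)
    show "AE \<omega> in M. norm (Y j \<omega>) \<le> 1" using \<phi> by (auto simp: Y_def F_def)
  qed
  have "(\<integral>\<omega>. (\<Prod>j\<in>{0,1}. Y j \<omega>) \<partial>M) = (\<Prod>j\<in>{0,1}. \<integral>\<omega>. Y j \<omega> \<partial>M)"
    by (rule indep_vars_lebesgue_integral[OF _ ind int]) auto
  then have "(\<integral>\<omega>. H \<omega> * \<phi> (X (t k + u) \<omega> - X (t k) \<omega>) \<partial>M) = (\<integral>\<omega>. H \<omega> \<partial>M) * (\<integral>\<omega>. \<phi> (X (t k + u) \<omega> - X (t k) \<omega>) \<partial>M)"
    using Y1 by (simp add: Y0 cong: Bochner_Integration.integral_cong)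
  also have "(\<integral>\<omega>. \<phi> (X (t k + u) \<omega> - X (t k) \<omega>) \<partial>M) = (\<integral>x. \<phi> x \<partial>distr M borel (\<lambda>\<omega>. X (t k + u) \<omega> - X (t k) \<omega>))"
    by (simp add: integral_distr)
  also have "distr M borel (\<lambda>\<omega>. X (t k + u) \<omega> - X (t k) \<omega>) = inc_law u"
    using increment_law[of "t k" u] t u by simp
  finally show ?thesis .
qed

text \<open>The strong Markov property at the first passage over \<open>y\<close>, reduced to one inequality; the passage has
  happened by time \<open>T\<close> at least when \<open>X\<^sub>T > y\<close>. For the first passages on the grids the increments before and
  after are independent, and a continuous bump \<open>\<phi> m\<close> stands in for the indicator of \<open>c\<close>. Then the grid is
  refined by means of right-continuity, and finally the bump shrinks to the point.\<close>

lemma passage_restart: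
  assumes y: "0 < y"
  shows "\<exists>A\<in>sets M. \<exists>\<tau>\<in>borel_measurable M. (\<forall>\<omega>\<in>A. 0 \<le> \<tau> \<omega> \<and> \<tau> \<omega> \<le> T \<and> X (\<tau> \<omega>) \<omega> = y) \<and>
    (\<forall>u>0. \<forall>c. prob {\<omega> \<in> space M. X T \<omega> > y} * measure (inc_law u) {c} \<le> prob {\<omega> \<in> A. X (\<tau> \<omega> + u) \<omega> = y + c})"
proof -
  define t where "t n i = real i * T / real (Suc n)" for n i
  define A where "A = {\<omega> \<in> space M. \<exists>s\<in>{0..T}. X s \<omega> > y}"
  define An where "An n = {\<omega> \<in> space M. \<exists>k\<le>Suc n. X (t n k) \<omega> > y}" for n
  define k where "k n \<omega> = (LEAST k. X (t n k) \<omega> > y)" for n \<omega>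
  have t_in: "t n i \<in> {0..T}" if "i \<le> Suc n" for n i
  proof -
    have "real i * T \<le> real (Suc n) * T" using that T_pos by (intro mult_right_mono) auto
    then have "real i * T / real (Suc n) \<le> T"
      by (subst pos_divide_le_eq) (auto simp: mult.commute)
    then show ?thesis using T_pos by (auto simp: t_def)
  qed
  have An_sub: "An n \<subseteq> A" for n using t_in by (auto simp: An_def A_def)
  have An_sets [measurable]: "An n \<in> sets M" for n unfolding An_def by measurable
  have k_meas [measurable]: "k n \<in> measurable M (count_space UNIV)" for n unfolding k_def[abs_def] by measurable
  define Q where "Q \<omega> r \<longleftrightarrow> 0 \<le> r \<and> r \<le> T \<and> X r \<omega> = y \<and> (\<forall>\<^sub>F n in sequentially. \<omega> \<in> An n)
     \<and> (\<forall>\<^sub>F n in sequentially. r \<le> t n (k n \<omega>)) \<and> (\<lambda>n. t n (k n \<omega>)) \<longlonglongrightarrow> r" for \<omega> r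
  have Q_ex: "\<exists>r. Q \<omega> r" if \<omega>: "\<omega> \<in> A" for \<omega>
  proof -
    obtain s where s: "\<omega> \<in> space M" "s \<in> {0..T}" "X s \<omega> > y" using \<omega> by (auto simp: A_def)
    from first_passage_grid_tendsto[OF s(1) y s(2,3)] s(1) show ?thesis
      unfolding Q_def t_def k_def An_def by simp
  qed
  have Q: "Q \<omega> (SOME r. Q \<omega> r)" if "\<omega> \<in> A" for \<omega>
    using Q_ex[OF that] by (rule someI_ex)
  define \<tau> where "\<tau> \<omega> = lim (\<lambda>n. t n (k n \<omega>))" for \<omega>
  have \<tau>_eq: "(SOME r. Q \<omega> r) = \<tau> \<omega>" if "\<omega> \<in> A" for \<omega>
    using Q[OF that] unfolding \<tau>_def Q_def by (intro limI[symmetric]) auto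
  have "Q \<omega> (\<tau> \<omega>)" if "\<omega> \<in> A" for \<omega>
    using Q[OF that] \<tau>_eq[OF that] by simp
  then have \<tau>: "0 \<le> \<tau> \<omega>" "\<tau> \<omega> \<le> T" "X (\<tau> \<omega>) \<omega> = y" "\<forall>\<^sub>F n in sequentially. \<omega> \<in> An n"
    "\<forall>\<^sub>F n in sequentially. \<tau> \<omega> \<le> t n (k n \<omega>)" "(\<lambda>n. t n (k n \<omega>)) \<longlonglongrightarrow> \<tau> \<omega>" if "\<omega> \<in> A" for \<omega>
    using that unfolding Q_def by blast+
  have \<tau>_meas [measurable]: "\<tau> \<in> borel_measurable M" unfolding \<tau>_def[abs_def] t_def by measurable
  have "A = (\<Union>n. An n)"
  proof
    show "(\<Union>n. An n) \<subseteq> A" using An_sub by auto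
    show "A \<subseteq> (\<Union>n. An n)"
    proof
      fix \<omega> assume "\<omega> \<in> A"
      from \<tau>(4)[OF this] show "\<omega> \<in> (\<Union>n. An n)" by (auto simp: eventually_sequentially)
    qed
  qed
  then have A_sets [measurable]: "A \<in> sets M" by auto
  have XT_sub: "{\<omega> \<in> space M. X T \<omega> > y} \<subseteq> An n" for n
    by (auto simp: An_def t_def intro!: exI[of _ "Suc n"] simp del: of_nat_Suc)
  have main: "prob {\<omega> \<in> space M. X T \<omega> > y} * measure (inc_law u) {c} \<le> prob {\<omega> \<in> A. X (\<tau> \<omega> + u) \<omega> = y + c}"
    if u: "0 < u" for u c
  proof -
    define \<phi> where "\<phi> m x = max 0 (1 - real m * \<bar>x - c\<bar>)" for m x
    have \<phi>_meas [measurable]: "\<phi> m \<in> borel_measurable borel" for m unfolding \<phi>_def[abs_def] by measurable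
    have \<phi>_bd: "0 \<le> \<phi> m x" "\<phi> m x \<le> 1" "\<bar>\<phi> m x\<bar> \<le> 1" for m x by (auto simp: \<phi>_def)
    have \<phi>_c: "\<phi> m c = 1" for m by (simp add: \<phi>_def)
    interpret I: real_distribution "inc_law u" by simp
    have \<phi>_inc: "measure (inc_law u) {c} \<le> (\<integral>x. \<phi> m x \<partial>inc_law u)" for m
    proof -
      have "measure (inc_law u) {c} = (\<integral>x. indicator {c} x \<partial>inc_law u)" by simp
      also have "\<dots> \<le> (\<integral>x. \<phi> m x \<partial>inc_law u)"
        using \<phi>_bd \<phi>_c by (intro integral_mono integrable_const_bound[of _ 1] I.integrable_const_bound[of _ 1]) (auto simp: indicator_def)
      finally show ?thesis .
    qed
    define H where "H n j \<omega> = (if (\<forall>i<j. X (t n i) \<omega> \<le> y) \<and> X (t n j) \<omega> > y then 1 else (0::real))" for n j \<omega>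
    have H_meas [measurable]: "H n j \<in> borel_measurable M" for n j unfolding H_def[abs_def] by measurable
    have H_k: "H n j \<omega> = (if j = k n \<omega> then 1 else 0)" if "\<omega> \<in> An n" for n j \<omega>
    proof -
      obtain i where i: "X (t n i) \<omega> > y" using \<open>\<omega> \<in> An n\<close> by (auto simp: An_def)
      have 1: "X (t n (k n \<omega>)) \<omega> > y" unfolding k_def by (rule LeastI[of _ i]) (rule i)
      have 2: "X (t n i) \<omega> \<le> y" if "i < k n \<omega>" for i
        using not_less_Least[OF that[unfolded k_def]] by simp
      show ?thesis
        using 1 2 by (cases j "k n \<omega>" rule: linorder_cases) (auto simp: H_def not_less dest: leD)
    qed
    have k_le: "k n \<omega> \<le> Suc n" if "\<omega> \<in> An n" for n \<omega>
      using \<open>\<omega> \<in> An n\<close> unfolding An_def k_def by (auto intro: Least_le order_trans)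
    have H_0: "H n j \<omega> = 0" if "\<omega> \<in> space M - An n" "j \<le> Suc n" for n j \<omega>
      using that by (auto simp: H_def An_def)
    define g where "g n m \<omega> = indicator (An n) \<omega> * \<phi> m (X (t n (k n \<omega>) + u) \<omega> - X (t n (k n \<omega>)) \<omega>)" for n m \<omega>
    have g_sum: "g n m \<omega> = (\<Sum>j\<le>Suc n. H n j \<omega> * \<phi> m (X (t n j + u) \<omega> - X (t n j) \<omega>))" if \<omega>: "\<omega> \<in> space M" for n m \<omega>
    proof (cases "\<omega> \<in> An n")
      case True
      then show ?thesis using k_le[OF True] by (simp add: H_k g_def if_distrib[of "\<lambda>z. z * _"] cong: if_cong del: sum.atMost_Suc)
    next
      case False
      then show ?thesis using \<omega> by (auto simp: g_def H_0 intro!: sum.neutral[symmetric] simp del: sum.atMost_Suc)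
    qed
    have An_sum: "indicator (An n) \<omega> = (\<Sum>j\<le>Suc n. H n j \<omega>)" if \<omega>: "\<omega> \<in> space M" for n \<omega>
    proof (cases "\<omega> \<in> An n")
      case True
      then show ?thesis using k_le[OF True] by (simp add: H_k del: sum.atMost_Suc)
    next
      case False
      then show ?thesis using \<omega> by (auto simp: H_0 intro!: sum.neutral[symmetric] simp del: sum.atMost_Suc)
    qed
    have int: "integrable M (H n j)" "integrable M (\<lambda>\<omega>. H n j \<omega> * \<phi> m (X (t n j + u) \<omega> - X (t n j) \<omega>))" for n j m
      using \<phi>_bd by (auto intro!: integrable_const_bound[of _ 1] simp: H_def)
    have step: "prob {\<omega> \<in> space M. X T \<omega> > y} * measure (inc_law u) {c} \<le> (\<integral>\<omega>. g n m \<omega> \<partial>M)" for n m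
    proof -
      have "(\<integral>\<omega>. g n m \<omega> \<partial>M) = (\<integral>\<omega>. (\<Sum>j\<le>Suc n. H n j \<omega> * \<phi> m (X (t n j + u) \<omega> - X (t n j) \<omega>)) \<partial>M)"
        by (intro Bochner_Integration.integral_cong refl g_sum)
      also have "\<dots> = (\<Sum>j\<le>Suc n. (\<integral>\<omega>. H n j \<omega> * \<phi> m (X (t n j + u) \<omega> - X (t n j) \<omega>) \<partial>M))"
        using int by (intro Bochner_Integration.integral_sum) auto
      also have "\<dots> = (\<Sum>j\<le>Suc n. (\<integral>\<omega>. H n j \<omega> \<partial>M) * (\<integral>x. \<phi> m x \<partial>inc_law u))"
        unfolding H_def t_def by (intro sum.cong refl first_passage_grid_indep u \<phi>_meas \<phi>_bd y)
      also have "\<dots> = (\<integral>\<omega>. (\<Sum>j\<le>Suc n. H n j \<omega>) \<partial>M) * (\<integral>x. \<phi> m x \<partial>inc_law u)"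
        using int by (subst Bochner_Integration.integral_sum) (auto simp: sum_distrib_right simp del: sum.atMost_Suc)
      also have "(\<integral>\<omega>. (\<Sum>j\<le>Suc n. H n j \<omega>) \<partial>M) = (\<integral>\<omega>. indicator (An n) \<omega> \<partial>M)"
        by (intro Bochner_Integration.integral_cong refl An_sum[symmetric])
      also have "\<dots> = prob (An n)" by (simp add: Int_absorb1 sets.sets_into_space)
      finally have "(\<integral>\<omega>. g n m \<omega> \<partial>M) = prob (An n) * (\<integral>x. \<phi> m x \<partial>inc_law u)" .
      moreover have "prob {\<omega> \<in> space M. X T \<omega> > y} \<le> prob (An n)" using XT_sub by (intro finite_measure_mono) auto
      ultimately show ?thesis using \<phi>_inc[of m] by (simp add: mult_mono)
    qed
    have g_meas [measurable]: "g n m \<in> borel_measurable M" for n m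
      unfolding g_def[abs_def] t_def by measurable
    have g_bd: "\<bar>g n m \<omega>\<bar> \<le> 1" for n m \<omega> using \<phi>_bd by (auto simp: g_def indicator_def)
    define G where "G m \<omega> = indicator A \<omega> * \<phi> m (X (\<tau> \<omega> + u) \<omega> - y)" for m \<omega>
    have G_meas [measurable]: "G m \<in> borel_measurable M" for m unfolding G_def[abs_def] by measurable
    have G_bd: "\<bar>G m \<omega>\<bar> \<le> 1" for m \<omega> using \<phi>_bd by (auto simp: G_def indicator_def)
    have lim1: "(\<lambda>n. g n m \<omega>) \<longlonglongrightarrow> G m \<omega>" if \<omega>: "\<omega> \<in> space M" for m \<omega>
    proof (cases "\<omega> \<in> A")
      case False
      then have "g n m \<omega> = G m \<omega>" for n using An_sub[of n] by (auto simp: g_def G_def indicator_def)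
      then show ?thesis by simp
    next
      case True
      note * = \<tau>[OF True]
      have "(\<lambda>n. \<phi> m (X (t n (k n \<omega>) + u) \<omega> - X (t n (k n \<omega>)) \<omega>)) \<longlonglongrightarrow> \<phi> m (X (\<tau> \<omega> + u) \<omega> - X (\<tau> \<omega>) \<omega>)"
        unfolding \<phi>_def using *
        by (intro tendsto_intros right_cont_tendsto[OF path_right_cont[OF \<omega>]]) auto
      moreover have "\<forall>\<^sub>F n in sequentially. \<phi> m (X (t n (k n \<omega>) + u) \<omega> - X (t n (k n \<omega>)) \<omega>) = g n m \<omega>"
        using * by (auto elim!: eventually_mono simp: g_def)
      ultimately show ?thesis using * True by (simp add: G_def filterlim_cong)
    qed
    have "(\<lambda>n. (\<integral>\<omega>. g n m \<omega> \<partial>M)) \<longlonglongrightarrow> (\<integral>\<omega>. G m \<omega> \<partial>M)" for m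
      by (rule integral_dominated_convergence[where w = "\<lambda>_. 1"]) (auto simp: lim1 g_bd)
    then have step2: "prob {\<omega> \<in> space M. X T \<omega> > y} * measure (inc_law u) {c} \<le> (\<integral>\<omega>. G m \<omega> \<partial>M)" for m
      by (rule tendsto_lowerbound) (auto simp: step)
    let ?E = "{\<omega> \<in> A. X (\<tau> \<omega> + u) \<omega> = y + c}"
    have E_sets [measurable]: "?E \<in> sets M"
    proof -
      have "?E = {\<omega> \<in> space M. \<omega> \<in> A \<and> X (\<tau> \<omega> + u) \<omega> = y + c}" by (auto simp: A_def)
      also have "\<dots> \<in> sets M" by measurable
      finally show ?thesis .
    qed
    have lim2: "(\<lambda>m. G m \<omega>) \<longlonglongrightarrow> indicator ?E \<omega>" for \<omega>
    proof (cases "\<omega> \<in> A \<and> X (\<tau> \<omega> + u) \<omega> \<noteq> y + c")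
      case False
      then have "G m \<omega> = indicator ?E \<omega>" for m by (auto simp: G_def \<phi>_def indicator_def)
      then show ?thesis by simp
    next
      case True
      define d where "d = \<bar>X (\<tau> \<omega> + u) \<omega> - y - c\<bar>"
      have d: "d > 0" using True by (auto simp: d_def)
      have "\<forall>\<^sub>F m in sequentially. 1 / d \<le> real m" 
        by (rule eventually_sequentiallyI[of "nat \<lceil>1 / d\<rceil>"]) linarith
      then have "\<forall>\<^sub>F m in sequentially. G m \<omega> = 0"
      proof eventually_elim
        case (elim m)
        then have "1 \<le> real m * d" using d by (simp add: divide_le_eq)
        then show ?case by (simp add: G_def \<phi>_def d_def)
      qed
      then show ?thesis using True by (auto intro!: tendsto_eventually)
    qed
    have "(\<lambda>m. (\<integral>\<omega>. G m \<omega> \<partial>M)) \<longlonglongrightarrow> (\<integral>\<omega>. indicator ?E \<omega> \<partial>M)"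
      by (rule integral_dominated_convergence[where w = "\<lambda>_. 1"]) (auto simp: lim2 G_bd)
    then have "prob {\<omega> \<in> space M. X T \<omega> > y} * measure (inc_law u) {c} \<le> (\<integral>\<omega>. indicator ?E \<omega> \<partial>M)"
      by (rule tendsto_lowerbound) (auto simp: step2)
    also have "\<dots> = prob ?E" using sets.sets_into_space[OF E_sets] by (simp add: Int_absorb1)
    finally show ?thesis .
  qed
  show ?thesis
  proof (intro bexI conjI ballI allI impI)
    show "0 \<le> \<tau> \<omega>" "\<tau> \<omega> \<le> T" "X (\<tau> \<omega>) \<omega> = y" if "\<omega> \<in> A" for \<omega> using \<tau>(1-3)[OF that] by auto
  qed (use main in auto)
qed

text \<open>The mass of the level \<open>c\<close> under the expected occupation measure up to time \<open>K\<close>.\<close>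

definition atom_time :: "real \<Rightarrow> real \<Rightarrow> ennreal" where
  "atom_time K c = (\<integral>\<^sup>+u. emeasure (inc_law u) {c} * indicator {0<..K} u \<partial>lborel)"

lemma emeasure_inc_law: "emeasure (inc_law u) {c} = (\<integral>\<^sup>+\<omega>. indicator {c} (X u \<omega>) \<partial>M)"
proof -
  have "emeasure (inc_law u) {c} = emeasure M (X u -` {c} \<inter> space M)"
    unfolding inc_law_def by (rule emeasure_distr) auto
  also have "\<dots> = (\<integral>\<^sup>+\<omega>. indicator (X u -` {c} \<inter> space M) \<omega> \<partial>M)" by simp
  also have "\<dots> = (\<integral>\<^sup>+\<omega>. indicator {c} (X u \<omega>) \<partial>M)"
    by (intro nn_integral_cong) (auto simp: indicator_def)
  finally show ?thesis .
qed

lemma atom_time_swap: "atom_time K c = (\<integral>\<^sup>+\<omega>. (\<integral>\<^sup>+u. indicator {c} (X u \<omega>) * indicator {0<..K} u \<partial>lborel) \<partial>M)"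
proof -
  interpret pair_sigma_finite M lborel ..
  have "atom_time K c = (\<integral>\<^sup>+u. (\<integral>\<^sup>+\<omega>. indicator {c} (X u \<omega>) * indicator {0<..K} u \<partial>M) \<partial>lborel)"
    unfolding atom_time_def emeasure_inc_law by (simp add: nn_integral_multc)
  also have "\<dots> = (\<integral>\<^sup>+\<omega>. (\<integral>\<^sup>+u. indicator {c} (X u \<omega>) * indicator {0<..K} u \<partial>lborel) \<partial>M)"
    by (rule Fubini') measurable
  finally show ?thesis .
qed

lemma atom_time_shift:
  assumes y: "0 < y"
  shows "ennreal (prob {\<omega> \<in> space M. X T \<omega> > y}) * atom_time K c \<le> atom_time (K + T) (y + c)"
proof -
  interpret pair_sigma_finite M lborel ..
  obtain A \<tau> where [measurable]: "A \<in> sets M" "\<tau> \<in> borel_measurable M"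
    and \<tau>: "\<And>\<omega>. \<omega> \<in> A \<Longrightarrow> 0 \<le> \<tau> \<omega> \<and> \<tau> \<omega> \<le> T \<and> X (\<tau> \<omega>) \<omega> = y"
    and ineq: "\<And>u c. 0 < u \<Longrightarrow> prob {\<omega> \<in> space M. X T \<omega> > y} * measure (inc_law u) {c} \<le> prob {\<omega> \<in> A. X (\<tau> \<omega> + u) \<omega> = y + c}"
    using passage_restart[OF y] by (elim bexE conjE) blast
  have E: "{\<omega> \<in> A. X (\<tau> \<omega> + u) \<omega> = y + c} = {\<omega> \<in> space M. \<omega> \<in> A \<and> X (\<tau> \<omega> + u) \<omega> = y + c}" for u
    using sets.sets_into_space[OF \<open>A \<in> sets M\<close>] by auto
  have "ennreal (prob {\<omega> \<in> space M. X T \<omega> > y}) * atom_time K c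
     = (\<integral>\<^sup>+u. ennreal (prob {\<omega> \<in> space M. X T \<omega> > y}) * (emeasure (inc_law u) {c} * indicator {0<..K} u) \<partial>lborel)"
    unfolding atom_time_def emeasure_inc_law by (rule nn_integral_cmult[symmetric]) measurable
  also have "\<dots> \<le> (\<integral>\<^sup>+u. (\<integral>\<^sup>+\<omega>. indicator A \<omega> * indicator {y + c} (X (\<tau> \<omega> + u) \<omega>) * indicator {0<..K} u \<partial>M) \<partial>lborel)"
  proof (rule nn_integral_mono)
    fix u :: real
    show "ennreal (prob {\<omega> \<in> space M. X T \<omega> > y}) * (emeasure (inc_law u) {c} * indicator {0<..K} u)
      \<le> (\<integral>\<^sup>+\<omega>. indicator A \<omega> * indicator {y + c} (X (\<tau> \<omega> + u) \<omega>) * indicator {0<..K} u \<partial>M)"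
    proof (cases "0 < u \<and> u \<le> K")
      case True
      interpret I: real_distribution "inc_law u" by simp
      have "ennreal (prob {\<omega> \<in> space M. X T \<omega> > y}) * emeasure (inc_law u) {c}
         = ennreal (prob {\<omega> \<in> space M. X T \<omega> > y} * measure (inc_law u) {c})"
        by (simp add: I.emeasure_eq_measure ennreal_mult)
      also have "\<dots> \<le> emeasure M {\<omega> \<in> space M. \<omega> \<in> A \<and> X (\<tau> \<omega> + u) \<omega> = y + c}"
        using ineq[of u c] True by (simp add: emeasure_eq_measure E ennreal_leI)
      also have "\<dots> = (\<integral>\<^sup>+\<omega>. indicator {\<omega> \<in> space M. \<omega> \<in> A \<and> X (\<tau> \<omega> + u) \<omega> = y + c} \<omega> \<partial>M)"
        by simp
      also have "\<dots> = (\<integral>\<^sup>+\<omega>. indicator A \<omega> * indicator {y + c} (X (\<tau> \<omega> + u) \<omega>) \<partial>M)"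
        by (intro nn_integral_cong) (auto simp: indicator_def)
      finally show ?thesis using True by (simp add: indicator_def)
    qed auto
  qed
  also have "\<dots> = (\<integral>\<^sup>+\<omega>. (\<integral>\<^sup>+u. indicator A \<omega> * indicator {y + c} (X (\<tau> \<omega> + u) \<omega>) * indicator {0<..K} u \<partial>lborel) \<partial>M)"
    by (rule Fubini') measurable
  also have "\<dots> \<le> (\<integral>\<^sup>+\<omega>. (\<integral>\<^sup>+u. indicator {y + c} (X u \<omega>) * indicator {0<..K + T} u \<partial>lborel) \<partial>M)"
  proof (rule nn_integral_mono)
    fix \<omega> assume \<omega>: "\<omega> \<in> space M"
    note [measurable] = measurable_const[OF \<omega>]
    show "(\<integral>\<^sup>+u. indicator A \<omega> * indicator {y + c} (X (\<tau> \<omega> + u) \<omega>) * indicator {0<..K} u \<partial>lborel)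
      \<le> (\<integral>\<^sup>+u. indicator {y + c} (X u \<omega>) * indicator {0<..K + T} u \<partial>lborel)"
    proof (cases "\<omega> \<in> A")
      case True
      have m: "(\<lambda>u. indicator {y + c} (X u \<omega>) * indicator {0<..K + T} u :: ennreal) \<in> borel_measurable borel"
        by measurable
      have "(\<integral>\<^sup>+u. indicator A \<omega> * indicator {y + c} (X (\<tau> \<omega> + u) \<omega>) * indicator {0<..K} u \<partial>lborel)
        \<le> (\<integral>\<^sup>+u. indicator {y + c} (X (\<tau> \<omega> + 1 * u) \<omega>) * indicator {0<..K + T} (\<tau> \<omega> + 1 * u) \<partial>lborel)"
        using \<tau>[OF True] by (intro nn_integral_mono) (auto simp: indicator_def)
      also have "\<dots> = (\<integral>\<^sup>+u. indicator {y + c} (X u \<omega>) * indicator {0<..K + T} u \<partial>lborel)"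
        using nn_integral_real_affine[OF m, of 1 "\<tau> \<omega>"] by simp
      finally show ?thesis .
    qed auto
  qed
  also have "\<dots> = atom_time (K + T) (y + c)" by (rule atom_time_swap[symmetric])
  finally show ?thesis .
qed

lemma countable_atom_times: "countable {c. atom_time K c \<noteq> 0}"
proof -
  define L where "L = density lborel (\<lambda>u. indicator {0<..K} u)"
  have Lfin: "emeasure L (space L) \<noteq> \<infinity>"
    by (cases "0 \<le> K") (simp_all add: L_def emeasure_density)
  interpret L: finite_measure L by (rule finite_measureI) (use Lfin in auto)
  interpret LM: pair_sigma_finite L M ..
  have [measurable_cong]: "sets L = sets borel" by (simp add: L_def)
  define \<nu> where "\<nu> = distr (L \<Otimes>\<^sub>M M) borel (\<lambda>(u, \<omega>). X u \<omega>)"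
  have "emeasure \<nu> (space \<nu>) = emeasure L (space L) * emeasure M (space M)"
    unfolding \<nu>_def by (subst emeasure_distr) (auto simp: space_pair_measure emeasure_pair_measure_Times)
  then have "emeasure \<nu> (space \<nu>) \<noteq> \<infinity>" using Lfin by (simp add: emeasure_space_1)
  then interpret N: finite_measure \<nu> by (intro finite_measureI)
  have *: "emeasure \<nu> {c} = atom_time K c" for c
  proof -
    have "emeasure \<nu> {c} = (\<integral>\<^sup>+x. indicator {c} x \<partial>\<nu>)" by (simp add: \<nu>_def)
    also have "\<dots> = (\<integral>\<^sup>+z. indicator {c} (case z of (u, \<omega>) \<Rightarrow> X u \<omega>) \<partial>(L \<Otimes>\<^sub>M M))"
      unfolding \<nu>_def by (rule nn_integral_distr) measurable
    also have "\<dots> = (\<integral>\<^sup>+u. (\<integral>\<^sup>+\<omega>. indicator {c} (X u \<omega>) \<partial>M) \<partial>L)"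
      by (subst nn_integral_fst[symmetric]) auto
    also have "\<dots> = atom_time K c"
      unfolding L_def atom_time_def emeasure_inc_law
      by (subst nn_integral_density) (auto simp: mult.commute)
    finally show ?thesis .
  qed
  have "{c. atom_time K c \<noteq> 0} = {c. measure \<nu> {c} \<noteq> 0}"
    by (auto simp: N.emeasure_eq_measure simp flip: *)
  then show ?thesis using N.countable_support by simp
qed

text \<open>An atom of the expected occupation measure at \<open>c\<close> would be reproduced after the first passage over each
  small level \<open>y > 0\<close>, where the path equals \<open>y\<close> exactly. The uncountably many levels \<open>y + c\<close> would all be
  atoms of a finite measure.\<close>

theorem no_atoms: "atom_time K c = 0"
proof (rule ccontr)
  assume nz: "atom_time K c \<noteq> 0"
  have "\<exists>m. prob {\<omega> \<in> space M. X T \<omega> > 1 / real (Suc m)} \<noteq> 0"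
  proof (rule ccontr)
    assume "\<not> ?thesis"
    then have "(\<Union>m. {\<omega> \<in> space M. X T \<omega> > 1 / real (Suc m)}) \<in> null_sets M"
      by (intro null_sets_UN) (auto simp: null_sets_def emeasure_eq_measure)
    moreover have "{\<omega> \<in> space M. X T \<omega> > 0} \<subseteq> (\<Union>m. {\<omega> \<in> space M. X T \<omega> > 1 / real (Suc m)})"
    proof
      fix \<omega> assume \<omega>: "\<omega> \<in> {\<omega> \<in> space M. X T \<omega> > 0}"
      then obtain m where "inverse (real (Suc m)) < X T \<omega>" using reals_Archimedean[of "X T \<omega>"] by auto
      then show "\<omega> \<in> (\<Union>m. {\<omega> \<in> space M. X T \<omega> > 1 / real (Suc m)})"
        using \<omega> by (auto simp: inverse_eq_divide simp del: of_nat_Suc)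
    qed
    moreover have "{\<omega> \<in> space M. X T \<omega> > 0} \<in> sets M" by measurable
    ultimately have "{\<omega> \<in> space M. X T \<omega> > 0} \<in> null_sets M"
      using null_sets_subset by blast
    then show False using up by (simp add: null_sets_def measure_def)
  qed
  then obtain m where m: "prob {\<omega> \<in> space M. X T \<omega> > 1 / real (Suc m)} \<noteq> 0" by blast
  define y0 where "y0 = 1 / real (Suc m)"
  have "y0 > 0" by (simp add: y0_def)
  have "x \<in> {c. atom_time (K + T) c \<noteq> 0}" if x: "x \<in> {c<..<c + y0}" for x
  proof -
    define y where "y = x - c"
    have y: "0 < y" "y < y0" "x = y + c" using x by (auto simp: y_def)
    have "prob {\<omega> \<in> space M. X T \<omega> > y0} \<le> prob {\<omega> \<in> space M. X T \<omega> > y}"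
      using y by (intro finite_measure_mono) auto
    then have "prob {\<omega> \<in> space M. X T \<omega> > y} > 0" using m measure_nonneg[of M] unfolding y0_def by (metis less_le_trans order_le_less)
    then have "ennreal (prob {\<omega> \<in> space M. X T \<omega> > y}) * atom_time K c \<noteq> 0" using nz by simp
    then show ?thesis using atom_time_shift[OF y(1), of K c] y(3) by auto
  qed
  then have "countable {c<..<c + y0}"
    by (intro countable_subset[OF _ countable_atom_times[of "K + T"]]) blast
  moreover have "uncountable {c<..<c + y0}" using \<open>y0 > 0\<close> by (simp add: uncountable_open_interval)
  ultimately show False by simp
qed

end

section \<open>Infima over separate windows differ\<close>

context sn_levy_up
begin

definition tie :: "real \<Rightarrow> real \<Rightarrow> real \<Rightarrow> real \<Rightarrow> 'a set" where
  "tie c b q l = {\<omega> \<in> space M. Inf ((\<lambda>t. c * X t \<omega>) ` {0..q}) = Inf ((\<lambda>t. c * X t \<omega>) ` {b - l..b})}"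

lemma tie_sets [measurable]: "c = 1 \<or> c = -1 \<Longrightarrow> tie c b q l \<in> sets M"
  unfolding tie_def by (intro measurable_equality_set Inf_measurable) auto

lemma inc_law_joint_measurable [measurable]: "(\<lambda>(h, r). emeasure (inc_law h) {r}) \<in> borel_measurable (borel \<Otimes>\<^sub>M borel)"
proof -
  have "(\<lambda>z. \<integral>\<^sup>+\<omega>. indicator {0} (X (fst z) \<omega> - snd z) \<partial>M) \<in> borel_measurable (borel \<Otimes>\<^sub>M borel)"
    by measurable
  moreover have "indicator {0} (X (fst z) \<omega> - snd z) = (indicator {snd z} (X (fst z) \<omega>) :: ennreal)" for z \<omega>
    by (auto simp: indicator_def)
  ultimately show ?thesis by (simp add: emeasure_inc_law split_beta')
qed

text \<open>A tie prescribes the value of the increment over the gap in terms of the past and the future.\<close>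

lemma emeasure_tie:
  assumes c: "c = 1 \<or> c = -1" and q: "0 \<le> q" and l: "0 < l" and b: "q + l < b"
  defines "R \<equiv> distr (distr M borel (drop_before c q) \<Otimes>\<^sub>M distr M borel (dip_after c 0 l)) borel (\<lambda>(a, b). a + b)"
  shows "emeasure M (tie c b q l) = (\<integral>\<^sup>+r. emeasure (inc_law (b - l - q)) {- c * r} \<partial>R)"
proof -
  define h where "h = b - l - q"
  have h: "0 < h" "q + h = b - l" "b - l + l = b" using b by (auto simp: h_def)
  note law = law_drop_mid_dip[OF c q h(1) l, folded R_def, unfolded h(2)]
  note [measurable] = drop_before_measurable[OF c] dip_after_measurable[OF c]
  let ?S = "\<lambda>\<omega>. drop_before c q \<omega> + (c * X (b - l) \<omega> - c * X q \<omega>) + dip_after c (b - l) l \<omega>"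
  interpret R: real_distribution R by (rule law(2))
  let ?Z = "distr M borel (\<lambda>\<omega>. c * X h \<omega>)"
  interpret Z: real_distribution ?Z by simp
  have "tie c b q l = ?S -` {0} \<inter> space M"
    by (auto simp: tie_def drop_before_def dip_after_def h)
  then have "emeasure M (tie c b q l) = emeasure (distr M borel ?S) {0}"
    by (simp add: emeasure_distr)
  also have "\<dots> = emeasure (distr (R \<Otimes>\<^sub>M ?Z) borel (\<lambda>(a, b). a + b)) {0}"
    by (simp only: law(1))
  also have "\<dots> = emeasure (R \<Otimes>\<^sub>M ?Z) ((\<lambda>(a, b). a + b) -` {0} \<inter> space (R \<Otimes>\<^sub>M ?Z))"
    by (rule emeasure_distr) auto
  also have "\<dots> = (\<integral>\<^sup>+r. emeasure ?Z (Pair r -` ((\<lambda>(a, b). a + b) -` {0} \<inter> space (R \<Otimes>\<^sub>M ?Z))) \<partial>R)"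
    by (rule Z.emeasure_pair_measure_alt) measurable
  also have "\<dots> = (\<integral>\<^sup>+r. emeasure (inc_law h) {- c * r} \<partial>R)"
  proof (rule nn_integral_cong)
    fix r
    have "Pair r -` ((\<lambda>(a, b). a + b) -` {0} \<inter> space (R \<Otimes>\<^sub>M ?Z)) = {- r}"
      by (auto simp: space_pair_measure)
    moreover have "(\<lambda>\<omega>. c * X h \<omega>) -` {- r} \<inter> space M = X h -` {- c * r} \<inter> space M" using c by auto
    ultimately show "emeasure ?Z (Pair r -` ((\<lambda>(a, b). a + b) -` {0} \<inter> space (R \<Otimes>\<^sub>M ?Z))) = emeasure (inc_law h) {- c * r}"
      by (simp add: emeasure_distr inc_law_def)
  qed
  finally show ?thesis by (simp add: h_def)
qed

text \<open>Moving the end point \<open>b\<close> changes the length of the gap but not the laws \<open>R\<close> of what happens on either side.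
  For almost every length the prescribed increment has probability zero.\<close>

lemma AE_no_tie:
  assumes c: "c = 1 \<or> c = -1" and q: "0 \<le> q" and l: "0 < l"
  shows "AE b in lborel. q + l < b \<longrightarrow> emeasure M (tie c b q l) = 0"
proof -
  define R where "R = distr (distr M borel (drop_before c q) \<Otimes>\<^sub>M distr M borel (dip_after c 0 l)) borel (\<lambda>(a, b). a + b)"
  interpret R: real_distribution R unfolding R_def by (rule law_drop_mid_dip(2)[OF c q zero_less_one l])
  interpret pair_sigma_finite R lborel ..
  have "AE h in lborel. 0 < h \<and> h \<le> real n \<longrightarrow> (\<integral>\<^sup>+r. emeasure (inc_law h) {- c * r} \<partial>R) = 0" for n :: nat
  proof -
    have "(\<integral>\<^sup>+h. (\<integral>\<^sup>+r. emeasure (inc_law h) {- c * r} * indicator {0<..real n} h \<partial>R) \<partial>lborel)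
      = (\<integral>\<^sup>+r. (\<integral>\<^sup>+h. emeasure (inc_law h) {- c * r} * indicator {0<..real n} h \<partial>lborel) \<partial>R)"
      by (rule Fubini') measurable
    also have "\<dots> = (\<integral>\<^sup>+r. atom_time (real n) (- c * r) \<partial>R)" by (simp add: atom_time_def)
    also have "\<dots> = 0" by (simp add: no_atoms)
    finally have "AE h in lborel. (\<integral>\<^sup>+r. emeasure (inc_law h) {- c * r} * indicator {0<..real n} h \<partial>R) = 0"
      by (subst (asm) nn_integral_0_iff_AE) auto
    then show ?thesis by eventually_elim (auto simp: indicator_def)
  qed
  then have *: "AE h in lborel. \<forall>n::nat. 0 < h \<and> h \<le> real n \<longrightarrow> (\<integral>\<^sup>+r. emeasure (inc_law h) {- c * r} \<partial>R) = 0"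
    by (rule AE_all_countable[THEN iffD2, rule_format])
  then have *: "AE h in lborel. 0 < h \<longrightarrow> (\<integral>\<^sup>+r. emeasure (inc_law h) {- c * r} \<partial>R) = 0"
    by eventually_elim (use real_arch_simple in blast)
  have "AE b in lborel. 0 < b - l - q \<longrightarrow> (\<integral>\<^sup>+r. emeasure (inc_law (b - l - q)) {- c * r} \<partial>R) = 0"
  proof -
    have e: "distr lborel borel ((+) (- (l + q))) = (lborel :: real measure)"
      by (rule lborel_distr_plus)
    have "AE b in distr lborel borel ((+) (- (l + q))). 0 < b \<longrightarrow> (\<integral>\<^sup>+r. emeasure (inc_law b) {- c * r} \<partial>R) = 0"
      by (subst e) (rule *)
    then have "AE b in lborel. 0 < - (l + q) + b \<longrightarrow> (\<integral>\<^sup>+r. emeasure (inc_law (- (l + q) + b)) {- c * r} \<partial>R) = 0"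
      by (rule AE_distrD[rotated]) measurable
    then show ?thesis by eventually_elim (auto simp: algebra_simps)
  qed
  then show ?thesis
    by eventually_elim (use emeasure_tie[OF c q l] in \<open>auto simp: R_def\<close>)
qed

lemma no_ties_exists:
  obtains B where "countable B" "dense_times B" "AE \<omega> in M. no_ties B (\<lambda>t. X t \<omega>) \<and> no_ties B (\<lambda>t. - X t \<omega>)"
proof -
  define good where "good b \<longleftrightarrow> (\<forall>c\<in>{1,-1}. \<forall>q\<in>\<rat>. \<forall>l\<in>\<rat>. 0 \<le> q \<longrightarrow> 0 < l \<longrightarrow> q + l < b \<longrightarrow> emeasure M (tie c b q l) = 0)" for b
  have "AE b in lborel. good b"
    unfolding good_def
    by (intro AE_ball_countable[THEN iffD2] ballI) (auto simp: countable_rat intro!: AE_impI AE_no_tie)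
  then obtain N where N: "{b. \<not> good b} \<subseteq> N" "N \<in> null_sets lborel"
    by (auto elim!: AE_E simp: null_sets_def)
  have ex: "\<exists>b. good b \<and> u < b \<and> b < v" if "u < v" for u v
  proof (rule ccontr)
    assume "\<not> ?thesis"
    then have "{u<..<v} \<subseteq> N" using N(1) by auto
    then have "{u<..<v} \<in> null_sets lborel" using N(2) null_sets_subset by (metis borel_open open_greaterThanLessThan sets_lborel)
    then show False using that by (simp add: null_sets_def)
  qed
  define f where "f p = (SOME b. good b \<and> fst p < b \<and> b < snd p)" for p
  have f: "good (f (u, v))" "u < f (u, v)" "f (u, v) < v" if "u < v" for u v
    using someI_ex[OF ex[OF that]] by (auto simp: f_def)
  define B where "B = f ` {(u, v). u \<in> \<rat> \<and> v \<in> \<rat> \<and> u < v}"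
  have "countable B"
    unfolding B_def by (intro countable_image countable_subset[OF _ countable_SIGMA[of \<rat> "\<lambda>_. \<rat>"]]) (auto simp: countable_rat)
  moreover have "dense_times B"
    unfolding dense_times_def
  proof (intro allI impI)
    fix u v :: real assume "u < v"
    then obtain u' where u': "u' \<in> \<rat>" "u < u'" "u' < v" using Rats_dense_in_real by blast
    then obtain v' where v': "v' \<in> \<rat>" "u' < v'" "v' < v" using Rats_dense_in_real by blast
    then show "\<exists>b\<in>B. u < b \<and> b < v" using f[of u' v'] u'
      by (intro bexI[of _ "f (u', v')"]) (auto simp: B_def)
  qed
  moreover have "AE \<omega> in M. no_ties B (\<lambda>t. X t \<omega>) \<and> no_ties B (\<lambda>t. - X t \<omega>)"
  proof -
    have Bg: "good b" if "b \<in> B" for b using that f by (auto simp: B_def)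
    have "AE \<omega> in M. 0 \<le> q \<longrightarrow> 0 < l \<longrightarrow> q + l < b \<longrightarrow> \<omega> \<notin> tie c b q l"
      if "c \<in> {1, -1}" "b \<in> B" "q \<in> \<rat>" "l \<in> \<rat>" for c b q l
    proof (intro AE_impI AE_not_in)
      assume "0 \<le> q" "0 < l" "q + l < b"
      then have "emeasure M (tie c b q l) = 0" using Bg[OF that(2)] that by (auto simp: good_def)
      then show "tie c b q l \<in> null_sets M" using that by (auto simp: null_sets_def intro!: tie_sets)
    qed
    then have "AE \<omega> in M. \<forall>c\<in>{1,-1}. \<forall>b\<in>B. \<forall>q\<in>\<rat>. \<forall>l\<in>\<rat>. 0 \<le> q \<longrightarrow> 0 < l \<longrightarrow> q + l < b \<longrightarrow> \<omega> \<notin> tie c b q l"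
      by (intro AE_ball_countable[THEN iffD2] ballI) (auto simp: countable_rat \<open>countable B\<close>)
    then show ?thesis
    proof (rule AE_mp, intro AE_I2 impI)
      fix \<omega> assume \<omega>: "\<omega> \<in> space M"
        and *: "\<forall>c\<in>{1,-1}. \<forall>b\<in>B. \<forall>q\<in>\<rat>. \<forall>l\<in>\<rat>. 0 \<le> q \<longrightarrow> 0 < l \<longrightarrow> q + l < b \<longrightarrow> \<omega> \<notin> tie c b q l"
      show "no_ties B (\<lambda>t. X t \<omega>) \<and> no_ties B (\<lambda>t. - X t \<omega>)"
        using *[THEN bspec, of 1] *[THEN bspec, of "-1"] \<omega> by (auto simp: no_ties_def tie_def)
    qed
  qed
  ultimately show ?thesis by (rule that)
qed

text \<open>By stationarity the probability of \<open>X u = X s\<close> is that of an increment over \<open>\<bar>u - s\<bar>\<close> being zero.\<close>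

lemma coincidence_time:
  assumes s: "0 \<le> s" "s \<le> T"
  shows "(\<integral>\<^sup>+u. (\<integral>\<^sup>+\<omega>. indicator {0} (X u \<omega> - X s \<omega>) * indicator {0..T} u \<partial>M) \<partial>lborel) = 0"
proof -
  let ?f = "\<lambda>h. emeasure (inc_law h) {0} * indicator {0<..T} h"
  have eq: "(\<integral>\<^sup>+\<omega>. indicator {0} (X (a + h) \<omega> - X a \<omega>) \<partial>M) = emeasure (inc_law h) {0}"
    if "0 \<le> a" "0 \<le> h" for a h
  proof -
    have "emeasure (inc_law h) {0} = emeasure (distr M borel (\<lambda>\<omega>. X (a + h) \<omega> - X a \<omega>)) {0}"
      using increment_law[OF that] by simp
    also have "\<dots> = (\<integral>\<^sup>+x. indicator {0} x \<partial>distr M borel (\<lambda>\<omega>. X (a + h) \<omega> - X a \<omega>))" by simp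
    also have "\<dots> = (\<integral>\<^sup>+\<omega>. indicator {0} (X (a + h) \<omega> - X a \<omega>) \<partial>M)"
      by (rule nn_integral_distr) measurable
    finally show ?thesis by simp
  qed
  have f0: "(\<integral>\<^sup>+h. ?f h \<partial>lborel) = 0" using no_atoms[of T 0] by (simp add: atom_time_def)
  have m: "?f \<in> borel_measurable borel" by measurable
  have f1: "(\<integral>\<^sup>+u. ?f (- s + 1 * u) \<partial>lborel) = 0" "(\<integral>\<^sup>+u. ?f (s + (-1) * u) \<partial>lborel) = 0"
    using nn_integral_real_affine[OF m, of 1 "- s"] nn_integral_real_affine[OF m, of "-1" s] f0 by simp_all
  have "(\<integral>\<^sup>+u. (\<integral>\<^sup>+\<omega>. indicator {0} (X u \<omega> - X s \<omega>) * indicator {0..T} u \<partial>M) \<partial>lborel)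
    \<le> (\<integral>\<^sup>+u. ?f (- s + 1 * u) + ?f (s + (-1) * u) \<partial>lborel)"
  proof (rule nn_integral_mono_AE)
    have "AE u in lborel. u \<noteq> s" by (rule AE_lborel_singleton)
    then show "AE u in lborel. (\<integral>\<^sup>+\<omega>. indicator {0} (X u \<omega> - X s \<omega>) * indicator {0..T} u \<partial>M)
      \<le> ?f (- s + 1 * u) + ?f (s + (-1) * u)"
    proof eventually_elim
      case (elim u)
      consider "u \<notin> {0..T}" | "u \<in> {0..T}" "u < s" | "u \<in> {0..T}" "s < u" using elim by argo
      then show ?case
      proof cases
        case 2
        have "(\<integral>\<^sup>+\<omega>. indicator {0} (X u \<omega> - X s \<omega>) \<partial>M) = (\<integral>\<^sup>+\<omega>. indicator {0} (X (u + (s - u)) \<omega> - X u \<omega>) \<partial>M)"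
          by (intro nn_integral_cong) (auto simp: indicator_def)
        also have "\<dots> = emeasure (inc_law (s - u)) {0}" using 2 by (intro eq) auto
        finally show ?thesis using 2 s by (auto simp: indicator_def)
      next
        case 3
        then show ?thesis using eq[of s "u - s"] s by (auto simp: indicator_def)
      qed auto
    qed
  qed
  also have "\<dots> = (\<integral>\<^sup>+u. ?f (- s + 1 * u) \<partial>lborel) + (\<integral>\<^sup>+u. ?f (s + (-1) * u) \<partial>lborel)"
    by (rule nn_integral_add) measurable
  also have "\<dots> = 0" by (simp only: f1 add_0)
  finally show ?thesis by simp
qed

text \<open>A level set of length \<open>L\<close> contributes \<open>L\<^sup>2\<close> to the area of the set of pairs of times with equal values, and
  that area is zero almost surely.\<close>

lemma AE_level_null: "AE \<omega> in M. \<forall>c. emeasure lborel {s\<in>{0..T}. X s \<omega> = c} = 0"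
proof -
  interpret pair_sigma_finite M lborel ..
  let ?D = "\<lambda>\<omega>. (\<integral>\<^sup>+s. indicator {0..T} s * (\<integral>\<^sup>+u. indicator {0} (X u \<omega> - X s \<omega>) * indicator {0..T} u \<partial>lborel) \<partial>lborel)"
  have "(\<integral>\<^sup>+\<omega>. ?D \<omega> \<partial>M) = (\<integral>\<^sup>+s. (\<integral>\<^sup>+\<omega>. indicator {0..T} s * (\<integral>\<^sup>+u. indicator {0} (X u \<omega> - X s \<omega>) * indicator {0..T} u \<partial>lborel) \<partial>M) \<partial>lborel)"
    by (rule Fubini'[symmetric]) measurable
  also have "\<dots> = (\<integral>\<^sup>+s. indicator {0..T} s * (\<integral>\<^sup>+u. (\<integral>\<^sup>+\<omega>. indicator {0} (X u \<omega> - X s \<omega>) * indicator {0..T} u \<partial>M) \<partial>lborel) \<partial>lborel)"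
  proof (rule nn_integral_cong)
    fix s :: real
    have "(\<integral>\<^sup>+\<omega>. indicator {0..T} s * (\<integral>\<^sup>+u. indicator {0} (X u \<omega> - X s \<omega>) * indicator {0..T} u \<partial>lborel) \<partial>M)
      = indicator {0..T} s * (\<integral>\<^sup>+\<omega>. (\<integral>\<^sup>+u. indicator {0} (X u \<omega> - X s \<omega>) * indicator {0..T} u \<partial>lborel) \<partial>M)"
      by (rule nn_integral_cmult) measurable
    also have "(\<integral>\<^sup>+\<omega>. (\<integral>\<^sup>+u. indicator {0} (X u \<omega> - X s \<omega>) * indicator {0..T} u \<partial>lborel) \<partial>M)
      = (\<integral>\<^sup>+u. (\<integral>\<^sup>+\<omega>. indicator {0} (X u \<omega> - X s \<omega>) * indicator {0..T} u \<partial>M) \<partial>lborel)"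
      by (rule Fubini'[symmetric]) measurable
    finally show "(\<integral>\<^sup>+\<omega>. indicator {0..T} s * (\<integral>\<^sup>+u. indicator {0} (X u \<omega> - X s \<omega>) * indicator {0..T} u \<partial>lborel) \<partial>M)
      = indicator {0..T} s * (\<integral>\<^sup>+u. (\<integral>\<^sup>+\<omega>. indicator {0} (X u \<omega> - X s \<omega>) * indicator {0..T} u \<partial>M) \<partial>lborel)" .
  qed
  also have "\<dots> = (\<integral>\<^sup>+s. 0 \<partial>(lborel :: real measure))"
    using coincidence_time by (intro nn_integral_cong) (auto simp: indicator_def)
  finally have "(\<integral>\<^sup>+\<omega>. ?D \<omega> \<partial>M) = 0" by simp
  then have "AE \<omega> in M. ?D \<omega> = 0" by (subst (asm) nn_integral_0_iff_AE) auto
  then show ?thesis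
  proof (rule AE_mp, intro AE_I2 impI allI)
    fix \<omega> c assume \<omega>: "\<omega> \<in> space M" and D: "?D \<omega> = 0"
    note [measurable] = measurable_const[OF \<omega>]
    let ?L = "{s\<in>{0..T}. X s \<omega> = c}"
    have L: "?L \<in> sets lborel"
    proof -
      have "?L = {s\<in>space lborel. s \<in> {0..T} \<and> X s \<omega> = c}" by auto
      also have "\<dots> \<in> sets lborel" by measurable
      finally show ?thesis .
    qed
    have "emeasure lborel ?L * emeasure lborel ?L = (\<integral>\<^sup>+s. indicator ?L s * (\<integral>\<^sup>+u. indicator ?L u \<partial>lborel) \<partial>lborel)"
      using L by (simp add: nn_integral_multc)
    also have "\<dots> \<le> ?D \<omega>"
      by (intro nn_integral_mono) (auto simp: indicator_def intro!: nn_integral_mono)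
    finally show "emeasure lborel ?L = 0" using D by simp
  qed
qed

end

section \<open>Cyclic exchangeability on grids\<close>

definition walk :: "(nat \<Rightarrow> real) \<Rightarrow> nat \<Rightarrow> real" where
  "walk v i = (\<Sum>l<i. v l)"

definition rot :: "nat \<Rightarrow> nat \<Rightarrow> nat \<Rightarrow> nat" where
  "rot k j i = (if i < k then (i + j) mod k else i)"

text \<open>The shift by \<open>j\<close> reads the original walk at the index \<open>src k j i\<close> when it stands at \<open>i\<close>. Indices run through
  \<open>{1..k}\<close> rather than \<open>{0..<k}\<close>, which matches the rounding of times to the right used below.\<close>

definition src :: "nat \<Rightarrow> nat \<Rightarrow> nat \<Rightarrow> nat" where
  "src k j i = (if i + j \<le> k then i + j else i + j - k)"

text \<open>The walk after a cyclic shift of its first \<open>k\<close> increments by \<open>j\<close> places. The last summand accounts for a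
  loop that does not close up exactly.\<close>

definition cyc :: "(nat \<Rightarrow> real) \<Rightarrow> nat \<Rightarrow> nat \<Rightarrow> nat \<Rightarrow> real" where
  "cyc S k j i = S (src k j i) - S j + (if src k j i \<le> j then S k else 0)"

definition last_at :: "nat \<Rightarrow> nat \<Rightarrow> (nat \<Rightarrow> real) \<Rightarrow> bool" where
  "last_at N k S \<longleftrightarrow> k \<le> N \<and> S k \<le> 0 \<and> (\<forall>j\<in>{k<..N}. S j > 0)"

lemma rot_bij: "k \<le> N \<Longrightarrow> bij_betw (rot k j) {..<N} {..<N}"
proof -
  assume k: "k \<le> N"
  have inj: "inj_on (rot k j) {..<N}"
  proof (rule inj_onI)
    fix a b assume ab: "a \<in> {..<N}" "b \<in> {..<N}" "rot k j a = rot k j b"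
    have lt: "(i + j) mod k < k" if "i < k" for i using that by auto
    have le: "a = b" if "a \<le> b" "b < k" "(a + j) mod k = (b + j) mod k" for a b
    proof -
      have "k dvd b - a" using that mod_eq_dvd_iff_nat[of "a + j" "b + j" k] by simp
      then show "a = b" using that by (auto dest!: dvd_imp_le)
    qed
    have both: "a = b" if "a < k" "b < k" "(a + j) mod k = (b + j) mod k" for a b
      using le[OF _ that(2,3)] le[OF _ that(1) that(3)[symmetric]] nat_le_linear[of a b] by blast
    show "a = b"
    proof (cases "a < k"; cases "b < k")
      assume "a < k" "b < k"
      then show ?thesis using ab(3) both[of a b] unfolding rot_def by presburger
    qed (use ab(3) lt[of a] lt[of b] in \<open>simp_all add: rot_def\<close>)
  qed
  have "rot k j ` {..<N} \<subseteq> {..<N}" using k by (auto simp: rot_def intro: less_le_trans[OF mod_less_divisor])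
  then show ?thesis using inj by (simp add: bij_betw_def endo_inj_surj)
qed

lemma sum_prefix: "walk v b - walk v a = (\<Sum>l\<in>{a..<b}. v l)" if "a \<le> b"
  using that by (auto simp: walk_def sum_diff_nat_ivl lessThan_atLeast0)

lemma walk_rot:
  assumes i: "i \<in> {1..k}" and j: "j \<in> {1..k}" and k: "k \<le> N"
  shows "walk (\<lambda>i\<in>{..<N}. v (rot k j i)) i = cyc (walk v) k j i"
proof -
  have w: "walk (\<lambda>i\<in>{..<N}. v (rot k j i)) i = (\<Sum>m<i. v ((m + j) mod k))"
    using i k unfolding walk_def by (intro sum.cong) (auto simp: rot_def)
  have first: "(\<Sum>m<b. v ((m + j) mod k)) = walk v (b + j) - walk v j" if "b + j \<le> k" for b
  proof -
    have "(\<Sum>m<b. v ((m + j) mod k)) = (\<Sum>m\<in>{0..<b}. v (m + j))"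
      using that by (intro sum.cong) auto
    also have "\<dots> = (\<Sum>m\<in>{0+j..<b+j}. v m)" by (rule sum.shift_bounds_nat_ivl[symmetric])
    also have "\<dots> = walk v (b + j) - walk v j" by (subst sum_prefix) auto
    finally show ?thesis .
  qed
  show ?thesis
  proof (cases "i + j \<le> k")
    case True
    then show ?thesis using w first[OF True] i by (simp add: cyc_def src_def)
  next
    case False
    define b where "b = k - j"
    have b: "b + j = k" "b \<le> i" using j False by (auto simp: b_def)
    have "(\<Sum>m<i. v ((m + j) mod k)) = (\<Sum>m<b. v ((m + j) mod k)) + (\<Sum>m\<in>{b..<i}. v ((m + j) mod k))"
      using b(2) by (simp add: lessThan_atLeast0 sum.atLeastLessThan_concat)
    also have "(\<Sum>m\<in>{b..<i}. v ((m + j) mod k)) = (\<Sum>m\<in>{0 + b..<(i - b) + b}. v ((m + j) mod k))"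
      using b by simp
    also have "\<dots> = (\<Sum>m\<in>{0..<i - b}. v ((m + b + j) mod k))"
      by (rule sum.shift_bounds_nat_ivl)
    also have "\<dots> = (\<Sum>m<i - b. v m)"
    proof (intro sum.cong)
      fix m assume "m \<in> {..<i - b}"
      then have "m < k" using i b by auto
      then show "v ((m + b + j) mod k) = v m" using b(1) by (simp add: add.assoc)
    qed auto
    also have "(\<Sum>m<b. v ((m + j) mod k)) = walk v k - walk v j" using first[of b] b by simp
    finally have "walk (\<lambda>i\<in>{..<N}. v (rot k j i)) i = walk v k - walk v j + walk v (i - b)"
      using w by (simp add: walk_def)
    moreover have "i - b = i + j - k" "i + j - k \<le> j" using b i j False by auto
    ultimately show ?thesis using False by (simp add: cyc_def src_def)
  qed
qed

lemma walk_rot_ge: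
  assumes i: "k \<le> i" "i \<le> N"
  shows "walk (\<lambda>i\<in>{..<N}. v (rot k j i)) i = walk v i"
proof -
  have "walk (\<lambda>i\<in>{..<N}. v (rot k j i)) i = (\<Sum>m\<in>{..<i}. v (rot k j m))"
    using i unfolding walk_def by (intro sum.cong) auto
  also have "\<dots> = (\<Sum>m\<in>{..<i}. v m)"
    using rot_bij[OF i(1), of j] by (rule sum.reindex_bij_betw)
  finally show ?thesis by (simp add: walk_def)
qed

lemma last_at_rot: "k \<le> N \<Longrightarrow> last_at N k (walk (\<lambda>i\<in>{..<N}. v (rot k j i))) \<longleftrightarrow> last_at N k (walk v)"
  by (auto simp: last_at_def walk_rot_ge)

lemma last_at_unique: "last_at N k S \<Longrightarrow> last_at N k' S \<Longrightarrow> k = k'"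
  by (cases k k' rule: linorder_cases) (force simp: last_at_def)+

lemma last_at_ex:
  assumes "S 0 \<le> 0"
  obtains k where "last_at N k S"
proof -
  let ?A = "{k. k \<le> N \<and> S k \<le> 0}"
  have A: "finite ?A" "0 \<in> ?A" using assms by auto
  have "Max ?A \<in> ?A" using A by (intro Max_in) auto
  moreover have "S j > 0" if "j \<in> {Max ?A<..N}" for j
  proof (rule ccontr)
    assume "\<not> S j > 0"
    then have "j \<le> Max ?A" using that A by (intro Max_ge) auto
    then show False using that by simp
  qed
  ultimately show ?thesis by (intro that[of "Max ?A"]) (simp add: last_at_def)
qed

text \<open>The value for \<open>k = 0\<close> lets an empty loop contribute itself.\<close>

definition cyc_avg :: "nat \<Rightarrow> (nat \<Rightarrow> real) \<Rightarrow> real" where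
  "cyc_avg k F = (if k = 0 then F 0 else (\<Sum>j\<in>{1..k}. F j) / real k)"

lemma walk_measurable: "i \<le> N \<Longrightarrow> (\<lambda>v. walk v i) \<in> borel_measurable (PiM {..<N} (\<lambda>_. borel))"
  unfolding walk_def by (intro borel_measurable_sum measurable_component_singleton) auto

lemma last_at_measurable: "{v \<in> space (PiM {..<N} (\<lambda>_. borel)). last_at N k (walk v)} \<in> sets (PiM {..<N} (\<lambda>_. borel))"
proof (cases "k \<le> N")
  case True
  note [measurable] = walk_measurable[of _ N]
  have "{v \<in> space (PiM {..<N} (\<lambda>_. borel)). last_at N k (walk v)} =
    {v \<in> space (PiM {..<N} (\<lambda>_. borel)). walk v k \<le> 0} \<inter> {v \<in> space (PiM {..<N} (\<lambda>_. borel)). \<forall>j\<in>{k<..N}. walk v j > 0}"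
    using True by (auto simp: last_at_def)
  also have "\<dots> \<in> sets (PiM {..<N} (\<lambda>_. borel))"
    using True by (intro sets.Int borel_measurable_le[OF walk_measurable] sets.sets_Collect_finite_All borel_measurable_less walk_measurable) auto
  finally show ?thesis .
next
  case False
  then show ?thesis by (auto simp: last_at_def)
qed

context sn_levy_up
begin

definition grid_inc :: "nat \<Rightarrow> 'a \<Rightarrow> nat \<Rightarrow> real" where
  "grid_inc N \<omega> = (\<lambda>i\<in>{..<N}. X (0 + real (Suc i) * (T / real N)) \<omega> - X (0 + real i * (T / real N)) \<omega>)"

lemma walk_grid_inc:
  assumes "\<omega> \<in> space M" "i \<le> N"
  shows "walk (grid_inc N \<omega>) i = X (real i * (T / real N)) \<omega>"
proof -
  have "walk (grid_inc N \<omega>) i = (\<Sum>l\<in>{0..<i}. X (0 + real (Suc l) * (T / real N)) \<omega> - X (0 + real l * (T / real N)) \<omega>)"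
    using assms unfolding walk_def grid_inc_def by (intro sum.cong) auto
  then show ?thesis
    using sum_Suc_diff'[of 0 i "\<lambda>l. X (0 + real l * (T / real N)) \<omega>"] X_nonpos[OF assms(1), of 0] by simp
qed

lemma grid_inc_measurable [measurable]: "grid_inc N \<in> measurable M (PiM {..<N} (\<lambda>_. borel))"
  unfolding grid_inc_def[abs_def] by (intro measurable_restrict) measurable

lemma grid_inc_rot_law:
  assumes "N > 0" "k \<le> N"
  shows "distr M (PiM {..<N} (\<lambda>_. borel)) (\<lambda>\<omega>. \<lambda>i\<in>{..<N}. grid_inc N \<omega> (rot k j i))
     = distr M (PiM {..<N} (\<lambda>_. borel)) (grid_inc N)"
proof -
  let ?P = "PiM {..<N} (\<lambda>_. inc_law (T / real N))"
  have sets: "sets ?P = sets (PiM {..<N} (\<lambda>_. borel))"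
    by (intro sets_PiM_cong) (auto simp: inc_law_def)
  have P: "distr M (PiM {..<N} (\<lambda>_. borel)) (grid_inc N) = ?P"
    unfolding grid_inc_def[abs_def] using assms T_pos by (intro grid_increments_iid) auto
  have rm: "(\<lambda>v. \<lambda>i\<in>{..<N}. v (rot k j i)) \<in> measurable (PiM {..<N} (\<lambda>_. borel)) (PiM {..<N} (\<lambda>_. borel))"
    using rot_bij[OF assms(2), of j]
    by (intro measurable_restrict measurable_component_singleton) (auto simp: bij_betw_def)
  have "distr M (PiM {..<N} (\<lambda>_. borel)) (\<lambda>\<omega>. \<lambda>i\<in>{..<N}. grid_inc N \<omega> (rot k j i))
    = distr (distr M (PiM {..<N} (\<lambda>_. borel)) (grid_inc N)) (PiM {..<N} (\<lambda>_. borel)) (\<lambda>v. \<lambda>i\<in>{..<N}. v (rot k j i))"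
    by (subst distr_distr[OF rm grid_inc_measurable]) (simp add: comp_def)
  also have "\<dots> = distr ?P (PiM {..<N} (\<lambda>_. inc_law (T / real N))) (\<lambda>v. \<lambda>i\<in>{..<N}. v (rot k j i))"
    by (intro distr_cong P refl sets[symmetric])
  also have "\<dots> = ?P"
  proof (rule distr_PiM_reindex)
    show "inj_on (rot k j) {..<N}" "rot k j \<in> {..<N} \<rightarrow> {..<N}"
      using rot_bij[OF assms(2), of j] by (auto simp: bij_betw_def)
    show "prob_space (inc_law (T / real N))" 
      using inc_law_distribution[of "T / real N"] by (simp add: real_distribution_def)
  qed
  finally show ?thesis using P by simp
qed

text \<open>Whether \<open>k\<close> is the last index with a nonpositive value can be read off the walk from index \<open>k\<close> on, and the
  shifts of the first \<open>k\<close> increments leave that part unchanged. As the increments are independent and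
  identically distributed, each shift preserves the law on this event, and so does averaging over all shifts.\<close>

lemma cyclic_exchange:
  fixes f :: "nat \<Rightarrow> (nat \<Rightarrow> real) \<Rightarrow> real"
  assumes N: "N > 0"
    and meas: "\<And>k. k < N \<Longrightarrow> (\<lambda>v. f k (walk v)) \<in> borel_measurable (PiM {..<N} (\<lambda>_. borel))"
    and bound: "\<And>k S. \<bar>f k S\<bar> \<le> C"
    and local: "\<And>k S S'. (\<And>i. i \<in> {1..k} \<Longrightarrow> S i = S' i) \<Longrightarrow> f k S = f k S'"
  defines "W \<equiv> \<lambda>\<omega>. walk (grid_inc N \<omega>)"
  shows "(\<integral>\<omega>. (\<Sum>k<N. if last_at N k (W \<omega>) then f k (W \<omega>) else 0) \<partial>M) =
    (\<integral>\<omega>. (\<Sum>k<N. if last_at N k (W \<omega>) then cyc_avg k (\<lambda>j. f k (cyc (W \<omega>) k j)) else 0) \<partial>M)" (is ?eq)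
    and "(\<lambda>\<omega>. \<Sum>k<N. if last_at N k (W \<omega>) then f k (W \<omega>) else 0) \<in> borel_measurable M" (is ?m1)
    and "(\<lambda>\<omega>. \<Sum>k<N. if last_at N k (W \<omega>) then cyc_avg k (\<lambda>j. f k (cyc (W \<omega>) k j)) else 0) \<in> borel_measurable M" (is ?m2)
proof -
  let ?P = "PiM {..<N} (\<lambda>_. borel :: real measure)"
  define \<Psi> where "\<Psi> k v = (if last_at N k (walk v) then f k (walk v) else 0)" for k v
  have \<Psi>m: "\<Psi> k \<in> borel_measurable ?P" if "k < N" for k
    unfolding \<Psi>_def[abs_def] using last_at_measurable[of N k] meas[OF that] by (intro measurable_If) auto
  have C: "0 \<le> C" using bound[of 0 undefined] by linarith
  have \<Psi>b: "\<bar>\<Psi> k v\<bar> \<le> C" for k v using bound C by (auto simp: \<Psi>_def)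
  define r where "r k j \<omega> = (\<lambda>i\<in>{..<N}. grid_inc N \<omega> (rot k j i))" for k j \<omega>
  have rm: "r k j \<in> measurable M ?P" if "k \<le> N" for k j
  proof -
    have 1: "(\<lambda>v. v i) \<in> borel_measurable ?P" if "i < N" for i using that by (intro measurable_component_singleton) auto
    have "(\<lambda>\<omega>. grid_inc N \<omega> (rot k j i)) \<in> borel_measurable M" if "i < N" for i
      using rot_bij[OF \<open>k \<le> N\<close>, of j] that
      by (intro measurable_compose[OF grid_inc_measurable 1]) (auto simp: bij_betw_def)
    then show ?thesis unfolding r_def[abs_def] by (intro measurable_restrict) auto
  qed
  have eq: "(\<integral>\<omega>. \<Psi> k (grid_inc N \<omega>) \<partial>M) = (\<integral>\<omega>. \<Psi> k (r k j \<omega>) \<partial>M)" if "k < N" for k j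
  proof -
    have "(\<integral>\<omega>. \<Psi> k (grid_inc N \<omega>) \<partial>M) = (\<integral>v. \<Psi> k v \<partial>distr M ?P (grid_inc N))"
      using \<Psi>m[OF that] by (simp add: integral_distr)
    also have "\<dots> = (\<integral>v. \<Psi> k v \<partial>distr M ?P (r k j))"
      unfolding r_def[abs_def] using grid_inc_rot_law[OF N, of k j] that by simp
    also have "\<dots> = (\<integral>\<omega>. \<Psi> k (r k j \<omega>) \<partial>M)"
      using \<Psi>m[OF that] rm[of k j] that by (simp add: integral_distr)
    finally show ?thesis .
  qed
  have rot_val: "\<Psi> k (r k j \<omega>) = (if last_at N k (W \<omega>) then f k (cyc (W \<omega>) k j) else 0)"
    if "k < N" "j \<in> {1..k} \<or> k = 0" for k j \<omega>
  proof -
    have "last_at N k (walk (r k j \<omega>)) \<longleftrightarrow> last_at N k (W \<omega>)"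
      unfolding r_def W_def using that by (intro last_at_rot) auto
    moreover have "f k (walk (r k j \<omega>)) = f k (cyc (W \<omega>) k j)"
      unfolding r_def W_def using that by (intro local walk_rot) auto
    ultimately show ?thesis by (simp add: \<Psi>_def)
  qed
  have int: "integrable M (\<lambda>\<omega>. \<Psi> k (r k j \<omega>))" "integrable M (\<lambda>\<omega>. \<Psi> k (grid_inc N \<omega>))" if "k < N" for k j
    using measurable_compose[OF rm[of k j] \<Psi>m[OF that]] measurable_compose[OF grid_inc_measurable \<Psi>m[OF that]] that \<Psi>b
    by (auto intro!: integrable_const_bound[of _ C])
  have avg: "(\<integral>\<omega>. \<Psi> k (grid_inc N \<omega>) \<partial>M) = (\<integral>\<omega>. (if last_at N k (W \<omega>) then cyc_avg k (\<lambda>j. f k (cyc (W \<omega>) k j)) else 0) \<partial>M)"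
    and avg_int: "integrable M (\<lambda>\<omega>. (if last_at N k (W \<omega>) then cyc_avg k (\<lambda>j. f k (cyc (W \<omega>) k j)) else 0))"
    if k: "k < N" for k
  proof -
    have *: "(if last_at N k (W \<omega>) then cyc_avg k (\<lambda>j. f k (cyc (W \<omega>) k j)) else 0)
      = cyc_avg k (\<lambda>j. \<Psi> k (r k j \<omega>))" for \<omega>
      using k by (auto simp: cyc_avg_def rot_val intro!: arg_cong2[where f = "(/)"] sum.cong)
    have "(\<integral>\<omega>. cyc_avg k (\<lambda>j. \<Psi> k (r k j \<omega>)) \<partial>M) = cyc_avg k (\<lambda>j. (\<integral>\<omega>. \<Psi> k (r k j \<omega>) \<partial>M))"
      using int[OF k] by (simp add: cyc_avg_def)
    also have "\<dots> = (\<integral>\<omega>. \<Psi> k (grid_inc N \<omega>) \<partial>M)"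
      using eq[OF k] by (simp add: cyc_avg_def eq[OF k, symmetric])
    finally show "(\<integral>\<omega>. \<Psi> k (grid_inc N \<omega>) \<partial>M) = (\<integral>\<omega>. (if last_at N k (W \<omega>) then cyc_avg k (\<lambda>j. f k (cyc (W \<omega>) k j)) else 0) \<partial>M)"
      by (simp add: *)
    show "integrable M (\<lambda>\<omega>. (if last_at N k (W \<omega>) then cyc_avg k (\<lambda>j. f k (cyc (W \<omega>) k j)) else 0))"
      unfolding * using int[OF k] by (cases "k = 0") (simp_all add: cyc_avg_def)
  qed
  have "(\<integral>\<omega>. (\<Sum>k<N. if last_at N k (W \<omega>) then f k (W \<omega>) else 0) \<partial>M) = (\<Sum>k<N. (\<integral>\<omega>. \<Psi> k (grid_inc N \<omega>) \<partial>M))"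
    unfolding W_def \<Psi>_def[symmetric] by (rule Bochner_Integration.integral_sum) (use int in auto)
  also have "\<dots> = (\<Sum>k<N. (\<integral>\<omega>. (if last_at N k (W \<omega>) then cyc_avg k (\<lambda>j. f k (cyc (W \<omega>) k j)) else 0) \<partial>M))"
    by (intro sum.cong refl avg) auto
  also have "\<dots> = (\<integral>\<omega>. (\<Sum>k<N. if last_at N k (W \<omega>) then cyc_avg k (\<lambda>j. f k (cyc (W \<omega>) k j)) else 0) \<partial>M)"
    using avg_int by (intro Bochner_Integration.integral_sum[symmetric]) auto
  finally show ?eq .
  show ?m1
    unfolding W_def \<Psi>_def[symmetric] using int by (intro borel_measurable_sum) auto
  show ?m2
    using avg_int by (intro borel_measurable_sum) auto
qed

end

section \<open>Refining the grid along a path\<close>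

lemma step_function_eq:
  fixes a :: "nat \<Rightarrow> real"
  assumes h: "h > 0"
  shows "indicator {0..<real k * h} u * a (nat \<lfloor>u / h\<rfloor> + 1) = (\<Sum>j\<in>{1..k}. a j * indicator {real (j - 1) * h..<real j * h} u)"
proof (cases "u \<in> {0..<real k * h}")
  case True
  define m where "m = nat \<lfloor>u / h\<rfloor>"
  have m: "real m \<le> u / h" "u / h < real m + 1" using True h by (auto simp: m_def)
  have mk: "m + 1 \<in> {1..k}"
  proof -
    have "u / h < real k" using True h by (simp add: divide_less_eq)
    then show ?thesis using m by auto
  qed
  have "indicator {real (j - 1) * h..<real j * h} u = (if j = m + 1 then 1 else (0::real))" if "j \<in> {1..k}" for j
  proof -
    have "u \<in> {real (j - 1) * h..<real j * h} \<longleftrightarrow> real (j - 1) \<le> u / h \<and> u / h < real j"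
      using h by (auto simp: field_simps)
    also have "\<dots> \<longleftrightarrow> j = m + 1" using m that by (auto simp: of_nat_diff)
    finally show ?thesis by (auto simp: indicator_def)
  qed
  then have "(\<Sum>j\<in>{1..k}. a j * indicator {real (j - 1) * h..<real j * h} u) = (\<Sum>j\<in>{1..k}. if j = m + 1 then a j else 0)"
    by (intro sum.cong) auto
  also have "\<dots> = a (m + 1)" using mk by (simp add: sum.delta)
  finally show ?thesis using True by (simp add: m_def)
next
  case False
  have "indicator {real (j - 1) * h..<real j * h} u = (0::real)" if "j \<in> {1..k}" for j
  proof -
    have "0 \<le> real (j - 1) * h" "real j * h \<le> real k * h" using h that by (auto intro!: mult_right_mono)
    then have "u \<notin> {real (j - 1) * h..<real j * h}"
      using False by (metis atLeastLessThan_iff order_trans less_le_trans)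
    then show ?thesis by simp
  qed
  then show ?thesis using False by simp
qed

lemma emeasure_lborel_Ico_finite: "emeasure lborel {a..<b::real} < top"
  by (cases "a \<le> b") auto

lemma step_function_integral:
  fixes a :: "nat \<Rightarrow> real"
  assumes h: "h > 0"
  shows "(\<integral>u. indicator {0..<real k * h} u * a (nat \<lfloor>u / h\<rfloor> + 1) \<partial>lborel) = (\<Sum>j\<in>{1..k}. a j) * h"
proof -
  have int: "integrable lborel (\<lambda>u. a j * indicator {real (j - 1) * h..<real j * h} u)" for j
    by (intro integrable_mult_right) (auto intro!: integrable_real_indicator simp: emeasure_lborel_Ico_finite)
  have "(\<integral>u. indicator {0..<real k * h} u * a (nat \<lfloor>u / h\<rfloor> + 1) \<partial>lborel)
    = (\<Sum>j\<in>{1..k}. (\<integral>u. a j * indicator {real (j - 1) * h..<real j * h} u \<partial>lborel))"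
    unfolding step_function_eq[OF h] using int by (intro Bochner_Integration.integral_sum)
  also have "\<dots> = (\<Sum>j\<in>{1..k}. a j * h)"
  proof (intro sum.cong refl)
    fix j assume j: "j \<in> {1..k}"
    have le: "real (j - 1) * h \<le> real j * h" using h by (intro mult_right_mono) auto
    have "(\<integral>u. a j * indicator {real (j - 1) * h..<real j * h} u \<partial>lborel) = a j * (real j * h - real (j - 1) * h)"
      using le by simp
    also have "\<dots> = a j * h" using j by (simp add: of_nat_diff algebra_simps)
    finally show "(\<integral>u. a j * indicator {real (j - 1) * h..<real j * h} u \<partial>lborel) = a j * h" .
  qed
  finally show ?thesis by (simp add: sum_distrib_right)
qed

lemma step_function_measurable:
  fixes a :: "nat \<Rightarrow> real"
  assumes h: "h > 0"
  shows "(\<lambda>u. indicator {0..<real k * h} u * a (nat \<lfloor>u / h\<rfloor> + 1)) \<in> borel_measurable borel"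
  unfolding step_function_eq[OF h] by measurable

text \<open>A path on the event \<open>x T > 0\<close> and the end \<open>s\<close> of its loop. The last two assumptions say that \<open>s\<close> is neither
  reached by a jump nor a local minimum; without the latter the grids could miss \<open>s\<close>.\<close>

locale bridge_path =
  fixes x :: "real \<Rightarrow> real" and T s :: real
  assumes path: "sn_path x" and T: "T > 0" and xT: "x T > 0" and s: "s = Sup {t \<in> {0..T}. x t \<le> 0}"
    and left: "s > 0 \<Longrightarrow> (x \<longlongrightarrow> 0) (at_left s)"
    and neg: "\<And>e. s > 0 \<Longrightarrow> e > 0 \<Longrightarrow> \<exists>t. s - e < t \<and> t < s \<and> 0 \<le> t \<and> x t < 0"
begin

lemmas last = last_nonpos[OF path T xT s]

lemma x_nonpos: "t \<le> 0 \<Longrightarrow> x t = 0" using path by (auto simp: sn_path_def)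

definition h :: "nat \<Rightarrow> real" where "h n = T / real (Suc n)"
definition S :: "nat \<Rightarrow> nat \<Rightarrow> real" where "S n i = x (real i * h n)"
definition kap :: "nat \<Rightarrow> nat" where "kap n = (THE k. last_at (Suc n) k (S n))"

text \<open>Times are rounded to the right, so that right-continuity suffices for convergence.\<close>

definition rnd :: "nat \<Rightarrow> real \<Rightarrow> nat" where "rnd n u = nat \<lfloor>u / h n\<rfloor> + 1"

lemma h_pos: "h n > 0" using T by (simp add: h_def)

lemma h_lim: "h \<longlonglongrightarrow> 0"
  unfolding h_def[abs_def] by (rule LIMSEQ_Suc[OF lim_const_over_n])

lemma Suc_h: "real (Suc n) * h n = T" by (simp add: h_def del: of_nat_Suc)

lemma kap_last: "last_at (Suc n) (kap n) (S n)"
proof -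
  obtain k where k: "last_at (Suc n) k (S n)"
    using last_at_ex[of "S n" "Suc n"] x_nonpos[of 0] by (auto simp: S_def)
  then show ?thesis unfolding kap_def by (rule theI) (rule last_at_unique[OF _ k])
qed

lemma kap_eq: "last_at (Suc n) k (S n) \<longleftrightarrow> k = kap n"
  using kap_last last_at_unique by blast

lemma kap_less: "kap n < Suc n"
proof -
  have "S n (Suc n) > 0" unfolding S_def Suc_h using xT .
  then show ?thesis using kap_last[of n] unfolding last_at_def by (cases "kap n = Suc n") auto
qed

lemma grid_le_T: "i \<le> Suc n \<Longrightarrow> real i * h n \<le> T"
  using mult_right_mono[of "real i" "real (Suc n)" "h n"] h_pos[of n] unfolding Suc_h by auto

lemma kap_le: "real (kap n) * h n \<le> s"
proof (rule ccontr)
  assume "\<not> ?thesis"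
  then have "x (real (kap n) * h n) > 0" using grid_le_T[of "kap n" n] kap_less[of n] by (intro last(4)) auto
  then show False using kap_last[of n] by (auto simp: last_at_def S_def)
qed

lemma kap_zero: "s = 0 \<Longrightarrow> kap n = 0"
  using kap_le[of n] h_pos[of n] by (auto simp: mult_le_0_iff)

lemma rnd_bounds: "u \<ge> 0 \<Longrightarrow> u < real (rnd n u) * h n" "u \<ge> 0 \<Longrightarrow> real (rnd n u) * h n \<le> u + h n"
proof -
  assume u: "u \<ge> 0"
  then have "0 \<le> u / h n" using h_pos[of n] by auto
  then have "u / h n < real (rnd n u)" "real (rnd n u) \<le> u / h n + 1"
    unfolding rnd_def by linarith+
  then show "u < real (rnd n u) * h n" "real (rnd n u) * h n \<le> u + h n"
    using h_pos[of n] by (auto simp: field_simps)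
qed

lemma rnd_lim: "u \<ge> 0 \<Longrightarrow> (\<lambda>n. real (rnd n u) * h n) \<longlonglongrightarrow> u"
proof (rule tendsto_sandwich)
  assume u: "u \<ge> 0"
  show "\<forall>\<^sub>F n in sequentially. u \<le> real (rnd n u) * h n" by (intro always_eventually allI less_imp_le rnd_bounds(1)[OF u])
  show "\<forall>\<^sub>F n in sequentially. real (rnd n u) * h n \<le> u + h n" using rnd_bounds(2)[OF u] by auto
  show "(\<lambda>n. u + h n) \<longlonglongrightarrow> u" using tendsto_add[OF tendsto_const h_lim, of u] by simp
qed auto

lemma x_rnd_lim: "u \<ge> 0 \<Longrightarrow> (\<lambda>n. S n (rnd n u)) \<longlonglongrightarrow> x u"
  unfolding S_def
  by (rule right_cont_tendsto[OF sn_path_right_cont[OF path] rnd_lim])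
     (auto intro!: always_eventually less_imp_le rnd_bounds(1))

text \<open>Just before \<open>s\<close> the path is negative on some interval, so fine grids see a nonpositive value there.\<close>

lemma kap_lim: "(\<lambda>n. real (kap n) * h n) \<longlonglongrightarrow> s"
proof (cases "s = 0")
  case True
  then show ?thesis using kap_zero by simp
next
  case False
  then have s0: "s > 0" using last(1) by simp
  show ?thesis
  proof (rule tendstoI)
    fix e :: real assume "e > 0"
    then obtain t where t: "s - e < t" "t < s" "0 \<le> t" "x t < 0" using neg[OF s0] by auto
    have "\<forall>\<^sub>F n in sequentially. S n (rnd n t) < 0"
      by (rule order_tendstoD(2)[OF x_rnd_lim[OF t(3)] t(4)])
    moreover have "\<forall>\<^sub>F n in sequentially. real (rnd n t) * h n < s"
      by (rule order_tendstoD(2)[OF rnd_lim[OF t(3)] t(2)])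
    ultimately show "\<forall>\<^sub>F n in sequentially. dist (real (kap n) * h n) s < e"
    proof eventually_elim
      case (elim n)
      have "rnd n t \<le> Suc n"
      proof -
        have "real (rnd n t) * h n < real (Suc n) * h n" unfolding Suc_h using elim last(2) by simp
        then show ?thesis using h_pos[of n] by (simp only: mult_less_cancel_right_pos of_nat_less_iff)
      qed
      then have "rnd n t \<le> kap n"
        using kap_last[of n] elim(1) unfolding last_at_def
        by (metis greaterThanAtMost_iff not_le order_less_asym)
      then have "real (rnd n t) * h n \<le> real (kap n) * h n" using h_pos[of n] by (intro mult_right_mono) auto
      then show ?case using rnd_bounds(1)[OF t(3), of n] t(1) kap_le[of n] by (auto simp: dist_real_def)
    qed
  qed
qed

text \<open>The error in closing the loop vanishes as the grid is refined.\<close>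

lemma S_kap_lim: "(\<lambda>n. S n (kap n)) \<longlonglongrightarrow> 0"
proof (cases "s = 0")
  case True
  then show ?thesis using kap_zero x_nonpos[of 0] by (simp add: S_def)
next
  case False
  then have s0: "s > 0" using last(1) by simp
  show ?thesis
  proof (rule tendstoI)
    fix e :: real assume e: "e > 0"
    obtain d where d: "d > 0" "\<And>t. s - d < t \<Longrightarrow> t < s \<Longrightarrow> \<bar>x t - 0\<bar> < e"
      using left_limD[OF left[OF s0] e] by blast
    have "\<forall>\<^sub>F n in sequentially. real (kap n) * h n > s - d"
      using d(1) by (intro order_tendstoD(1)[OF kap_lim]) auto
    then show "\<forall>\<^sub>F n in sequentially. dist (S n (kap n)) 0 < e"
    proof eventually_elim
      case (elim n)
      then show ?case using d(2)[of "real (kap n) * h n"] kap_le[of n] last(3) e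
        by (cases "real (kap n) * h n = s") (auto simp: S_def)
    qed
  qed
qed

lemma rnd_in: "0 \<le> u \<Longrightarrow> u < s \<Longrightarrow> \<forall>\<^sub>F n in sequentially. rnd n u \<in> {1..kap n}"
proof -
  assume u: "0 \<le> u" "u < s"
  have "(\<lambda>n. real (kap n) * h n - real (rnd n u) * h n) \<longlonglongrightarrow> s - u"
    by (intro tendsto_intros kap_lim rnd_lim u)
  then have "\<forall>\<^sub>F n in sequentially. real (kap n) * h n - real (rnd n u) * h n > 0"
    using u by (intro order_tendstoD(1)) auto
  then show ?thesis
  proof eventually_elim
    case (elim n)
    then have "real (rnd n u) * h n < real (kap n) * h n" by simp
    then have "rnd n u < kap n" using h_pos[of n] by (simp only: mult_less_cancel_right_pos of_nat_less_iff)
    then show ?case by (simp add: rnd_def)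
  qed
qed

lemma Riemann_sum_lim:
  fixes a :: "nat \<Rightarrow> nat \<Rightarrow> real"
  assumes bound: "\<And>n j. \<bar>a n j\<bar> \<le> C"
    and b [measurable]: "b \<in> borel_measurable borel"
    and lim: "AE u in lborel. 0 < u \<longrightarrow> u < s \<longrightarrow> (\<lambda>n. a n (rnd n u)) \<longlonglongrightarrow> b u"
  shows "(\<lambda>n. (\<Sum>j\<in>{1..kap n}. a n j) * h n) \<longlonglongrightarrow> (\<integral>u. indicator {0..<s} u * b u \<partial>lborel)"
proof -
  let ?f = "\<lambda>n u. indicator {0..<real (kap n) * h n} u * a n (rnd n u)"
  have C: "C \<ge> 0" using bound[of 0 0] by linarith
  have "(\<lambda>n. (\<integral>u. ?f n u \<partial>lborel)) \<longlonglongrightarrow> (\<integral>u. indicator {0..<s} u * b u \<partial>lborel)"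
  proof (rule integral_dominated_convergence[where w = "\<lambda>u. C * indicator {0..<s} u"])
    show "(\<lambda>u. indicator {0..<s} u * b u) \<in> borel_measurable lborel" by measurable
    show "?f n \<in> borel_measurable lborel" for n
      using step_function_measurable[OF h_pos[of n], of "kap n" "a n"] by (simp add: rnd_def)
    show "integrable lborel (\<lambda>u. C * indicator {0..<s} u)"
      by (intro integrable_mult_right integrable_real_indicator) (auto simp: emeasure_lborel_Ico_finite)
    show "AE u in lborel. norm (?f n u) \<le> C * indicator {0..<s} u" for n
    proof (rule AE_I2)
      fix u :: real
      have "u \<in> {0..<real (kap n) * h n} \<Longrightarrow> u \<in> {0..<s}" using kap_le[of n] by auto
      then show "norm (?f n u) \<le> C * indicator {0..<s} u" using bound[of n] C by (auto simp: indicator_def)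
    qed
    have "AE u in lborel. u \<noteq> 0 \<and> u \<noteq> s" using AE_lborel_singleton[of "0::real"] AE_lborel_singleton[of s] by eventually_elim auto
    then show "AE u in lborel. (\<lambda>n. ?f n u) \<longlonglongrightarrow> indicator {0..<s} u * b u"
      using lim
    proof eventually_elim
      case (elim u)
      show ?case
      proof (cases "0 < u \<and> u < s")
        case True
        have "\<forall>\<^sub>F n in sequentially. u < real (kap n) * h n"
          using True by (intro order_tendstoD(1)[OF kap_lim]) auto
        then have "\<forall>\<^sub>F n in sequentially. a n (rnd n u) = ?f n u"
          by eventually_elim (use True in auto)
        moreover have "(\<lambda>n. a n (rnd n u)) \<longlonglongrightarrow> b u" using elim True by auto
        ultimately show ?thesis using True by (auto intro: Lim_transform_eventually)
      next
        case False
        then have out: "u \<notin> {0..<s}" using elim by auto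
        then have "u \<notin> {0..<real (kap n) * h n}" for n using kap_le[of n] by auto
        then show ?thesis using out by simp
      qed
    qed
  qed
  then show ?thesis by (simp only: step_function_integral[OF h_pos] rnd_def)
qed

lemma cyc_avg_lim:
  fixes a :: "nat \<Rightarrow> nat \<Rightarrow> real"
  assumes s0: "s > 0" and bound: "\<And>n j. \<bar>a n j\<bar> \<le> C"
    and b: "b \<in> borel_measurable borel"
    and lim: "AE u in lborel. 0 < u \<longrightarrow> u < s \<longrightarrow> (\<lambda>n. a n (rnd n u)) \<longlonglongrightarrow> b u"
  shows "(\<lambda>n. cyc_avg (kap n) (a n)) \<longlonglongrightarrow> (\<integral>u. indicator {0..<s} u * b u \<partial>lborel) / s"
proof -
  have "(\<lambda>n. ((\<Sum>j\<in>{1..kap n}. a n j) * h n) / (real (kap n) * h n)) \<longlonglongrightarrow> (\<integral>u. indicator {0..<s} u * b u \<partial>lborel) / s"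
    using s0 by (intro tendsto_divide Riemann_sum_lim[OF bound b lim] kap_lim) auto
  moreover have "\<forall>\<^sub>F n in sequentially. ((\<Sum>j\<in>{1..kap n}. a n j) * h n) / (real (kap n) * h n) = cyc_avg (kap n) (a n)"
  proof -
    have "\<forall>\<^sub>F n in sequentially. real (kap n) * h n > 0" using s0 by (intro order_tendstoD(1)[OF kap_lim])
    then show ?thesis
      by eventually_elim (use h_pos in \<open>auto simp: cyc_avg_def zero_less_mult_iff less_imp_neq[symmetric]\<close>)
  qed
  ultimately show ?thesis by (rule Lim_transform_eventually)
qed

end

section \<open>Uniformity along a fixed loop\<close>

lemma src_in: "i \<in> {1..k} \<Longrightarrow> j \<in> {1..k} \<Longrightarrow> src k j i \<in> {1..k}"
  by (auto simp: src_def)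

lemma src_bij: "j \<in> {1..k} \<Longrightarrow> bij_betw (src k j) {1..k} {1..k}"
proof -
  assume j: "j \<in> {1..k}"
  have "inj_on (src k j) {1..k}" using j by (auto simp: inj_on_def src_def split: if_splits)
  moreover have "src k j ` {1..k} \<subseteq> {1..k}" using src_in[OF _ j] by auto
  ultimately show ?thesis by (simp add: bij_betw_def endo_inj_surj)
qed

definition count_nonpos :: "nat \<Rightarrow> (nat \<Rightarrow> real) \<Rightarrow> real" where
  "count_nonpos k S = (\<Sum>i\<in>{1..k}. if S i \<le> 0 then 1 else 0)"

definition first_argmin :: "real \<Rightarrow> nat \<Rightarrow> (nat \<Rightarrow> real) \<Rightarrow> real" where
  "first_argmin c k S = (if k = 0 then 0 else real (LEAST i. i \<in> {1..k} \<and> (\<forall>l\<in>{1..k}. c * S i \<le> c * S l)))"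

lemma first_argminE:
  assumes "k > 0"
  obtains i where "i \<in> {1..k}" "first_argmin c k S = real i" "\<And>l. l \<in> {1..k} \<Longrightarrow> c * S i \<le> c * S l"
proof -
  let ?P = "\<lambda>i. i \<in> {1..k} \<and> (\<forall>l\<in>{1..k}. c * S i \<le> c * S l)"
  have "Min ((\<lambda>i. c * S i) ` {1..k}) \<in> (\<lambda>i. c * S i) ` {1..k}" using assms by (intro Min_in) auto
  then obtain i where i: "i \<in> {1..k}" "c * S i = Min ((\<lambda>i. c * S i) ` {1..k})" by auto
  moreover have "\<forall>l\<in>{1..k}. c * S i \<le> c * S l" unfolding i(2) by (intro ballI Min_le) auto
  ultimately have "?P i" by auto
  then have "?P (LEAST i. ?P i)" by (rule LeastI)
  then show ?thesis using assms that[of "LEAST i. ?P i"] by (simp add: first_argmin_def)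
qed

lemma cyc_scale: "c * cyc S k j i = cyc (\<lambda>i. c * S i) k j i"
  by (simp add: cyc_def algebra_simps)

text \<open>A minimiser of the shifted walk minimises the original walk up to the error in closing the loop.\<close>

lemma cyc_near_min:
  assumes j: "j \<in> {1..k}" and i: "i \<in> {1..k}" and min: "\<And>l. l \<in> {1..k} \<Longrightarrow> cyc S k j i \<le> cyc S k j l"
    and l: "l \<in> {1..k}"
  shows "S (src k j i) \<le> S l + \<bar>S k\<bar>"
proof -
  obtain i' where i': "i' \<in> {1..k}" "src k j i' = l"
    using src_bij[OF j] l unfolding bij_betw_def by (metis imageE)
  have "cyc S k j i \<le> cyc S k j i'" by (rule min[OF i'(1)])
  then show ?thesis using i'(2) by (auto simp: cyc_def split: if_splits)
qed

text \<open>For \<open>0 < p < 1\<close>, the points where a continuous distribution function is at most \<open>p\<close> form a half-line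
  ending at a point where its value is exactly \<open>p\<close>.\<close>

lemma (in real_distribution) probability_integral_transform:
  assumes cont: "\<And>y. measure M {y} = 0"
  shows "prob {y. cdf M y \<le> p} = (if p \<le> 0 then 0 else if p \<ge> 1 then 1 else p)"
proof -
  have bnd: "0 \<le> cdf M y" "cdf M y \<le> 1" for y by (auto simp: cdf_def)
  have mono: "cdf M y \<le> cdf M z" if "y \<le> z" for y z using that by (rule cdf_nondecreasing)
  have isCont: "isCont (cdf M) y" for y using cont by (simp add: isCont_cdf)
  have mid: "prob {y. cdf M y \<le> p} = p" if p: "0 < p" "p < 1" for p
  proof -
    let ?Y = "{y. cdf M y \<le> p}"
    have "\<forall>\<^sub>F y in at_bot. cdf M y < p" using p by (intro order_tendstoD(2)[OF cdf_lim_at_bot])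
    then obtain a where a: "cdf M a < p" by (auto simp: eventually_at_bot_linorder)
    have "\<forall>\<^sub>F y in at_top. cdf M y > p" using p by (intro order_tendstoD(1)[OF cdf_lim_at_top_prob])
    then obtain b where b: "cdf M b > p" by (auto simp: eventually_at_top_linorder)
    have up: "y \<le> b" if "y \<in> ?Y" for y using mono[of b y] that b by force
    have bdd: "bdd_above ?Y" using up by (auto simp: bdd_above_def)
    define q where "q = Sup ?Y"
    have "a \<le> b" using up[of a] a by auto
    then obtain z where z: "cdf M z = p" using IVT[of "cdf M" a p b] a b isCont by force
    have "cdf M q = p"
    proof (rule antisym)
      have "z \<le> q" using z bdd by (auto simp: q_def intro!: cSup_upper)
      then show "p \<le> cdf M q" using mono z by blast
      show "cdf M q \<le> p"
      proof (rule tendsto_upperbound)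
        show "(cdf M \<longlongrightarrow> cdf M q) (at_left q)"
          using isCont[of q] by (auto simp: isCont_def intro: filterlim_mono[OF _ order_refl at_le])
        show "\<forall>\<^sub>F y in at_left q. cdf M y \<le> p"
          unfolding eventually_at_left_field
        proof (intro exI[of _ "q - 1"] conjI allI impI)
          fix y assume "y < q"
          then obtain y' where "y' \<in> ?Y" "y < y'" using less_cSup_iff[OF _ bdd, of y] z by (auto simp: q_def)
          then show "cdf M y \<le> p" using mono[of y y'] by auto
        qed auto
      qed auto
    qed
    moreover have "?Y = {..q}"
    proof
      show "?Y \<subseteq> {..q}" using bdd by (auto simp: q_def intro!: cSup_upper)
      show "{..q} \<subseteq> ?Y" using mono \<open>cdf M q = p\<close> by auto
    qed
    ultimately show ?thesis by (simp add: cdf_def)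
  qed
  have meas: "{y. cdf M y \<le> p} \<in> events" for p
  proof -
    have "cdf M \<in> borel_measurable borel" by (rule borel_measurable_mono) (auto simp: mono_def mono)
    then have "{y \<in> space borel. cdf M y \<le> p} \<in> sets borel" by (intro borel_measurable_le) auto
    then show ?thesis by simp
  qed
  consider "p \<le> 0" | "0 < p" "p < 1" | "p \<ge> 1" by linarith
  then show ?thesis
  proof cases
    case 1
    have small: "prob {y. cdf M y \<le> p} \<le> e" if "e > 0" for e
    proof -
      have "prob {y. cdf M y \<le> p} \<le> prob {y. cdf M y \<le> min e (1/2)}"
        using 1 that by (intro finite_measure_mono meas) auto
      then show ?thesis using mid[of "min e (1/2)"] that by auto
    qed
    have "prob {y. cdf M y \<le> p} \<le> 0"
    proof (rule field_le_epsilon)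
      fix e :: real assume "e > 0"
      then show "prob {y. cdf M y \<le> p} \<le> 0 + e" using small by simp
    qed
    then show ?thesis using 1 by (simp add: antisym)
  next
    case 2
    then show ?thesis using mid by simp
  next
    case 3
    then have "{y. cdf M y \<le> p} = UNIV" using bnd order_trans by blast
    then show ?thesis using 3 prob_space by (simp add: space_eq_univ)
  qed
qed

lemma integral_uniform_measure:
  fixes f :: "'a \<Rightarrow> real"
  assumes A [measurable]: "A \<in> sets M" and em: "emeasure M A \<noteq> 0" "emeasure M A \<noteq> \<infinity>"
    and [measurable]: "f \<in> borel_measurable M"
  shows "(\<integral>x. f x \<partial>uniform_measure M A) = (\<integral>x. indicator A x * f x \<partial>M) / measure M A"
proof -
  have eq: "emeasure M A = ennreal (measure M A)"
    using em(2) by (intro emeasure_eq_ennreal_measure) simp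
  then have pos: "measure M A > 0"
    using em(1) measure_nonneg[of M A] by (metis ennreal_0 order_le_less)
  have "indicator A x / emeasure M A = ennreal (indicator A x / measure M A)" for x
    using divide_ennreal[of 1 "measure M A"] pos by (cases "x \<in> A") (simp_all add: eq)
  then have "uniform_measure M A = density M (\<lambda>x. ennreal (indicator A x / measure M A))"
    by (simp add: uniform_measure_def)
  then have "(\<integral>x. f x \<partial>uniform_measure M A) = (\<integral>x. (indicator A x / measure M A) *\<^sub>R f x \<partial>M)"
    using pos by (simp add: integral_density)
  also have "\<dots> = (\<integral>x. indicator A x * f x / measure M A \<partial>M)"
    by (intro Bochner_Integration.integral_cong) auto
  finally show ?thesis by simp
qed

text \<open>The time that \<open>x\<close> spends below its value at a uniformly chosen time is the distribution function of the
  occupation measure, evaluated at a point sampled from the normalised occupation measure.\<close>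

lemma occupation_rank_uniform:
  fixes x :: "real \<Rightarrow> real" and f :: "real \<Rightarrow> real"
  assumes s: "0 < s" and [measurable]: "x \<in> borel_measurable borel" "f \<in> borel_measurable borel"
    and level: "\<And>c. emeasure lborel {t \<in> {0..<s}. x t = c} = 0"
  defines "A \<equiv> \<lambda>y. measure lborel {t \<in> {0..<s}. x t \<le> y}"
  shows "(\<integral>u. indicator {0..<s} u * f (A (x u)) \<partial>lborel) = (\<integral>u. indicator {0..<s} u * f u \<partial>lborel)"
proof -
  let ?P = "uniform_measure lborel {0..<s}"
  have em: "emeasure lborel {0..<s} = ennreal s" "measure lborel {0..<s} = s" using s by (auto simp: measure_def)
  interpret P: prob_space ?P by (rule prob_space_uniform_measure) (use em s in auto)
  have Pm: "P.prob E = measure lborel ({0..<s} \<inter> E) / s" if "E \<in> sets borel" for E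
    using that em s by (subst measure_uniform_measure) auto
  define \<nu> where "\<nu> = distr ?P borel x"
  interpret N: real_distribution \<nu> unfolding \<nu>_def by (rule P.real_distribution_distr) simp
  have N_meas: "measure \<nu> E = measure lborel {t \<in> {0..<s}. x t \<in> E} / s" if [measurable]: "E \<in> sets borel" for E
  proof -
    have "measure \<nu> E = P.prob (x -` E)" unfolding \<nu>_def by (subst measure_distr) auto
    also have "\<dots> = measure lborel ({0..<s} \<inter> x -` E) / s"
      using measurable_sets_borel[of x borel E] by (intro Pm) simp
    also have "{0..<s} \<inter> x -` E = {t \<in> {0..<s}. x t \<in> E}" by auto
    finally show ?thesis .
  qed
  have cdf_A: "cdf \<nu> y * s = A y" for y using s by (simp add: cdf_def N_meas A_def)
  have no_atom: "measure \<nu> {c} = 0" for c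
  proof -
    have "measure lborel {t \<in> {0..<s}. x t = c} = 0" using level[of c] by (simp add: measure_def)
    then show ?thesis using N_meas[of "{c}"] by simp
  qed
  have cdf_meas [measurable]: "cdf \<nu> \<in> borel_measurable borel"
    by (rule borel_measurable_mono) (auto simp: mono_def N.cdf_nondecreasing)
  have "(\<lambda>u. f (cdf \<nu> (x u) * s)) \<in> borel_measurable borel"
    by (rule measurable_compose[OF borel_measurable_times[OF measurable_compose[OF assms(2) cdf_meas] borel_measurable_const] assms(3)])
  then have Am: "(\<lambda>u. f (A (x u))) \<in> borel_measurable borel"
    by (simp only: cdf_A)
  define Q1 where "Q1 = distr ?P borel (\<lambda>u. cdf \<nu> (x u))"
  define Q2 where "Q2 = distr ?P borel (\<lambda>u. u / s)"
  have "Q1 = Q2"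
  proof (rule cdf_unique)
    have m1: "(\<lambda>u. cdf \<nu> (x u)) \<in> borel_measurable ?P" by (rule measurable_compose[OF _ cdf_meas]) measurable
    then show "real_distribution Q1" unfolding Q1_def by (rule P.real_distribution_distr)
    have "(\<lambda>u. u / s) \<in> borel_measurable ?P" by measurable
    then show "real_distribution Q2" unfolding Q2_def by (rule P.real_distribution_distr)
    show "cdf Q1 = cdf Q2"
    proof
      fix p
      have "{y. cdf \<nu> y \<le> p} = {y \<in> space borel. cdf \<nu> y \<le> p}" by simp
      also have "\<dots> \<in> sets borel" by measurable
      finally have m: "{y. cdf \<nu> y \<le> p} \<in> sets borel" .
      have "cdf Q1 p = P.prob ((\<lambda>u. cdf \<nu> (x u)) -` {..p})"
        unfolding cdf_def[of Q1] unfolding Q1_def using measure_distr[OF m1, of "{..p}"] by simp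
      also have "(\<lambda>u. cdf \<nu> (x u)) -` {..p} = x -` {y. cdf \<nu> y \<le> p}" by auto
      also have "P.prob \<dots> = measure \<nu> {y. cdf \<nu> y \<le> p}"
        unfolding \<nu>_def[of] using m[unfolded \<nu>_def] by (subst measure_distr) (auto simp: \<nu>_def)
      also have "\<dots> = (if p \<le> 0 then 0 else if p \<ge> 1 then 1 else p)"
        by (rule N.probability_integral_transform[OF no_atom])
      also have "\<dots> = measure lborel ({0..<s} \<inter> {..p * s}) / s"
      proof -
        consider "p < 0" | "p = 0" | "0 < p" "p < 1" | "p \<ge> 1" by linarith
        then show ?thesis
        proof cases
          case 1
          then have "{0..<s} \<inter> {..p * s} = {}" using s mult_neg_pos[of p s] by auto
          then show ?thesis using 1 by simp
        next
          case 2
          then have "{0..<s} \<inter> {..p * s} = {0}" using s by auto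
          then show ?thesis using 2 by simp
        next
          case 3
          have "p * s < s" using 3 s by simp
          then have "{0..<s} \<inter> {..p * s} = {0..p * s}" by auto
          then show ?thesis using 3 s by simp
        next
          case 4
          then have "s \<le> p * s" using s by simp
          then have "u \<le> p * s" if "u < s" for u using that by linarith
          then have "{0..<s} \<inter> {..p * s} = {0..<s}" by auto
          then show ?thesis using 4 s em by simp
        qed
      qed
      also have "\<dots> = P.prob {..p * s}" by (rule Pm[symmetric]) simp
      also have "{..p * s} = (\<lambda>u. u / s) -` {..p}" using s by (auto simp: divide_le_eq)
      also have "P.prob \<dots> = cdf Q2 p"
        unfolding Q2_def cdf_def by (subst measure_distr) auto
      finally show "cdf Q1 p = cdf Q2 p" .
    qed
  qed
  then have "(\<integral>w. f (w * s) \<partial>Q1) = (\<integral>w. f (w * s) \<partial>Q2)" by simp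
  then have "(\<integral>u. f (cdf \<nu> (x u) * s) \<partial>?P) = (\<integral>u. f (u / s * s) \<partial>?P)"
    unfolding Q1_def Q2_def by (subst (asm) (1 2) integral_distr) auto
  then have "(\<integral>u. f (A (x u)) \<partial>?P) = (\<integral>u. f u \<partial>?P)" using s by (simp add: cdf_A)
  then show ?thesis
    using em s Am by (subst (asm) (1 2) integral_uniform_measure) auto
qed

text \<open>Running forward from a uniform point of a circle of length \<open>s\<close>, the time until a fixed point is uniform.\<close>

lemma cyclic_distance_uniform:
  fixes f :: "real \<Rightarrow> real"
  assumes m: "0 < m" "m < s" and [measurable]: "f \<in> borel_measurable borel" and C: "\<And>u. \<bar>f u\<bar> \<le> C"
  shows "(\<integral>u. indicator {0..<s} u * f (if u < m then m - u else m - u + s) \<partial>lborel) = (\<integral>u. indicator {0..<s} u * f u \<partial>lborel)"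
proof -
  have C0: "0 \<le> C" using C[of 0] by linarith
  define g1 where "g1 v = indicator {0<..m} v * f v" for v
  define g2 where "g2 v = indicator {m<..s} v * f v" for v
  have int: "integrable lborel (\<lambda>v. indicator E v * f' v)" if "E \<subseteq> {0..s}" "E \<in> sets borel" "f' \<in> borel_measurable borel"
    "\<And>u. \<bar>f' u\<bar> \<le> C" for E and f' :: "real \<Rightarrow> real"
  proof (rule Bochner_Integration.integrable_bound[of _ "\<lambda>u. C * indicator {0..s} u"])
    show "integrable lborel (\<lambda>u. C * indicator {0..s} u)"
      by (intro integrable_mult_right integrable_real_indicator) (auto simp: emeasure_lborel_Icc_eq)
    show "AE u in lborel. norm (indicator E u * f' u) \<le> norm (C * indicator {0..s} u)"
      using that(1,4) C0 by (intro AE_I2) (auto simp: indicator_def abs_mult)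
  qed (use that in measurable)
  have i1: "integrable lborel g1" and i2: "integrable lborel g2"
    unfolding g1_def g2_def using m C by (auto intro!: int)
  have a1: "(\<integral>v. g1 v \<partial>lborel) = (\<integral>u. g1 (m + (-1) * u) \<partial>lborel)"
    using lborel_integral_real_affine[of "-1" g1 m] by simp
  have a2: "(\<integral>v. g2 v \<partial>lborel) = (\<integral>u. g2 ((m + s) + (-1) * u) \<partial>lborel)"
    using lborel_integral_real_affine[of "-1" g2 "m + s"] by simp
  have j1: "integrable lborel (\<lambda>u. g1 (m + (-1) * u))" "integrable lborel (\<lambda>u. g2 ((m + s) + (-1) * u))"
    by (rule lborel_integrable_real_affine[OF i1], simp) (rule lborel_integrable_real_affine[OF i2], simp)
  have "(\<integral>u. indicator {0..<s} u * f (if u < m then m - u else m - u + s) \<partial>lborel) =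
     (\<integral>u. g1 (m + (-1) * u) + g2 ((m + s) + (-1) * u) \<partial>lborel)"
    using m by (intro Bochner_Integration.integral_cong) (auto simp: g1_def g2_def indicator_def algebra_simps)
  also have "\<dots> = (\<integral>v. g1 v + g2 v \<partial>lborel)"
    using j1 i1 i2 a1 a2 by simp
  also have "\<dots> = (\<integral>u. indicator {0..<s} u * f u \<partial>lborel)"
  proof (rule integral_cong_AE)
    have "AE u in lborel. u \<noteq> 0 \<and> u \<noteq> s" using AE_lborel_singleton[of "0::real"] AE_lborel_singleton[of s] by eventually_elim auto
    then show "AE u in lborel. g1 u + g2 u = indicator {0..<s} u * f u"
      by eventually_elim (use m in \<open>auto simp: g1_def g2_def indicator_def\<close>)
  qed (auto simp: g1_def g2_def)
  finally show ?thesis .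
qed

context bridge_path
begin

text \<open>Points at which the walk is minimal up to a vanishing error form a minimising sequence of the path.\<close>

lemma near_min_lim:
  assumes s0: "s > 0" and c: "record_path (\<lambda>t. c * x t)" and wp: "well_posed (\<lambda>t. c * x t) s m"
    and neg: "Inf ((\<lambda>t. c * x t) ` {0..s}) < 0"
    and e: "e \<longlonglongrightarrow> (0::real)"
    and near: "\<forall>\<^sub>F n in sequentially. l n \<in> {1..kap n} \<and> (\<forall>i\<in>{1..kap n}. c * S n (l n) \<le> c * S n i + e n)"
  shows "(\<lambda>n. real (l n) * h n) \<longlonglongrightarrow> m"
proof (rule tendstoI)
  interpret record_path "\<lambda>t. c * x t" by fact
  let ?I = "Inf ((\<lambda>t. c * x t) ` {0..s})"
  fix r :: real assume "r > 0"
  then obtain d where d: "d > 0" "\<And>t. t\<in>{0..s} \<Longrightarrow> c * x t < ?I + d \<Longrightarrow> \<bar>t - m\<bar> < r"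
    using wp unfolding well_posed_def by metis
  have "min (d / 2) (- ?I) > 0" using d neg by auto
  then obtain u where u: "u \<in> {0..s}" "c * x u < ?I + min (d / 2) (- ?I)"
    using near_Inf[of 0 s] s0 by (metis less_imp_le)
  have us: "0 \<le> u" "u < s" using u last(3) by (auto simp: order_le_less)
  have "(\<lambda>n. c * S n (rnd n u)) \<longlonglongrightarrow> c * x u" by (intro tendsto_intros x_rnd_lim us)
  then have "\<forall>\<^sub>F n in sequentially. c * S n (rnd n u) < ?I + d / 2" using u(2) by (intro order_tendstoD(2)) auto
  moreover have "\<forall>\<^sub>F n in sequentially. e n < d / 2" using d(1) by (intro order_tendstoD(2)[OF e]) auto
  ultimately show "\<forall>\<^sub>F n in sequentially. dist (real (l n) * h n) m < r"
    using near rnd_in[OF us]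
  proof eventually_elim
    case (elim n)
    have "c * S n (l n) \<le> c * S n (rnd n u) + e n" using elim by blast
    then have 1: "c * x (real (l n) * h n) < ?I + d" using elim(1,2) unfolding S_def by linarith
    have "real (l n) * h n \<le> real (kap n) * h n" using elim h_pos[of n] by (intro mult_right_mono) auto
    from order_trans[OF this kap_le] have "real (l n) * h n \<in> {0..s}" using h_pos[of n] by simp
    from d(2)[OF this 1] show ?case by (simp add: dist_real_def)
  qed
qed

lemma kap_pos: "s > 0 \<Longrightarrow> \<forall>\<^sub>F n in sequentially. kap n > 0"
proof -
  assume "s > 0"
  then have "\<forall>\<^sub>F n in sequentially. real (kap n) * h n > 0" by (intro order_tendstoD(1)[OF kap_lim])
  then show ?thesis by eventually_elim (auto intro: gr0I)
qed

lemma first_argmin_lim: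
  assumes s0: "s > 0" and c: "record_path (\<lambda>t. c * x t)" and wp: "well_posed (\<lambda>t. c * x t) s m"
    and neg: "Inf ((\<lambda>t. c * x t) ` {0..s}) < 0"
  shows "(\<lambda>n. first_argmin c (kap n) (S n) * h n) \<longlonglongrightarrow> m"
proof -
  have "\<exists>i. first_argmin c (kap n) (S n) = real i \<and> (kap n > 0 \<longrightarrow> i \<in> {1..kap n} \<and> (\<forall>l\<in>{1..kap n}. c * S n i \<le> c * S n l))" for n
  proof (cases "kap n = 0")
    case True
    then show ?thesis by (auto simp: first_argmin_def intro!: exI[of _ 0])
  next
    case False
    then obtain i where "i \<in> {1..kap n}" "first_argmin c (kap n) (S n) = real i" "\<And>l. l \<in> {1..kap n} \<Longrightarrow> c * S n i \<le> c * S n l"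
      using first_argminE[of "kap n" c "S n"] by auto
    then show ?thesis by blast
  qed
  then obtain l where l: "\<And>n. first_argmin c (kap n) (S n) = real (l n)"
    "\<And>n. kap n > 0 \<Longrightarrow> l n \<in> {1..kap n} \<and> (\<forall>i\<in>{1..kap n}. c * S n (l n) \<le> c * S n i)" by metis
  have "(\<lambda>n. real (l n) * h n) \<longlonglongrightarrow> m"
    by (rule near_min_lim[OF s0 c wp neg tendsto_const]) (use kap_pos[OF s0] l(2) in \<open>auto elim: eventually_mono\<close>)
  then show ?thesis by (simp add: l(1))
qed

text \<open>The shift moves the minimum from \<open>m\<close> to \<open>m - u\<close>, taken modulo \<open>s\<close>.\<close>

lemma first_argmin_cyc_lim:
  assumes s0: "s > 0" and c: "record_path (\<lambda>t. c * x t)" and wp: "well_posed (\<lambda>t. c * x t) s m"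
    and neg: "Inf ((\<lambda>t. c * x t) ` {0..s}) < 0"
    and u: "0 < u" "u < s" "u \<noteq> m"
  shows "(\<lambda>n. first_argmin c (kap n) (cyc (S n) (kap n) (rnd n u)) * h n) \<longlonglongrightarrow> (if u < m then m - u else m - u + s)"
proof -
  define good where "good n \<longleftrightarrow> rnd n u \<in> {1..kap n}" for n
  have good: "\<forall>\<^sub>F n in sequentially. good n" unfolding good_def using u by (intro rnd_in) auto
  have "\<exists>i. good n \<longrightarrow> i \<in> {1..kap n} \<and> first_argmin c (kap n) (cyc (S n) (kap n) (rnd n u)) = real i \<and>
    (\<forall>l\<in>{1..kap n}. c * S n (src (kap n) (rnd n u) i) \<le> c * S n l + \<bar>c * S n (kap n)\<bar>)" for n
  proof (cases "good n")
    case True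
    then have j: "rnd n u \<in> {1..kap n}" by (simp add: good_def)
    then have "kap n > 0" by auto
    then obtain i where i: "i \<in> {1..kap n}" "first_argmin c (kap n) (cyc (S n) (kap n) (rnd n u)) = real i"
      "\<And>l. l \<in> {1..kap n} \<Longrightarrow> c * cyc (S n) (kap n) (rnd n u) i \<le> c * cyc (S n) (kap n) (rnd n u) l"
      using first_argminE[of "kap n" c "cyc (S n) (kap n) (rnd n u)"] by auto
    show ?thesis
      using i(1,2) cyc_near_min[OF j i(1) i(3)[unfolded cyc_scale]] by blast
  qed auto
  then obtain i where i: "\<And>n. good n \<Longrightarrow> i n \<in> {1..kap n} \<and> first_argmin c (kap n) (cyc (S n) (kap n) (rnd n u)) = real (i n) \<and>
    (\<forall>l\<in>{1..kap n}. c * S n (src (kap n) (rnd n u) (i n)) \<le> c * S n l + \<bar>c * S n (kap n)\<bar>)" by metis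
  define l where "l n = src (kap n) (rnd n u) (i n)" for n
  have e: "(\<lambda>n. \<bar>c * S n (kap n)\<bar>) \<longlonglongrightarrow> 0"
    using tendsto_rabs[OF tendsto_mult_left[OF S_kap_lim, of c]] by simp
  have l_in: "l n \<in> {1..kap n}" if "good n" for n
    unfolding l_def using i[OF that] that by (intro src_in) (auto simp: good_def)
  have "\<forall>\<^sub>F n in sequentially. l n \<in> {1..kap n} \<and> (\<forall>k\<in>{1..kap n}. c * S n (l n) \<le> c * S n k + \<bar>c * S n (kap n)\<bar>)"
    using good by eventually_elim (use i l_in in \<open>auto simp: l_def\<close>)
  then have l_lim: "(\<lambda>n. real (l n) * h n) \<longlonglongrightarrow> m"
    by (rule near_min_lim[OF s0 c wp neg e])
  have j_lim: "(\<lambda>n. real (rnd n u) * h n) \<longlonglongrightarrow> u" using u by (intro rnd_lim) auto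
  have diff: "(\<lambda>n. real (l n) * h n - real (rnd n u) * h n) \<longlonglongrightarrow> m - u" by (intro tendsto_intros l_lim j_lim)
  have i_l: "real (i n) * h n = (if rnd n u < l n then real (l n) * h n - real (rnd n u) * h n
      else real (l n) * h n - real (rnd n u) * h n + real (kap n) * h n)" if "good n" for n
  proof -
    have "real (i n) = (if rnd n u < l n then real (l n) - real (rnd n u) else real (l n) - real (rnd n u) + real (kap n))"
      using i[OF that] that by (auto simp: l_def src_def good_def split: if_splits)
    then show ?thesis by (simp add: algebra_simps)
  qed
  show ?thesis
  proof (cases "u < m")
    case True
    then have "\<forall>\<^sub>F n in sequentially. real (l n) * h n - real (rnd n u) * h n > 0"
      by (intro order_tendstoD(1)[OF diff]) auto
    then have "\<forall>\<^sub>F n in sequentially. real (l n) * h n - real (rnd n u) * h n = first_argmin c (kap n) (cyc (S n) (kap n) (rnd n u)) * h n"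
      using good
    proof eventually_elim
      case (elim n)
      then have "rnd n u < l n" using h_pos[of n] by (simp add: mult_less_cancel_right_pos)
      then show ?case using i[OF elim(2)] i_l[OF elim(2)] by simp
    qed
    from Lim_transform_eventually[OF diff this] show ?thesis using True by simp
  next
    case False
    then have "\<forall>\<^sub>F n in sequentially. real (l n) * h n - real (rnd n u) * h n < 0"
      using u by (intro order_tendstoD(2)[OF diff]) auto
    then have "\<forall>\<^sub>F n in sequentially. real (l n) * h n - real (rnd n u) * h n + real (kap n) * h n = first_argmin c (kap n) (cyc (S n) (kap n) (rnd n u)) * h n"
      using good
    proof eventually_elim
      case (elim n)
      then have "\<not> rnd n u < l n" using h_pos[of n] by (simp add: mult_less_cancel_right_pos)
      then show ?case using i[OF elim(2)] i_l[OF elim(2)] by simp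
    qed
    from Lim_transform_eventually[OF tendsto_add[OF diff kap_lim] this] show ?thesis using False by simp
  qed
qed

lemma indicator_nonpos_lim:
  assumes "(y::nat \<Rightarrow> real) \<longlonglongrightarrow> l" "l \<noteq> 0"
  shows "(\<lambda>n. if y n \<le> 0 then 1 else (0::real)) \<longlonglongrightarrow> (if l \<le> 0 then 1 else 0)"
proof (cases "l < 0")
  case True
  then have "\<forall>\<^sub>F n in sequentially. y n < 0" by (intro order_tendstoD(2)[OF assms(1)])
  then have "\<forall>\<^sub>F n in sequentially. (if y n \<le> 0 then 1 else (0::real)) = (if l \<le> 0 then 1 else 0)"
    by eventually_elim (use True in auto)
  then show ?thesis by (rule tendsto_eventually)
next
  case False
  then have "\<forall>\<^sub>F n in sequentially. y n > 0" using assms(2) by (intro order_tendstoD(1)[OF assms(1)]) auto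
  then have "\<forall>\<^sub>F n in sequentially. (if y n \<le> 0 then 1 else (0::real)) = (if l \<le> 0 then 1 else 0)"
    by eventually_elim (use False assms(2) in auto)
  then show ?thesis by (rule tendsto_eventually)
qed

lemma occupation_integral:
  assumes [measurable]: "x \<in> borel_measurable borel"
  shows "(\<integral>t. indicator {0..<s} t * (if x t - y \<le> 0 then 1 else (0::real)) \<partial>lborel) = measure lborel {t \<in> {0..<s}. x t \<le> y}"
proof -
  have "(\<integral>t. indicator {0..<s} t * (if x t - y \<le> 0 then 1 else (0::real)) \<partial>lborel) = (\<integral>t. indicator {t \<in> {0..<s}. x t \<le> y} t \<partial>lborel)"
    by (intro Bochner_Integration.integral_cong) (auto simp: indicator_def)
  then show ?thesis by simp
qed

lemma count_lim:
  assumes [measurable]: "x \<in> borel_measurable borel" and lev: "AE t in lborel. 0 < t \<longrightarrow> t < s \<longrightarrow> x t \<noteq> 0"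
  shows "(\<lambda>n. count_nonpos (kap n) (S n) * h n) \<longlonglongrightarrow> measure lborel {t \<in> {0..<s}. x t \<le> 0}"
proof -
  have "(\<lambda>n. (\<Sum>i\<in>{1..kap n}. if S n i \<le> 0 then 1 else 0) * h n) \<longlonglongrightarrow> (\<integral>t. indicator {0..<s} t * (if x t - 0 \<le> 0 then 1 else 0) \<partial>lborel)"
  proof (rule Riemann_sum_lim[where C = 1])
    show "AE t in lborel. 0 < t \<longrightarrow> t < s \<longrightarrow> (\<lambda>n. if S n (rnd n t) \<le> 0 then 1 else (0::real)) \<longlonglongrightarrow> (if x t - 0 \<le> 0 then 1 else 0)"
      using lev
    proof (eventually_elim, intro impI)
      fix t assume t: "0 < t \<longrightarrow> t < s \<longrightarrow> x t \<noteq> 0" "0 < t" "t < s"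
      have "(\<lambda>n. if S n (rnd n t) \<le> 0 then 1 else (0::real)) \<longlonglongrightarrow> (if x t \<le> 0 then 1 else 0)"
        using t by (intro indicator_nonpos_lim x_rnd_lim) auto
      then show "(\<lambda>n. if S n (rnd n t) \<le> 0 then 1 else (0::real)) \<longlonglongrightarrow> (if x t - 0 \<le> 0 then 1 else 0)"
        by simp
    qed
  qed auto
  then show ?thesis unfolding occupation_integral[OF assms(1)] by (simp only: count_nonpos_def)
qed

lemma count_cyc_lim:
  assumes [measurable]: "x \<in> borel_measurable borel" and lev: "AE t in lborel. 0 < t \<longrightarrow> t < s \<longrightarrow> x t \<noteq> x u"
    and u: "0 < u" "u < s"
  shows "(\<lambda>n. count_nonpos (kap n) (cyc (S n) (kap n) (rnd n u)) * h n) \<longlonglongrightarrow> measure lborel {t \<in> {0..<s}. x t \<le> x u}"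
proof -
  define a where "a n l = (if S n l - S n (rnd n u) + (if l \<le> rnd n u then S n (kap n) else 0) \<le> 0 then 1 else (0::real))" for n l
  have "(\<lambda>n. (\<Sum>i\<in>{1..kap n}. a n i) * h n) \<longlonglongrightarrow> (\<integral>t. indicator {0..<s} t * (if x t - x u \<le> 0 then 1 else 0) \<partial>lborel)"
  proof (rule Riemann_sum_lim[where C = 1])
    show "AE t in lborel. 0 < t \<longrightarrow> t < s \<longrightarrow> (\<lambda>n. a n (rnd n t)) \<longlonglongrightarrow> (if x t - x u \<le> 0 then 1 else 0)"
      using lev
    proof (eventually_elim, intro impI)
      fix t assume t: "0 < t \<longrightarrow> t < s \<longrightarrow> x t \<noteq> x u" "0 < t" "t < s"
      have z: "(\<lambda>n. if rnd n t \<le> rnd n u then S n (kap n) else 0) \<longlonglongrightarrow> 0"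
        by (rule Lim_null_comparison[OF _ tendsto_rabs_zero[OF S_kap_lim]]) auto
      have "(\<lambda>n. S n (rnd n t) - S n (rnd n u) + (if rnd n t \<le> rnd n u then S n (kap n) else 0)) \<longlonglongrightarrow> x t - x u + 0"
        using t u by (intro tendsto_intros x_rnd_lim z) auto
      then show "(\<lambda>n. a n (rnd n t)) \<longlonglongrightarrow> (if x t - x u \<le> 0 then 1 else 0)"
        unfolding a_def using t by (intro indicator_nonpos_lim) auto
    qed
  qed (auto simp: a_def)
  moreover have "\<forall>\<^sub>F n in sequentially. (\<Sum>i\<in>{1..kap n}. a n i) * h n = count_nonpos (kap n) (cyc (S n) (kap n) (rnd n u)) * h n"
    using rnd_in[OF less_imp_le[OF u(1)] u(2)]
  proof eventually_elim
    case (elim n)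
    have "(\<Sum>i\<in>{1..kap n}. a n (src (kap n) (rnd n u) i)) = (\<Sum>i\<in>{1..kap n}. a n i)"
      by (rule sum.reindex_bij_betw[OF src_bij[OF elim]])
    then show ?case by (simp add: count_nonpos_def a_def cyc_def)
  qed
  ultimately show ?thesis unfolding occupation_integral[OF assms(1)] by (rule Lim_transform_eventually)
qed

text \<open>The grid functional \<open>\<Phi>\<close> converges to \<open>\<tau>\<close>. If the loop is started at \<open>u\<close> instead, the limit is \<open>\<psi> u\<close>, and
  \<open>\<psi>\<close> maps the uniform distribution on \<open>[0, s]\<close> to itself.\<close>

definition uniformizes :: "(nat \<Rightarrow> (nat \<Rightarrow> real) \<Rightarrow> real) \<Rightarrow> real \<Rightarrow> bool" where
  "uniformizes \<Phi> \<tau> \<longleftrightarrow> (\<lambda>n. \<Phi> (kap n) (S n) * h n) \<longlonglongrightarrow> \<tau> \<and>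
    (\<exists>\<psi>\<in>borel_measurable borel.
      (AE u in lborel. 0 < u \<longrightarrow> u < s \<longrightarrow> (\<lambda>n. \<Phi> (kap n) (cyc (S n) (kap n) (rnd n u)) * h n) \<longlonglongrightarrow> \<psi> u) \<and>
      (\<forall>(f :: real \<Rightarrow> real) C. f \<in> borel_measurable borel \<longrightarrow> (\<forall>u. \<bar>f u\<bar> \<le> C) \<longrightarrow>
        (\<integral>u. indicator {0..<s} u * f (\<psi> u) \<partial>lborel) = (\<integral>u. indicator {0..<s} u * f u \<partial>lborel)))"

lemma uniformizes_count:
  assumes s0: "s > 0" and xm [measurable]: "x \<in> borel_measurable borel"
    and level: "\<And>c. emeasure lborel {t \<in> {0..<s}. x t = c} = 0"
    and level_AE: "\<And>c. AE t in lborel. 0 < t \<longrightarrow> t < s \<longrightarrow> x t \<noteq> c"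
  shows "uniformizes count_nonpos (measure lborel {t \<in> {0..<s}. x t \<le> 0})"
proof -
  define A where "A y = measure lborel {t \<in> {0..<s}. x t \<le> y}" for y
  have "A \<in> borel_measurable borel"
  proof (rule borel_measurable_mono, rule monoI)
    fix y z :: real assume "y \<le> z"
    have "{t \<in> {0..<s}. x t \<le> z} \<in> fmeasurable lborel"
      by (rule fmeasurableI2[of "{0..s}"]) (auto simp: fmeasurable_def emeasure_lborel_Icc_eq)
    then show "A y \<le> A z" unfolding A_def using \<open>y \<le> z\<close> by (intro measure_mono_fmeasurable) auto
  qed
  then have m: "(\<lambda>u. A (x u)) \<in> borel_measurable borel" by (rule measurable_compose[OF xm])
  show ?thesis
    unfolding uniformizes_def
  proof (rule conjI[OF count_lim[OF xm level_AE]], rule bexI[OF _ m], intro conjI AE_I2 impI allI)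
    fix u assume "0 < u" "u < s"
    then show "(\<lambda>n. count_nonpos (kap n) (cyc (S n) (kap n) (rnd n u)) * h n) \<longlonglongrightarrow> A (x u)"
      unfolding A_def by (intro count_cyc_lim xm level_AE)
  next
    fix f :: "real \<Rightarrow> real" and C assume "f \<in> borel_measurable borel"
    then show "(\<integral>u. indicator {0..<s} u * f (A (x u)) \<partial>lborel) = (\<integral>u. indicator {0..<s} u * f u \<partial>lborel)"
      unfolding A_def by (intro occupation_rank_uniform s0 xm level)
  qed
qed

lemma uniformizes_first_argmin:
  assumes c: "record_path (\<lambda>t. c * x t)" and m: "0 < m" "m < s" "well_posed (\<lambda>t. c * x t) s m"
    and I: "Inf ((\<lambda>t. c * x t) ` {0..s}) < 0"
  shows "uniformizes (first_argmin c) (F_right (\<lambda>t. c * x t) s)"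
proof -
  have s0: "s > 0" using m by simp
  have psi: "(\<lambda>u. if u < m then m - u else m - u + s) \<in> borel_measurable borel" by measurable
  show ?thesis
    unfolding uniformizes_def record_path.F_right_eq_argmin[OF c m]
  proof (rule conjI[OF first_argmin_lim[OF s0 c m(3) I]], rule bexI[OF _ psi], intro conjI impI allI)
    show "AE u in lborel. 0 < u \<longrightarrow> u < s \<longrightarrow>
      (\<lambda>n. first_argmin c (kap n) (cyc (S n) (kap n) (rnd n u)) * h n) \<longlonglongrightarrow> (if u < m then m - u else m - u + s)"
      using AE_lborel_singleton[of m]
      by eventually_elim (intro impI first_argmin_cyc_lim[OF s0 c m(3) I])
    fix f :: "real \<Rightarrow> real" and C assume "f \<in> borel_measurable borel" "\<forall>u. \<bar>f u\<bar> \<le> C"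
    then show "(\<integral>u. indicator {0..<s} u * f (if u < m then m - u else m - u + s) \<partial>lborel) = (\<integral>u. indicator {0..<s} u * f u \<partial>lborel)"
      by (intro cyclic_distance_uniform[OF m(1,2)]) auto
  qed
qed

end

section \<open>The cyclic invariance in the limit\<close>

text \<open>The mean of \<open>g s U\<close> for \<open>U\<close> uniformly distributed on \<open>[0, s]\<close>, degenerate at 0 for \<open>s = 0\<close>.\<close>

definition uniform_avg :: "(real \<Rightarrow> real \<Rightarrow> real) \<Rightarrow> real \<Rightarrow> real" where
  "uniform_avg g s = (if s = 0 then g 0 0 else (\<integral>u. indicator {0..<s} u * g s u \<partial>lborel) / s)"

lemma uniform_avg_measurable:
  assumes "continuous_on UNIV (\<lambda>(a, b). g a b)"
  shows "uniform_avg g \<in> borel_measurable borel"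
proof -
  have [measurable]: "(\<lambda>(a, b). g a b) \<in> borel_measurable (borel \<Otimes>\<^sub>M borel)"
    using borel_measurable_continuous_onI[OF assms] by (simp add: borel_prod)
  have "(\<lambda>s. \<integral>u. (if 0 \<le> u \<and> u < s then 1 else 0) * (case (s, u) of (a, b) \<Rightarrow> g a b) \<partial>lborel) \<in> borel_measurable borel"
    by measurable
  moreover have "(if 0 \<le> u \<and> u < s then 1 else 0) = (indicator {0..<s} u :: real)" for u s :: real
    by (auto simp: indicator_def)
  ultimately have [measurable]: "(\<lambda>s. \<integral>u. indicator {0..<s} u * g s u \<partial>lborel) \<in> borel_measurable borel" by simp
  show ?thesis unfolding uniform_avg_def[abs_def] by measurable
qed

lemma count_nonpos_measurable:
  assumes "k < N"
  shows "(\<lambda>v. count_nonpos k (walk v)) \<in> borel_measurable (PiM {..<N} (\<lambda>_. borel))"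
proof -
  have [measurable]: "(\<lambda>v. walk v i) \<in> borel_measurable (PiM {..<N} (\<lambda>_. borel))" if "i \<in> {1..k}" for i
    using that assms by (intro walk_measurable) auto
  show ?thesis unfolding count_nonpos_def by (intro borel_measurable_sum) measurable
qed

lemma first_argmin_measurable:
  assumes "k < N"
  shows "(\<lambda>v. first_argmin c k (walk v)) \<in> borel_measurable (PiM {..<N} (\<lambda>_. borel))"
proof (cases "k = 0")
  case False
  let ?P = "PiM {..<N} (\<lambda>_. borel :: real measure)"
  have w: "(\<lambda>v. c * walk v i) \<in> borel_measurable ?P" if "i \<in> {1..k}" for i
    using that assms by (intro borel_measurable_times borel_measurable_const walk_measurable) auto
  have "Measurable.pred ?P (\<lambda>v. i \<in> {1..k} \<and> (\<forall>l\<in>{1..k}. c * walk v i \<le> c * walk v l))" for i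
  proof (cases "i \<in> {1..k}")
    case True
    have "{v \<in> space ?P. \<forall>l\<in>{1..k}. c * walk v i \<le> c * walk v l} \<in> sets ?P"
      by (rule sets.sets_Collect_finite_All) (rule borel_measurable_le[OF w[OF True] w], assumption, simp)
    moreover have "(\<lambda>v. i \<in> {1..k} \<and> (\<forall>l\<in>{1..k}. c * walk v i \<le> c * walk v l)) = (\<lambda>v. \<forall>l\<in>{1..k}. c * walk v i \<le> c * walk v l)"
      by (simp only: True simp_thms)
    ultimately show ?thesis unfolding Measurable.pred_def by simp
  next
    case False
    then have "(\<lambda>v. i \<in> {1..k} \<and> (\<forall>l\<in>{1..k}. c * walk v i \<le> c * walk v l)) = (\<lambda>v. False)"
      by (simp only: simp_thms)
    then show ?thesis by simp
  qed
  then have "(\<lambda>v. LEAST i. i \<in> {1..k} \<and> (\<forall>l\<in>{1..k}. c * walk v i \<le> c * walk v l)) \<in> measurable ?P (count_space UNIV)"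
    by (rule measurable_Least)
  then have "(\<lambda>v. real (LEAST i. i \<in> {1..k} \<and> (\<forall>l\<in>{1..k}. c * walk v i \<le> c * walk v l))) \<in> borel_measurable ?P"
    by (rule measurable_compose[where g = real]) (rule borel_measurable_count_space)
  moreover have "(\<lambda>v. first_argmin c k (walk v)) = (\<lambda>v. real (LEAST i. i \<in> {1..k} \<and> (\<forall>l\<in>{1..k}. c * walk v i \<le> c * walk v l)))"
    using False by (simp only: first_argmin_def if_False)
  ultimately show ?thesis by (simp only:)
qed (simp add: first_argmin_def)

lemma count_nonpos_local: "(\<And>i. i \<in> {1..k} \<Longrightarrow> S i = S' i) \<Longrightarrow> count_nonpos k S = count_nonpos k S'"
  unfolding count_nonpos_def by (rule sum.cong) simp_all

lemma first_argmin_local: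
  assumes "\<And>i. i \<in> {1..k} \<Longrightarrow> S i = S' i"
  shows "first_argmin c k S = first_argmin c k S'"
proof -
  have "(\<lambda>i. i \<in> {1..k} \<and> (\<forall>l\<in>{1..k}. c * S i \<le> c * S l)) = (\<lambda>i. i \<in> {1..k} \<and> (\<forall>l\<in>{1..k}. c * S' i \<le> c * S' l))"
    using assms by (intro ext conj_cong ball_cong) auto
  then show ?thesis by (simp only: first_argmin_def)
qed

context sn_levy_up
begin

definition sigma :: "'a \<Rightarrow> real" where "sigma \<omega> = Sup {t \<in> {0..T}. X t \<omega> \<le> 0}"
definition E :: "'a set" where "E = {\<omega> \<in> space M. X T \<omega> > 0}"

lemma E_sets [measurable]: "E \<in> sets M" unfolding E_def by measurable

lemma sigma_bounds:
  assumes "\<omega> \<in> space M"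
  shows "0 \<le> sigma \<omega>" "sigma \<omega> \<le> T"
proof -
  have "0 \<in> {t \<in> {0..T}. X t \<omega> \<le> 0}" using X_nonpos[OF assms, of 0] T_pos by auto
  then show "0 \<le> sigma \<omega>" "sigma \<omega> \<le> T" unfolding sigma_def
    by (auto intro!: cSup_upper cSup_least simp: bdd_above_def intro: exI[of _ T])
qed

lemma sigma_measurable [measurable]: "sigma \<in> borel_measurable M"
proof (rule borel_measurableI_greater)
  fix a :: real
  (* Infima are attained, so a nonpositive infimum over a closed window after a exhibits a nonpositive value. *)
  have *: "sigma \<omega> > a \<longleftrightarrow> a < 0 \<or> (\<exists>m::nat. a + 1 / real (Suc m) \<le> T \<and> Inf ((\<lambda>t. 1 * X t \<omega>) ` {a + 1 / real (Suc m)..T}) \<le> 0)"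
    if \<omega>: "\<omega> \<in> space M" for \<omega>
  proof (cases "a < 0")
    case True
    then show ?thesis using sigma_bounds[OF \<omega>] by simp
  next
    case False
    let ?S = "{t \<in> {0..T}. X t \<omega> \<le> 0}"
    have "0 \<in> ?S" using X_nonpos[OF \<omega>, of 0] T_pos by auto
    then have S: "?S \<noteq> {}" "bdd_above ?S" by (blast, auto simp: bdd_above_def)
    show ?thesis
    proof
      assume "sigma \<omega> > a"
      then obtain t where t: "t \<in> ?S" "a < t" using less_cSup_iff[OF S, of a] by (auto simp: sigma_def)
      obtain m where m: "inverse (real (Suc m)) < t - a" using reals_Archimedean[of "t - a"] t by auto
      interpret record_path "\<lambda>t. 1 * X t \<omega>" using \<omega> by (intro signed_record_path) auto
      have "Inf ((\<lambda>t. 1 * X t \<omega>) ` {a + 1 / real (Suc m)..T}) \<le> 1 * X t \<omega>"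
        using m t by (intro Inf_le) (auto simp: inverse_eq_divide simp del: of_nat_Suc)
      then have "a + 1 / real (Suc m) \<le> T \<and> Inf ((\<lambda>t. 1 * X t \<omega>) ` {a + 1 / real (Suc m)..T}) \<le> 0"
        using m t by (auto simp: inverse_eq_divide simp del: of_nat_Suc)
      then show "a < 0 \<or> (\<exists>m::nat. a + 1 / real (Suc m) \<le> T \<and> Inf ((\<lambda>t. 1 * X t \<omega>) ` {a + 1 / real (Suc m)..T}) \<le> 0)"
        by blast
    next
      assume "a < 0 \<or> (\<exists>m::nat. a + 1 / real (Suc m) \<le> T \<and> Inf ((\<lambda>t. 1 * X t \<omega>) ` {a + 1 / real (Suc m)..T}) \<le> 0)"
      then obtain m :: nat where m: "a + 1 / real (Suc m) \<le> T" "Inf ((\<lambda>t. X t \<omega>) ` {a + 1 / real (Suc m)..T}) \<le> 0" using False by auto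
      obtain t where t: "t \<in> {a + 1 / real (Suc m)..T}" "X t \<omega> = Inf ((\<lambda>t. X t \<omega>) ` {a + 1 / real (Suc m)..T})"
        using sn_path_attains_Inf[OF paths[OF \<omega>] m(1)] .
      have "0 < 1 / real (Suc m)" by simp
      moreover have "a + 1 / real (Suc m) \<le> t" using t(1) by simp
      ultimately have at: "a < t" by linarith
      then have "t \<in> ?S" using t m False by auto
      then have "t \<le> sigma \<omega>" unfolding sigma_def using S(2) by (rule cSup_upper)
      then show "a < sigma \<omega>" using at by simp
    qed
  qed
  have "{\<omega> \<in> space M. a < sigma \<omega>} = {\<omega> \<in> space M. a < 0 \<or> (\<exists>m::nat. a + 1 / real (Suc m) \<le> T \<and> Inf ((\<lambda>t. 1 * X t \<omega>) ` {a + 1 / real (Suc m)..T}) \<le> 0)}"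
    using * by blast
  also have "\<dots> \<in> sets M"
  proof -
    have [measurable]: "(\<lambda>\<omega>. Inf ((\<lambda>t. 1 * X t \<omega>) ` {b..T})) \<in> borel_measurable M" for b
      by (rule Inf_measurable) simp
    show ?thesis by measurable
  qed
  finally show "{\<omega> \<in> space M. a < sigma \<omega>} \<in> sets M" .
qed

lemma AE_bridge: "AE \<omega> in M. \<omega> \<in> E \<longrightarrow> bridge_path (\<lambda>t. X t \<omega>) T (sigma \<omega>)"
proof -
  obtain B where B: "countable B" "dense_times B" "AE \<omega> in M. no_ties B (\<lambda>t. X t \<omega>) \<and> no_ties B (\<lambda>t. - X t \<omega>)"
    by (rule no_ties_exists)
  from B(3) show ?thesis
  proof (rule AE_mp, intro AE_I2 impI)
    fix \<omega> assume \<omega>: "\<omega> \<in> space M" "no_ties B (\<lambda>t. X t \<omega>) \<and> no_ties B (\<lambda>t. - X t \<omega>)" "\<omega> \<in> E"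
    have p: "sn_path (\<lambda>t. X t \<omega>)" "X T \<omega> > 0" using paths \<omega> by (auto simp: E_def)
    show "bridge_path (\<lambda>t. X t \<omega>) T (sigma \<omega>)"
    proof
      show "((\<lambda>t. X t \<omega>) \<longlongrightarrow> 0) (at_left (sigma \<omega>))" if "sigma \<omega> > 0"
        using last_nonpos_left(2)[OF p(1) T_pos p(2) sigma_def that B(2)] \<omega> by auto
      show "\<exists>t>sigma \<omega> - e. t < sigma \<omega> \<and> 0 \<le> t \<and> X t \<omega> < 0" if "sigma \<omega> > 0" "e > 0" for e
        using last_nonpos_left(1)[OF p(1) T_pos p(2) sigma_def that(1) B(2) _ that(2)] \<omega> by auto
    qed (use p T_pos in \<open>auto simp: sigma_def\<close>)
  qed
qed

lemma last_at_local:
  assumes "\<And>i. i \<le> N \<Longrightarrow> S i = S' i"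
  shows "last_at N k S \<longleftrightarrow> last_at N k S'"
  using assms by (auto simp: last_at_def)

text \<open>Exactly one summand survives on \<open>E\<close>, and none outside: there the last nonpositive index is the end of the
  grid.\<close>

lemma sum_last_at:
  assumes \<omega>: "\<omega> \<in> space M" and br: "\<omega> \<in> E \<Longrightarrow> bridge_path (\<lambda>t. X t \<omega>) T (sigma \<omega>)"
  shows "(\<Sum>k<Suc n. if last_at (Suc n) k (walk (grid_inc (Suc n) \<omega>)) then F k else (0::real)) =
    indicator E \<omega> * F (bridge_path.kap (\<lambda>t. X t \<omega>) T n)"
proof (cases "\<omega> \<in> E")
  case True
  interpret bridge_path "\<lambda>t. X t \<omega>" T "sigma \<omega>" by (rule br[OF True])
  have "last_at (Suc n) k (walk (grid_inc (Suc n) \<omega>)) \<longleftrightarrow> k = kap n" for k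
    unfolding kap_eq[symmetric] by (rule last_at_local) (simp add: walk_grid_inc[OF \<omega>] S_def h_def)
  then show ?thesis using True kap_less[of n] by (simp del: sum.lessThan_Suc)
next
  case False
  have "walk (grid_inc (Suc n) \<omega>) (Suc n) = X T \<omega>" by (simp add: walk_grid_inc[OF \<omega>] del: of_nat_Suc)
  then have "\<not> last_at (Suc n) k (walk (grid_inc (Suc n) \<omega>))" if "k < Suc n" for k
    using False \<omega> that by (auto simp: last_at_def E_def intro!: bexI[of _ "Suc n"])
  then show ?thesis using False by simp
qed

text \<open>On \<open>E\<close> and given \<open>sigma\<close>, the time \<open>\<tau>\<close> is uniformly distributed on \<open>[0, sigma]\<close>. The measurable version \<open>\<tau>'\<close>
  appears because \<open>\<tau>\<close> may be measurable only with respect to the completion.\<close>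

definition uniform_time :: "('a \<Rightarrow> real) \<Rightarrow> bool" where
  "uniform_time \<tau> \<longleftrightarrow> (\<exists>\<tau>'\<in>borel_measurable M. (AE \<omega> in M. \<omega> \<in> E \<longrightarrow> \<tau>' \<omega> = \<tau> \<omega>) \<and>
    (\<forall>g C. continuous_on UNIV (\<lambda>(a, b). g a b) \<longrightarrow> (\<forall>a b. \<bar>g a b\<bar> \<le> C) \<longrightarrow>
      (\<integral>\<omega>. indicator E \<omega> * g (sigma \<omega>) (\<tau>' \<omega>) \<partial>M) = (\<integral>\<omega>. indicator E \<omega> * uniform_avg g (sigma \<omega>) \<partial>M)))"

lemma uniform_timeE:
  assumes "uniform_time \<tau>"
  obtains \<tau>' where "\<tau>' \<in> borel_measurable M" "AE \<omega> in M. \<omega> \<in> E \<longrightarrow> \<tau>' \<omega> = \<tau> \<omega>"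
    "\<And>g C. continuous_on UNIV (\<lambda>(a, b). g a b) \<Longrightarrow> (\<And>a b. \<bar>g a b\<bar> \<le> C) \<Longrightarrow>
      (\<integral>\<omega>. indicator E \<omega> * g (sigma \<omega>) (\<tau>' \<omega>) \<partial>M) = (\<integral>\<omega>. indicator E \<omega> * uniform_avg g (sigma \<omega>) \<partial>M)"
  using assms unfolding uniform_time_def by blast

text \<open>On each grid, the functional \<open>\<Phi>\<close> and its average over all cyclic shifts give the same expectation of \<open>g\<close>.
  As the grid is refined, the former tends to the expectation of \<open>g sigma \<tau>\<close>, and the latter to that of the
  average of \<open>g sigma\<close> over \<open>[0, sigma]\<close>.\<close>

theorem cyclic_limit:
  fixes \<Phi> :: "nat \<Rightarrow> (nat \<Rightarrow> real) \<Rightarrow> real" and \<tau> :: "'a \<Rightarrow> real"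
  assumes meas: "\<And>N k. k < N \<Longrightarrow> (\<lambda>v. \<Phi> k (walk v)) \<in> borel_measurable (PiM {..<N} (\<lambda>_. borel))"
    and local: "\<And>k S S'. (\<And>i. i \<in> {1..k} \<Longrightarrow> S i = S' i) \<Longrightarrow> \<Phi> k S = \<Phi> k S'"
    and \<Phi>0: "\<And>S. \<Phi> 0 S = 0"
    and tau0: "\<And>\<omega>. \<omega> \<in> E \<Longrightarrow> sigma \<omega> = 0 \<Longrightarrow> \<tau> \<omega> = 0"
    and unif: "AE \<omega> in M. \<omega> \<in> E \<longrightarrow> 0 < sigma \<omega> \<longrightarrow> bridge_path.uniformizes (\<lambda>t. X t \<omega>) T (sigma \<omega>) \<Phi> (\<tau> \<omega>)"
  shows "uniform_time \<tau>"
proof -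
  define W where "W n \<omega> = walk (grid_inc (Suc n) \<omega>)" for n \<omega>
  define \<tau>' where "\<tau>' \<omega> = lim (\<lambda>n. \<Sum>k<Suc n. if last_at (Suc n) k (W n \<omega>) then \<Phi> k (W n \<omega>) * (T / real (Suc n)) else 0)" for \<omega>
  have \<tau>'m [measurable]: "\<tau>' \<in> borel_measurable M"
    unfolding \<tau>'_def[abs_def]
  proof (intro borel_measurable_lim_metric borel_measurable_sum)
    fix n k assume k: "k \<in> {..<Suc n}"
    have "(\<lambda>v. if last_at (Suc n) k (walk v) then \<Phi> k (walk v) * (T / real (Suc n)) else 0) \<in> borel_measurable (PiM {..<Suc n} (\<lambda>_. borel))"
      using k last_at_measurable[of "Suc n" k]
      by (intro measurable_If borel_measurable_times meas borel_measurable_const) auto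
    from measurable_compose[OF grid_inc_measurable this]
    show "(\<lambda>\<omega>. if last_at (Suc n) k (W n \<omega>) then \<Phi> k (W n \<omega>) * (T / real (Suc n)) else 0) \<in> borel_measurable M"
      unfolding W_def .
  qed
  have W_S: "W n \<omega> i = bridge_path.S (\<lambda>t. X t \<omega>) T n i" if "\<omega> \<in> E" "bridge_path (\<lambda>t. X t \<omega>) T (sigma \<omega>)" "i \<le> Suc n" for n \<omega> i
  proof -
    interpret bridge_path "\<lambda>t. X t \<omega>" T "sigma \<omega>" by fact
    show ?thesis using that by (simp add: W_def walk_grid_inc E_def S_def h_def)
  qed
  have W_\<Phi>: "\<Phi> (bridge_path.kap (\<lambda>t. X t \<omega>) T n) (W n \<omega>) = \<Phi> (bridge_path.kap (\<lambda>t. X t \<omega>) T n) (bridge_path.S (\<lambda>t. X t \<omega>) T n)"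
    if \<omega>: "\<omega> \<in> E" "bridge_path (\<lambda>t. X t \<omega>) T (sigma \<omega>)" for n \<omega>
  proof (rule local)
    interpret bridge_path "\<lambda>t. X t \<omega>" T "sigma \<omega>" by (rule \<omega>(2))
    fix i assume "i \<in> {1..kap n}"
    then show "W n \<omega> i = S n i" using kap_less[of n] by (intro W_S[OF \<omega>]) auto
  qed
  have ptw: "AE \<omega> in M. \<omega> \<in> E \<longrightarrow> bridge_path (\<lambda>t. X t \<omega>) T (sigma \<omega>) \<and> \<tau>' \<omega> = \<tau> \<omega> \<and>
      (\<lambda>n. \<Phi> (bridge_path.kap (\<lambda>t. X t \<omega>) T n) (bridge_path.S (\<lambda>t. X t \<omega>) T n) * bridge_path.h T n) \<longlonglongrightarrow> \<tau>' \<omega>"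
    using AE_bridge unif AE_space
  proof eventually_elim
    case (elim \<omega>)
    show ?case
    proof
      assume \<omega>: "\<omega> \<in> E"
      then have br: "bridge_path (\<lambda>t. X t \<omega>) T (sigma \<omega>)" using elim by blast
      interpret bridge_path "\<lambda>t. X t \<omega>" T "sigma \<omega>" by (rule br)
      have l: "(\<lambda>n. \<Phi> (kap n) (S n) * h n) \<longlonglongrightarrow> \<tau> \<omega>"
      proof (cases "sigma \<omega> = 0")
        case True
        then show ?thesis using kap_zero \<Phi>0 tau0[OF \<omega>] by simp
      next
        case False
        then show ?thesis using elim(2) \<omega> last(1) unfolding uniformizes_def by simp
      qed
      have "(\<Sum>k<Suc n. if last_at (Suc n) k (W n \<omega>) then \<Phi> k (W n \<omega>) * (T / real (Suc n)) else 0) = \<Phi> (kap n) (S n) * h n" for n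
        using sum_last_at[OF elim(3) br, of n "\<lambda>k. \<Phi> k (W n \<omega>) * (T / real (Suc n))", folded W_def] \<omega> W_\<Phi>[OF \<omega> br, of n]
        by (simp add: h_def del: sum.lessThan_Suc)
      then have "\<tau>' \<omega> = \<tau> \<omega>" unfolding \<tau>'_def using l by (simp add: limI del: sum.lessThan_Suc)
      then show "bridge_path (\<lambda>t. X t \<omega>) T (sigma \<omega>) \<and> \<tau>' \<omega> = \<tau> \<omega> \<and> (\<lambda>n. \<Phi> (kap n) (S n) * h n) \<longlonglongrightarrow> \<tau>' \<omega>"
        using br l by simp
    qed
  qed
  show ?thesis
    unfolding uniform_time_def
  proof (intro bexI[OF _ \<tau>'m] conjI allI impI)
    show "AE \<omega> in M. \<omega> \<in> E \<longrightarrow> \<tau>' \<omega> = \<tau> \<omega>" using ptw by eventually_elim auto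
    fix g :: "real \<Rightarrow> real \<Rightarrow> real" and C
    assume cont: "continuous_on UNIV (\<lambda>(a, b). g a b)" and bound: "\<forall>a b. \<bar>g a b\<bar> \<le> C"
    define f where "f n k S = g (real k * (T / real (Suc n))) (\<Phi> k S * (T / real (Suc n)))" for n k S
    define A where "A n \<omega> = (\<Sum>k<Suc n. if last_at (Suc n) k (W n \<omega>) then f n k (W n \<omega>) else 0)" for n \<omega>
    define B where "B n \<omega> = (\<Sum>k<Suc n. if last_at (Suc n) k (W n \<omega>) then cyc_avg k (\<lambda>j. f n k (cyc (W n \<omega>) k j)) else 0)" for n \<omega>
    have g_lim: "(\<lambda>n. g (a n) (b n)) \<longlonglongrightarrow> g a' b'" if "a \<longlonglongrightarrow> a'" "b \<longlonglongrightarrow> b'" for a b a' b'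
    proof -
      have "isCont (\<lambda>(a, b). g a b) (a', b')" using cont by (simp add: continuous_on_eq_continuous_at)
      from isCont_tendsto_compose[OF this tendsto_Pair[OF that]] show ?thesis by simp
    qed
    have gm [measurable]: "(\<lambda>(a, b). g a b) \<in> borel_measurable (borel \<Otimes>\<^sub>M borel)"
      using borel_measurable_continuous_onI[OF cont] by (simp add: borel_prod)
    have gsm: "g a \<in> borel_measurable borel" for a
      using measurable_compose[OF measurable_Pair1'[of a borel borel] gm] by simp
    have C0: "0 \<le> C" using bound by (meson abs_ge_zero order_trans)
    have f_meas: "(\<lambda>v. f n k (walk v)) \<in> borel_measurable (PiM {..<Suc n} (\<lambda>_. borel))" if "k < Suc n" for n k
    proof -
      have "(\<lambda>v. \<Phi> k (walk v) * (T / real (Suc n))) \<in> borel_measurable (PiM {..<Suc n} (\<lambda>_. borel))"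
        using meas[OF that] by measurable
      from measurable_compose[OF this gsm] show ?thesis by (simp add: f_def)
    qed
    have f_bound: "\<bar>f n k S\<bar> \<le> C" for n k S using bound by (simp add: f_def)
    have f_local: "f n k S = f n k S'" if "\<And>i. i \<in> {1..k} \<Longrightarrow> S i = S' i" for n k S S'
      using local[of k S S', OF that] by (simp add: f_def)
    note exchange = cyclic_exchange[OF zero_less_Suc f_meas f_bound f_local]
    have ex: "(\<integral>\<omega>. A n \<omega> \<partial>M) = (\<integral>\<omega>. B n \<omega> \<partial>M)" and Am: "A n \<in> borel_measurable M" and Bm: "B n \<in> borel_measurable M" for n
      unfolding A_def[abs_def] B_def[abs_def] W_def by (rule exchange; assumption)+
    have cyc_avg_bound: "\<bar>cyc_avg k F\<bar> \<le> C" if "\<And>j. \<bar>F j\<bar> \<le> C" for k and F :: "nat \<Rightarrow> real"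
    proof (cases "k = 0")
      case False
      have "\<bar>\<Sum>j\<in>{1..k}. F j\<bar> \<le> (\<Sum>j\<in>{1..k}. \<bar>F j\<bar>)" by (rule sum_abs)
      also have "\<dots> \<le> (\<Sum>j\<in>{1..k}. C)" by (intro sum_mono that)
      finally show ?thesis using False by (simp add: cyc_avg_def divide_le_eq mult.commute)
    qed (simp add: cyc_avg_def that)
    have A_val: "A n \<omega> = indicator E \<omega> * f n (bridge_path.kap (\<lambda>t. X t \<omega>) T n) (W n \<omega>)"
      and B_val: "B n \<omega> = indicator E \<omega> * cyc_avg (bridge_path.kap (\<lambda>t. X t \<omega>) T n) (\<lambda>j. f n (bridge_path.kap (\<lambda>t. X t \<omega>) T n) (cyc (W n \<omega>) (bridge_path.kap (\<lambda>t. X t \<omega>) T n) j))"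
      if "\<omega> \<in> space M" "\<omega> \<in> E \<Longrightarrow> bridge_path (\<lambda>t. X t \<omega>) T (sigma \<omega>)" for n \<omega>
      unfolding A_def B_def W_def by (rule sum_last_at[OF that], simp)+
    have limA: "(\<lambda>n. (\<integral>\<omega>. A n \<omega> \<partial>M)) \<longlonglongrightarrow> (\<integral>\<omega>. indicator E \<omega> * g (sigma \<omega>) (\<tau>' \<omega>) \<partial>M)"
    proof (rule integral_dominated_convergence[where w = "\<lambda>_. C"])
      have "(\<lambda>\<omega>. case (sigma \<omega>, \<tau>' \<omega>) of (a, b) \<Rightarrow> g a b) \<in> borel_measurable M" by measurable
      then show "(\<lambda>\<omega>. indicator E \<omega> * g (sigma \<omega>) (\<tau>' \<omega>)) \<in> borel_measurable M" by simp
      show "AE \<omega> in M. norm (A n \<omega>) \<le> C" for n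
        using ptw AE_space by eventually_elim (use A_val bound C0 in \<open>auto simp: f_def indicator_def\<close>)
      show "AE \<omega> in M. (\<lambda>n. A n \<omega>) \<longlonglongrightarrow> indicator E \<omega> * g (sigma \<omega>) (\<tau>' \<omega>)"
        using ptw AE_space
      proof eventually_elim
        case (elim \<omega>)
        show ?case
        proof (cases "\<omega> \<in> E")
          case True
          then have br: "bridge_path (\<lambda>t. X t \<omega>) T (sigma \<omega>)" using elim by blast
          interpret bridge_path "\<lambda>t. X t \<omega>" T "sigma \<omega>" by (rule br)
          have "A n \<omega> = g (real (kap n) * h n) (\<Phi> (kap n) (S n) * h n)" for n
            using A_val[OF elim(2) br, of n] True W_\<Phi>[OF True br, of n] by (simp add: f_def h_def)
          moreover have "(\<lambda>n. g (real (kap n) * h n) (\<Phi> (kap n) (S n) * h n)) \<longlonglongrightarrow> g (sigma \<omega>) (\<tau>' \<omega>)"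
            using elim(1) True by (intro g_lim kap_lim) auto
          ultimately show ?thesis using True by simp
        next
          case False
          then show ?thesis using A_val[OF elim(2)] by simp
        qed
      qed
    qed (use Am in auto)
    have limB: "(\<lambda>n. (\<integral>\<omega>. B n \<omega> \<partial>M)) \<longlonglongrightarrow> (\<integral>\<omega>. indicator E \<omega> * uniform_avg g (sigma \<omega>) \<partial>M)"
    proof (rule integral_dominated_convergence[where w = "\<lambda>_. C"])
      show "(\<lambda>\<omega>. indicator E \<omega> * uniform_avg g (sigma \<omega>)) \<in> borel_measurable M"
        using measurable_compose[OF sigma_measurable uniform_avg_measurable[OF cont]] by measurable
      show "AE \<omega> in M. norm (B n \<omega>) \<le> C" for n
        using ptw AE_space
      proof eventually_elim
        case (elim \<omega>)
        have "\<bar>cyc_avg (bridge_path.kap (\<lambda>t. X t \<omega>) T n) (\<lambda>j. f n (bridge_path.kap (\<lambda>t. X t \<omega>) T n) (cyc (W n \<omega>) (bridge_path.kap (\<lambda>t. X t \<omega>) T n) j))\<bar> \<le> C"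
          by (rule cyc_avg_bound) (simp add: f_def bound)
        then show ?case using B_val[of \<omega> n] elim C0 by (auto simp: indicator_def)
      qed
      show "AE \<omega> in M. (\<lambda>n. B n \<omega>) \<longlonglongrightarrow> indicator E \<omega> * uniform_avg g (sigma \<omega>)"
        using ptw unif AE_space
      proof eventually_elim
        case (elim \<omega>)
        show ?case
        proof (cases "\<omega> \<in> E")
          case True
          then have br: "bridge_path (\<lambda>t. X t \<omega>) T (sigma \<omega>)" using elim by blast
          interpret bridge_path "\<lambda>t. X t \<omega>" T "sigma \<omega>" by (rule br)
          define a where "a n j = g (real (kap n) * h n) (\<Phi> (kap n) (cyc (S n) (kap n) j) * h n)" for n j
          have B_a: "B n \<omega> = cyc_avg (kap n) (a n)" for n
          proof -
            have "f n (kap n) (cyc (W n \<omega>) (kap n) j) = a n j" if "j \<in> {1..kap n} \<or> kap n = 0" for j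
            proof -
              have "\<Phi> (kap n) (cyc (W n \<omega>) (kap n) j) = \<Phi> (kap n) (cyc (S n) (kap n) j)"
              proof (rule local)
                fix i assume i: "i \<in> {1..kap n}"
                then have "j \<in> {1..kap n}" using that by auto
                moreover from src_in[OF i this] have "src (kap n) j i \<in> {1..kap n}" .
                ultimately show "cyc (W n \<omega>) (kap n) j i = cyc (S n) (kap n) j i"
                  using kap_less[of n] by (simp add: cyc_def W_S[OF True br])
              qed
              then show ?thesis by (simp add: f_def a_def h_def)
            qed
            then have "cyc_avg (kap n) (\<lambda>j. f n (kap n) (cyc (W n \<omega>) (kap n) j)) = cyc_avg (kap n) (a n)"
              by (auto simp: cyc_avg_def intro!: arg_cong2[where f = "(/)"] sum.cong)
            then show ?thesis using B_val[OF elim(3) br, of n] True by simp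
          qed
          have "(\<lambda>n. cyc_avg (kap n) (a n)) \<longlonglongrightarrow> uniform_avg g (sigma \<omega>)"
          proof (cases "sigma \<omega> = 0")
            case True
            then show ?thesis using kap_zero \<Phi>0 by (simp add: cyc_avg_def a_def uniform_avg_def)
          next
            case False
            then have s0: "sigma \<omega> > 0" using last(1) by simp
            note unif_\<omega> = mp[OF mp[OF elim(2) \<open>\<omega> \<in> E\<close>] s0, unfolded uniformizes_def, THEN conjunct2]
            from unif_\<omega> obtain \<psi> where \<psi>: "\<psi> \<in> borel_measurable borel"
              "AE u in lborel. 0 < u \<longrightarrow> u < sigma \<omega> \<longrightarrow> (\<lambda>n. \<Phi> (kap n) (cyc (S n) (kap n) (rnd n u)) * h n) \<longlonglongrightarrow> \<psi> u"
              "\<forall>(f :: real \<Rightarrow> real) C. f \<in> borel_measurable borel \<longrightarrow> (\<forall>u. \<bar>f u\<bar> \<le> C) \<longrightarrow>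
                (\<integral>u. indicator {0..<sigma \<omega>} u * f (\<psi> u) \<partial>lborel) = (\<integral>u. indicator {0..<sigma \<omega>} u * f u \<partial>lborel)"
              by (elim bexE conjE) (rule that)
            have "(\<lambda>n. cyc_avg (kap n) (a n)) \<longlonglongrightarrow> (\<integral>u. indicator {0..<sigma \<omega>} u * g (sigma \<omega>) (\<psi> u) \<partial>lborel) / sigma \<omega>"
            proof (rule cyc_avg_lim[OF s0, where C = C])
              show "\<bar>a n j\<bar> \<le> C" for n j by (simp add: a_def bound)
              show "(\<lambda>u. g (sigma \<omega>) (\<psi> u)) \<in> borel_measurable borel" by (rule measurable_compose[OF \<psi>(1) gsm])
              show "AE u in lborel. 0 < u \<longrightarrow> u < sigma \<omega> \<longrightarrow> (\<lambda>n. a n (rnd n u)) \<longlonglongrightarrow> g (sigma \<omega>) (\<psi> u)"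
                using \<psi>(2) by eventually_elim (auto simp: a_def intro!: g_lim kap_lim)
            qed
            also have "(\<integral>u. indicator {0..<sigma \<omega>} u * g (sigma \<omega>) (\<psi> u) \<partial>lborel) = (\<integral>u. indicator {0..<sigma \<omega>} u * g (sigma \<omega>) u \<partial>lborel)"
              using bound by (intro mp[OF mp[OF spec[OF spec[OF \<psi>(3)]]]] gsm) blast
            finally show ?thesis using s0 by (simp add: uniform_avg_def)
          qed
          then show ?thesis using True by (simp add: B_a)
        next
          case False
          then show ?thesis using B_val[OF elim(3)] by simp
        qed
      qed
    qed (use Bm in auto)
    show "(\<integral>\<omega>. indicator E \<omega> * g (sigma \<omega>) (\<tau>' \<omega>) \<partial>M) = (\<integral>\<omega>. indicator E \<omega> * uniform_avg g (sigma \<omega>) \<partial>M)"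
      using LIMSEQ_unique[OF limA limB[folded ex]] .
  qed
qed

end

section \<open>The laws of the six times\<close>

lemma N_minus_eq_occupation:
  assumes [measurable]: "x \<in> borel_measurable borel"
  shows "N_minus x s = measure lborel {t \<in> {0..<s}. x t \<le> 0}"
proof -
  have "N_minus x s = (\<integral>t. indicator {0..s} t * indicator {v. x v \<le> 0} t \<partial>lborel)"
    by (simp add: N_minus_def set_lebesgue_integral_def)
  also have "\<dots> = (\<integral>t. indicator {t \<in> {0..<s}. x t \<le> 0} t \<partial>lborel)"
  proof (rule integral_cong_AE)
    show "AE t in lborel. indicator {0..s} t * indicator {v. x v \<le> 0} t = (indicator {t \<in> {0..<s}. x t \<le> 0} t :: real)"
      using AE_lborel_singleton[of s] by eventually_elim (auto simp: indicator_def)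
  qed (auto intro!: borel_measurable_times borel_measurable_indicator)
  also have "\<dots> = measure lborel {t \<in> {0..<s}. x t \<le> 0}" by simp
  finally show ?thesis .
qed

context sn_levy_up
begin

lemma uniform_time_cong:
  assumes "AE \<omega> in M. \<omega> \<in> E \<longrightarrow> \<tau>1 \<omega> = \<tau>2 \<omega>" "uniform_time \<tau>1"
  shows "uniform_time \<tau>2"
proof -
  obtain \<tau>' where \<tau>': "\<tau>' \<in> borel_measurable M" "AE \<omega> in M. \<omega> \<in> E \<longrightarrow> \<tau>' \<omega> = \<tau>1 \<omega>"
    "\<forall>g C. continuous_on UNIV (\<lambda>(a, b). g a b) \<longrightarrow> (\<forall>a b. \<bar>g a b\<bar> \<le> C) \<longrightarrow>
      (\<integral>\<omega>. indicator E \<omega> * g (sigma \<omega>) (\<tau>' \<omega>) \<partial>M) = (\<integral>\<omega>. indicator E \<omega> * uniform_avg g (sigma \<omega>) \<partial>M)"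
    using assms(2) unfolding uniform_time_def by blast
  have "AE \<omega> in M. \<omega> \<in> E \<longrightarrow> \<tau>' \<omega> = \<tau>2 \<omega>" using \<tau>'(2) assms(1) by eventually_elim auto
  then show ?thesis unfolding uniform_time_def using \<tau>'(1,3) by blast
qed

lemma uniform_avg_reverse:
  assumes [measurable]: "g s \<in> borel_measurable borel"
  shows "uniform_avg (\<lambda>a b. g a (a - b)) s = uniform_avg g s"
proof (cases "s = 0")
  case False
  have "(\<integral>u. indicator {0..<s} u * g s u \<partial>lborel) = (\<integral>u. indicator {0..<s} (s + (-1) * u) * g s (s + (-1) * u) \<partial>lborel)"
    using lborel_integral_real_affine[of "-1" "\<lambda>u. indicator {0..<s} u * g s u" s] by simp
  also have "\<dots> = (\<integral>u. indicator {0..<s} u * g s (s - u) \<partial>lborel)"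
  proof (rule integral_cong_AE)
    show "AE u in lborel. indicator {0..<s} (s + (-1) * u) * g s (s + (-1) * u) = indicator {0..<s} u * g s (s - u)"
      using AE_lborel_singleton[of "0::real"] AE_lborel_singleton[of s] by eventually_elim (auto simp: indicator_def)
  qed measurable
  finally show ?thesis using False by (simp add: uniform_avg_def)
qed (simp add: uniform_avg_def)

lemma uniform_time_reverse:
  assumes "uniform_time \<tau>"
  shows "uniform_time (\<lambda>\<omega>. sigma \<omega> - \<tau> \<omega>)"
proof -
  obtain \<tau>' where \<tau>': "\<tau>' \<in> borel_measurable M" "AE \<omega> in M. \<omega> \<in> E \<longrightarrow> \<tau>' \<omega> = \<tau> \<omega>"
    "\<And>g C. continuous_on UNIV (\<lambda>(a, b). g a b) \<Longrightarrow> (\<And>a b. \<bar>g a b\<bar> \<le> C) \<Longrightarrow>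
      (\<integral>\<omega>. indicator E \<omega> * g (sigma \<omega>) (\<tau>' \<omega>) \<partial>M) = (\<integral>\<omega>. indicator E \<omega> * uniform_avg g (sigma \<omega>) \<partial>M)"
    using assms by (rule uniform_timeE) blast
  show ?thesis
    unfolding uniform_time_def
  proof (intro bexI[of _ "\<lambda>\<omega>. sigma \<omega> - \<tau>' \<omega>"] conjI allI impI)
    show "(\<lambda>\<omega>. sigma \<omega> - \<tau>' \<omega>) \<in> borel_measurable M" using \<tau>'(1) by measurable
    show "AE \<omega> in M. \<omega> \<in> E \<longrightarrow> sigma \<omega> - \<tau>' \<omega> = sigma \<omega> - \<tau> \<omega>" using \<tau>'(2) by eventually_elim auto
    fix g :: "real \<Rightarrow> real \<Rightarrow> real" and C
    assume g: "continuous_on UNIV (\<lambda>(a, b). g a b)" "\<forall>a b. \<bar>g a b\<bar> \<le> C"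
    have gs: "g a \<in> borel_measurable borel" for a
    proof -
      have "continuous_on UNIV ((\<lambda>(a, b). g a b) \<circ> Pair a)"
        by (intro continuous_on_compose continuous_intros continuous_on_subset[OF g(1)]) auto
      then show ?thesis by (intro borel_measurable_continuous_onI) (simp add: comp_def)
    qed
    have "continuous_on UNIV ((\<lambda>(a, b). g a b) \<circ> (\<lambda>z. (fst z, fst z - snd z)))"
      by (intro continuous_on_compose continuous_intros continuous_on_subset[OF g(1)]) auto
    then have "continuous_on UNIV (\<lambda>(a, b). g a (a - b))" by (simp add: comp_def split_beta')
    then have "(\<integral>\<omega>. indicator E \<omega> * g (sigma \<omega>) (sigma \<omega> - \<tau>' \<omega>) \<partial>M) = (\<integral>\<omega>. indicator E \<omega> * uniform_avg (\<lambda>a b. g a (a - b)) (sigma \<omega>) \<partial>M)"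
      using \<tau>'(3)[of "\<lambda>a b. g a (a - b)" C] g(2) by simp
    then show "(\<integral>\<omega>. indicator E \<omega> * g (sigma \<omega>) (sigma \<omega> - \<tau>' \<omega>) \<partial>M) = (\<integral>\<omega>. indicator E \<omega> * uniform_avg g (sigma \<omega>) \<partial>M)"
      by (simp only: uniform_avg_reverse gs)
  qed
qed

lemma path_measurable: "\<omega> \<in> space M \<Longrightarrow> (\<lambda>t. X t \<omega>) \<in> borel_measurable borel"
  by (rule X_compose_measurable) auto

lemma AE_level_bridge:
  "AE \<omega> in M. \<omega> \<in> E \<longrightarrow> (\<forall>c. emeasure lborel {t \<in> {0..<sigma \<omega>}. X t \<omega> = c} = 0 \<and>
     (AE t in lborel. 0 < t \<longrightarrow> t < sigma \<omega> \<longrightarrow> X t \<omega> \<noteq> c))"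
  using AE_level_null AE_space
proof (eventually_elim, intro impI allI)
  fix \<omega> c assume lev: "\<forall>c. emeasure lborel {s\<in>{0..T}. X s \<omega> = c} = 0" and \<omega>: "\<omega> \<in> space M"
  note [measurable] = path_measurable[OF \<omega>]
  have sub: "{t \<in> {0..<sigma \<omega>}. X t \<omega> = c} \<subseteq> {s\<in>{0..T}. X s \<omega> = c}" using sigma_bounds[OF \<omega>] by auto
  have S: "{s \<in> {0..b}. X s \<omega> = c} \<in> sets lborel" "{s \<in> {0..<b}. X s \<omega> = c} \<in> sets lborel" for b by measurable
  then have null: "{s\<in>{0..T}. X s \<omega> = c} \<in> null_sets lborel" using lev by (auto simp: null_sets_def)
  have "{t \<in> {0..<sigma \<omega>}. X t \<omega> = c} \<in> null_sets lborel" by (rule null_sets_subset[OF null S(2) sub])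
  moreover have "AE t in lborel. t \<notin> {s\<in>{0..T}. X s \<omega> = c}" using null by (rule AE_not_in)
  then have "AE t in lborel. 0 < t \<longrightarrow> t < sigma \<omega> \<longrightarrow> X t \<omega> \<noteq> c"
    by eventually_elim (use sigma_bounds[OF \<omega>] in auto)
  ultimately show "emeasure lborel {t \<in> {0..<sigma \<omega>}. X t \<omega> = c} = 0 \<and>
     (AE t in lborel. 0 < t \<longrightarrow> t < sigma \<omega> \<longrightarrow> X t \<omega> \<noteq> c)"
    by (simp add: null_sets_def)
qed

lemma uniform_time_occupation: "uniform_time (\<lambda>\<omega>. measure lborel {t \<in> {0..<sigma \<omega>}. X t \<omega> \<le> 0})"
proof (rule cyclic_limit[where \<Phi> = count_nonpos, OF count_nonpos_measurable count_nonpos_local])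
  show "AE \<omega> in M. \<omega> \<in> E \<longrightarrow> 0 < sigma \<omega> \<longrightarrow>
    bridge_path.uniformizes (\<lambda>t. X t \<omega>) T (sigma \<omega>) count_nonpos (measure lborel {t \<in> {0..<sigma \<omega>}. X t \<omega> \<le> 0})"
    using AE_bridge AE_level_bridge AE_space
    by eventually_elim (intro impI bridge_path.uniformizes_count path_measurable; blast)
qed (simp_all add: count_nonpos_def)

text \<open>The integrand is 1 where \<open>a = b \<ge> d\<close>. For a uniform second argument it is supported on a strip of width \<open>e\<close>;
  the second factor compensates for short intervals.\<close>

lemma uniform_avg_ramp:
  assumes "0 \<le> s" "0 < d" "0 < e"
  shows "uniform_avg (\<lambda>a b. max 0 (1 - \<bar>a - b\<bar> / e) * min 1 (\<bar>a\<bar> / d)) s \<le> e / d"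
proof (cases "s = 0")
  case True
  then show ?thesis using assms by (simp add: uniform_avg_def)
next
  case False
  then have s: "s > 0" using assms by simp
  let ?g = "\<lambda>u. max 0 (1 - \<bar>s - u\<bar> / e) * min 1 (\<bar>s\<bar> / d)"
  have g0: "0 \<le> ?g u" for u using assms by (intro mult_nonneg_nonneg) auto
  have g1: "?g u \<le> 1 * 1" for u using assms by (intro mult_mono) auto
  have "(\<integral>u. indicator {0..<s} u * ?g u \<partial>lborel) \<le> (\<integral>u. (s / d) * indicator {s - e..s} u \<partial>lborel)"
  proof (rule integral_mono)
    show "integrable lborel (\<lambda>u. indicator {0..<s} u * ?g u)"
    proof (rule Bochner_Integration.integrable_bound[of _ "\<lambda>u. indicator {0..s} u :: real"])
      show "AE u in lborel. norm (indicator {0..<s} u * ?g u) \<le> norm (indicator {0..s} u :: real)"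
      proof (rule AE_I2)
        fix u :: real
        show "norm (indicator {0..<s} u * ?g u) \<le> norm (indicator {0..s} u :: real)"
          using g0[of u] g1[of u] by (cases "u \<in> {0..<s}") (simp_all only: indicator_simps norm_mult real_norm_def abs_of_nonneg, auto)
      qed
    qed (auto simp: integrable_real_indicator emeasure_lborel_Icc_eq)
    show "integrable lborel (\<lambda>u. (s / d) * indicator {s - e..s} u)"
      by (intro integrable_mult_right integrable_real_indicator) (auto simp: emeasure_lborel_Icc_eq)
    fix u :: real
    show "indicator {0..<s} u * ?g u \<le> (s / d) * indicator {s - e..s} u"
    proof (cases "u \<in> {0..<s} \<and> s - e \<le> u")
      case True
      have "?g u \<le> 1 * (s / d)" using True assms s by (intro mult_mono) auto
      then show ?thesis using True by simp
    next
      case False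
      then have "indicator {0..<s} u * ?g u = 0" using assms by (auto simp: indicator_def max_def divide_less_eq)
      moreover have "0 \<le> (s / d) * indicator {s - e..s} u" using assms by (intro mult_nonneg_nonneg) auto
      ultimately show ?thesis by linarith
    qed
  qed
  also have "\<dots> = (s / d) * e" using assms by simp
  finally show ?thesis using s assms by (simp add: uniform_avg_def divide_le_eq mult.commute)
qed

text \<open>A loop that is nowhere positive spends all of its time below 0, but a uniform time almost surely differs from
  the length of the interval.\<close>

lemma AE_positive_somewhere: "AE \<omega> in M. \<omega> \<in> E \<longrightarrow> 0 < sigma \<omega> \<longrightarrow> (\<exists>t\<in>{0..sigma \<omega>}. X t \<omega> > 0)"
proof -
  obtain \<tau>' where \<tau>' [measurable]: "\<tau>' \<in> borel_measurable M" and eq: "AE \<omega> in M. \<omega> \<in> E \<longrightarrow> \<tau>' \<omega> = measure lborel {t \<in> {0..<sigma \<omega>}. X t \<omega> \<le> 0}"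
    and unif: "\<And>g C. continuous_on UNIV (\<lambda>(a, b). g a b) \<Longrightarrow> (\<And>a b. \<bar>g a b\<bar> \<le> C) \<Longrightarrow>
      (\<integral>\<omega>. indicator E \<omega> * g (sigma \<omega>) (\<tau>' \<omega>) \<partial>M) = (\<integral>\<omega>. indicator E \<omega> * uniform_avg g (sigma \<omega>) \<partial>M)"
    using uniform_time_occupation by (rule uniform_timeE) blast
  let ?F = "\<lambda>d. {\<omega> \<in> space M. \<omega> \<in> E \<and> d \<le> sigma \<omega> \<and> \<tau>' \<omega> = sigma \<omega>}"
  have F: "?F d \<in> sets M" for d by measurable
  have "prob (?F d) \<le> 0" if d: "d > 0" for d
  proof (rule field_le_epsilon)
    fix r :: real assume "r > 0"
    define e where "e = r * d"
    have e: "e > 0" using \<open>r > 0\<close> d by (simp add: e_def)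
    define g where "g = (\<lambda>a b :: real. max 0 (1 - \<bar>a - b\<bar> / e) * min 1 (\<bar>a\<bar> / d))"
    have g0: "0 \<le> g a b" for a b unfolding g_def using d e by (intro mult_nonneg_nonneg) auto
    have "g a b \<le> 1 * 1" for a b unfolding g_def using d e by (intro mult_mono) auto
    then have g1: "g a b \<le> 1" for a b by simp
    have cont: "continuous_on UNIV (\<lambda>(a, b). g a b)"
      unfolding g_def using d e by (auto simp: split_beta' intro!: continuous_intros)
    have gm: "(\<lambda>\<omega>. g (sigma \<omega>) (\<tau>' \<omega>)) \<in> borel_measurable M" unfolding g_def by measurable
    have am: "(\<lambda>\<omega>. uniform_avg g (sigma \<omega>)) \<in> borel_measurable M"
      by (rule measurable_compose[OF sigma_measurable uniform_avg_measurable[OF cont]])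
    have "prob (?F d) = (\<integral>\<omega>. indicator (?F d) \<omega> \<partial>M)" using F[of d] sets.sets_into_space[OF F] by (simp add: Int_absorb1)
    also have "\<dots> \<le> (\<integral>\<omega>. indicator E \<omega> * g (sigma \<omega>) (\<tau>' \<omega>) \<partial>M)"
    proof (rule integral_mono)
      show "integrable M (indicator (?F d) :: 'a \<Rightarrow> real)" using F[of d] by (intro integrable_real_indicator) (auto simp: emeasure_eq_measure)
      show "integrable M (\<lambda>\<omega>. indicator E \<omega> * g (sigma \<omega>) (\<tau>' \<omega>))"
        using gm g0 g1 by (intro integrable_const_bound[of _ 1]) (auto simp: indicator_def)
      show "indicator (?F d) \<omega> \<le> indicator E \<omega> * g (sigma \<omega>) (\<tau>' \<omega>)" for \<omega>
        using d g0 by (auto simp: indicator_def g_def min_def)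
    qed
    also have "\<dots> = (\<integral>\<omega>. indicator E \<omega> * uniform_avg g (sigma \<omega>) \<partial>M)"
      using unif[OF cont, of 1] g0 g1 by (simp add: abs_of_nonneg)
    also have "\<dots> \<le> (\<integral>\<omega>. e / d \<partial>M)"
    proof (rule integral_mono_AE')
      show "AE \<omega> in M. indicator E \<omega> * uniform_avg g (sigma \<omega>) \<le> e / d"
        using AE_space by eventually_elim (use uniform_avg_ramp[OF sigma_bounds(1) d e, folded g_def] d e in \<open>auto simp: indicator_def\<close>)
    qed (use d e in auto)
    also have "\<dots> = r" using d by (simp add: e_def prob_space)
    finally show "prob (?F d) \<le> 0 + r" by simp
  qed
  then have "?F (1 / real (Suc n)) \<in> null_sets M" for n
    using F by (auto simp: null_sets_def emeasure_eq_measure measure_le_0_iff)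
  then have "AE \<omega> in M. \<forall>n. \<omega> \<notin> ?F (1 / real (Suc n))"
    by (subst AE_all_countable) (intro allI AE_not_in)
  then show ?thesis
    using eq AE_space
  proof (eventually_elim, intro impI)
    fix \<omega> assume a: "\<forall>n. \<omega> \<notin> ?F (1 / real (Suc n))" "\<omega> \<in> E \<longrightarrow> \<tau>' \<omega> = measure lborel {t \<in> {0..<sigma \<omega>}. X t \<omega> \<le> 0}"
      "\<omega> \<in> space M" "\<omega> \<in> E" "0 < sigma \<omega>"
    obtain n where "inverse (real (Suc n)) < sigma \<omega>" using reals_Archimedean[OF a(5)] by blast
    then have ne: "\<tau>' \<omega> \<noteq> sigma \<omega>" using a(1,3,4) by (auto simp: inverse_eq_divide simp del: of_nat_Suc dest!: spec[of _ n])
    show "\<exists>t\<in>{0..sigma \<omega>}. X t \<omega> > 0"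
    proof (rule ccontr)
      assume "\<not> ?thesis"
      then have "{t \<in> {0..<sigma \<omega>}. X t \<omega> \<le> 0} = {0..<sigma \<omega>}" by (auto simp: not_less)
      then show False using ne a by simp
    qed
  qed
qed

lemma AE_well_posed:
  assumes c: "c = 1 \<or> c = -1"
  shows "AE \<omega> in M. \<omega> \<in> E \<longrightarrow> 0 < sigma \<omega> \<longrightarrow> Inf ((\<lambda>t. c * X t \<omega>) ` {0..sigma \<omega>}) < 0 \<and>
    (\<exists>m. 0 < m \<and> m < sigma \<omega> \<and> well_posed (\<lambda>t. c * X t \<omega>) (sigma \<omega>) m)"
proof -
  obtain B where B: "countable B" "dense_times B" "AE \<omega> in M. no_ties B (\<lambda>t. X t \<omega>) \<and> no_ties B (\<lambda>t. - X t \<omega>)"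
    by (rule no_ties_exists)
  show ?thesis
    using B(3) AE_bridge AE_positive_somewhere AE_space
  proof (eventually_elim, intro impI)
    fix \<omega> assume a: "no_ties B (\<lambda>t. X t \<omega>) \<and> no_ties B (\<lambda>t. - X t \<omega>)" "\<omega> \<in> E \<longrightarrow> bridge_path (\<lambda>t. X t \<omega>) T (sigma \<omega>)"
      "\<omega> \<in> E \<longrightarrow> 0 < sigma \<omega> \<longrightarrow> (\<exists>t\<in>{0..sigma \<omega>}. X t \<omega> > 0)" "\<omega> \<in> space M" "\<omega> \<in> E" "0 < sigma \<omega>"
    interpret bridge_path "\<lambda>t. X t \<omega>" T "sigma \<omega>" using a by blast
    interpret record_path "\<lambda>t. c * X t \<omega>" using c a(4) by (rule signed_record_path)
    have nt: "no_ties B (\<lambda>t. c * X t \<omega>)" using a(1) c by auto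
    have "\<exists>t\<in>{0..sigma \<omega>}. c * X t \<omega> < 0"
    proof (cases "c = 1")
      case True
      obtain t where "sigma \<omega> - 1 < t" "t < sigma \<omega>" "0 \<le> t" "X t \<omega> < 0" using neg[OF a(6), of 1] by auto
      then show ?thesis using True by (intro bexI[of _ t]) auto
    next
      case False
      then show ?thesis using a c by auto
    qed
    then obtain t where t: "t \<in> {0..sigma \<omega>}" "c * X t \<omega> < 0" by blast
    then have I: "Inf ((\<lambda>t. c * X t \<omega>) ` {0..sigma \<omega>}) < 0" using Inf_le[OF t(1)] by simp
    have "((\<lambda>t. c * X t \<omega>) \<longlongrightarrow> c * 0) (at_left (sigma \<omega>))" by (intro tendsto_intros left a)
    then have l: "((\<lambda>t. c * X t \<omega>) \<longlongrightarrow> 0) (at_left (sigma \<omega>))" by simp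
    have "c * X (sigma \<omega>) \<omega> = 0" using last(3) by simp
    from well_posed_bridge[OF B(2) nt a(6) this l I] obtain m where "0 < m" "m < sigma \<omega>" "well_posed (\<lambda>t. c * X t \<omega>) (sigma \<omega>) m" .
    then show "Inf ((\<lambda>t. c * X t \<omega>) ` {0..sigma \<omega>}) < 0 \<and>
      (\<exists>m. 0 < m \<and> m < sigma \<omega> \<and> well_posed (\<lambda>t. c * X t \<omega>) (sigma \<omega>) m)" using I by blast
  qed
qed

lemma uniform_time_F_right:
  assumes c: "c = 1 \<or> c = -1"
  shows "uniform_time (\<lambda>\<omega>. F_right (\<lambda>t. c * X t \<omega>) (sigma \<omega>))"
proof (rule cyclic_limit[where \<Phi> = "first_argmin c", OF first_argmin_measurable first_argmin_local])
  show "AE \<omega> in M. \<omega> \<in> E \<longrightarrow> 0 < sigma \<omega> \<longrightarrow>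
    bridge_path.uniformizes (\<lambda>t. X t \<omega>) T (sigma \<omega>) (first_argmin c) (F_right (\<lambda>t. c * X t \<omega>) (sigma \<omega>))"
    using AE_bridge AE_well_posed[OF c] AE_space
  proof (eventually_elim, intro impI)
    fix \<omega> assume a: "\<omega> \<in> E \<longrightarrow> bridge_path (\<lambda>t. X t \<omega>) T (sigma \<omega>)"
      "\<omega> \<in> E \<longrightarrow> 0 < sigma \<omega> \<longrightarrow> Inf ((\<lambda>t. c * X t \<omega>) ` {0..sigma \<omega>}) < 0 \<and>
        (\<exists>m. 0 < m \<and> m < sigma \<omega> \<and> well_posed (\<lambda>t. c * X t \<omega>) (sigma \<omega>) m)" "\<omega> \<in> space M" "\<omega> \<in> E" "0 < sigma \<omega>"
    then obtain m where "0 < m" "m < sigma \<omega>" "well_posed (\<lambda>t. c * X t \<omega>) (sigma \<omega>) m" by blast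
    then show "bridge_path.uniformizes (\<lambda>t. X t \<omega>) T (sigma \<omega>) (first_argmin c) (F_right (\<lambda>t. c * X t \<omega>) (sigma \<omega>))"
      using a signed_record_path[OF c a(3)] by (intro bridge_path.uniformizes_first_argmin) auto
  qed
qed (simp_all add: first_argmin_def F_right_def)

end

section \<open>Conditional laws and the completion\<close>

lemma sets_completion_cong_AE:
  assumes S: "S \<in> sets (completion M)" and AE: "AE \<omega> in M. \<omega> \<in> S \<longleftrightarrow> P \<omega>"
  shows "{\<omega> \<in> space M. P \<omega>} \<in> sets (completion M)"
proof -
  from AE obtain N where N: "{\<omega> \<in> space M. \<not> (\<omega> \<in> S \<longleftrightarrow> P \<omega>)} \<subseteq> N" "N \<in> null_sets M"
    by (auto elim!: AE_E simp: null_sets_def)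
  have Ssp: "S \<subseteq> space M" using sets.sets_into_space[OF S] by simp
  have "{\<omega> \<in> space M. P \<omega>} = (S - N) \<union> ({\<omega> \<in> space M. P \<omega>} \<inter> N)" using N(1) Ssp by auto
  moreover have "S - N \<in> sets (completion M)" using S N(2) by (intro sets.Diff) (auto simp: null_sets_def)
  moreover have "{\<omega> \<in> space M. P \<omega>} \<inter> N \<in> sets (completion M)"
    using N(2) by (intro null_sets_completion[of N]) auto
  ultimately show ?thesis by (metis sets.Un)
qed

lemma borel_measurable_completion_cong_AE:
  fixes f g :: "'a \<Rightarrow> real"
  assumes f: "f \<in> borel_measurable (completion M)" and AE: "AE \<omega> in M. f \<omega> = g \<omega>"
  shows "g \<in> borel_measurable (completion M)"
proof (rule borel_measurableI_greater)
  fix a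
  have "{\<omega> \<in> space (completion M). f \<omega> > a} \<in> sets (completion M)" using f by measurable
  then have S: "{\<omega> \<in> space M. f \<omega> > a} \<in> sets (completion M)" by simp
  have "AE \<omega> in M. \<omega> \<in> {\<omega> \<in> space M. f \<omega> > a} \<longleftrightarrow> g \<omega> > a" using AE AE_space by eventually_elim auto
  from sets_completion_cong_AE[OF S this]
  show "{\<omega> \<in> space (completion M). a < g \<omega>} \<in> sets (completion M)" by simp
qed

lemma cond_law_cong_AE:
  assumes A: "A \<in> sets M" "A' \<in> sets M" and Y: "Y \<in> borel_measurable (completion M)" and Y': "Y' \<in> borel_measurable M"
    and AE1: "AE \<omega> in M. \<omega> \<in> A \<longleftrightarrow> \<omega> \<in> A'" and AE2: "AE \<omega> in M. \<omega> \<in> A' \<longrightarrow> Y' \<omega> = Y \<omega>"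
  shows "cond_law M A Y = distr (uniform_measure M A') borel Y'"
proof (rule measure_eqI)
  show "sets (cond_law M A Y) = sets (distr (uniform_measure M A') borel Y')" by (simp add: cond_law_def)
  fix B assume "B \<in> sets (cond_law M A Y)"
  then have B: "B \<in> sets borel" by (simp add: cond_law_def)
  have m: "Y -` B \<inter> space M \<in> sets (completion M)" using measurable_sets[OF Y B] by simp
  have m': "Y' -` B \<inter> space M \<in> sets M" using measurable_sets[OF Y' B] .
  have "emeasure (cond_law M A Y) B = emeasure (completion M) (A \<inter> (Y -` B \<inter> space M)) / emeasure (completion M) A"
    unfolding cond_law_def using B Y m A by (subst emeasure_distr) (auto simp: emeasure_uniform_measure)
  also have "emeasure (completion M) A = emeasure M A" using A by simp
  also have "\<dots> = emeasure M A'" using AE1 A by (intro emeasure_eq_AE) auto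
  also have "emeasure (completion M) (A \<inter> (Y -` B \<inter> space M)) = emeasure (completion M) (A' \<inter> (Y' -` B \<inter> space M))"
  proof (rule emeasure_eq_AE)
    have "AE \<omega> in M. \<omega> \<in> A \<inter> (Y -` B \<inter> space M) \<longleftrightarrow> \<omega> \<in> A' \<inter> (Y' -` B \<inter> space M)"
      using AE1 AE2 by eventually_elim auto
    then show "AE \<omega> in completion M. \<omega> \<in> A \<inter> (Y -` B \<inter> space M) \<longleftrightarrow> \<omega> \<in> A' \<inter> (Y' -` B \<inter> space M)"
      by (rule AE_completion)
  qed (use A m m' in auto)
  also have "\<dots> = emeasure M (A' \<inter> (Y' -` B \<inter> space M))" using A m' by (intro emeasure_completion[THEN trans]) auto
  also have "emeasure M (A' \<inter> (Y' -` B \<inter> space M)) / emeasure M A' = emeasure (distr (uniform_measure M A') borel Y') B"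
    using B Y' m' A by (subst emeasure_distr) (auto simp: emeasure_uniform_measure)
  finally show "emeasure (cond_law M A Y) B = emeasure (distr (uniform_measure M A') borel Y') B" .
qed

context sn_levy_up
begin

lemma E_pos: "prob E > 0" using up by (simp add: E_def)

lemma uniform_time_law:
  assumes "uniform_time \<tau>1" "uniform_time \<tau>2"
  obtains \<tau>1' \<tau>2' where "\<tau>1' \<in> borel_measurable M" "AE \<omega> in M. \<omega> \<in> E \<longrightarrow> \<tau>1' \<omega> = \<tau>1 \<omega>"
    "\<tau>2' \<in> borel_measurable M" "AE \<omega> in M. \<omega> \<in> E \<longrightarrow> \<tau>2' \<omega> = \<tau>2 \<omega>"
    "distr (uniform_measure M E) borel \<tau>1' = distr (uniform_measure M E) borel \<tau>2'"
proof -
  obtain \<tau>1' where m1: "\<tau>1' \<in> borel_measurable M" and ae1: "AE \<omega> in M. \<omega> \<in> E \<longrightarrow> \<tau>1' \<omega> = \<tau>1 \<omega>"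
    and u1: "\<And>g C. continuous_on UNIV (\<lambda>(a, b). g a b) \<Longrightarrow> (\<And>a b. \<bar>g a b\<bar> \<le> C) \<Longrightarrow>
      (\<integral>\<omega>. indicator E \<omega> * g (sigma \<omega>) (\<tau>1' \<omega>) \<partial>M) = (\<integral>\<omega>. indicator E \<omega> * uniform_avg g (sigma \<omega>) \<partial>M)"
    using assms(1) by (rule uniform_timeE) blast
  obtain \<tau>2' where m2: "\<tau>2' \<in> borel_measurable M" and ae2: "AE \<omega> in M. \<omega> \<in> E \<longrightarrow> \<tau>2' \<omega> = \<tau>2 \<omega>"
    and u2: "\<And>g C. continuous_on UNIV (\<lambda>(a, b). g a b) \<Longrightarrow> (\<And>a b. \<bar>g a b\<bar> \<le> C) \<Longrightarrow>
      (\<integral>\<omega>. indicator E \<omega> * g (sigma \<omega>) (\<tau>2' \<omega>) \<partial>M) = (\<integral>\<omega>. indicator E \<omega> * uniform_avg g (sigma \<omega>) \<partial>M)"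
    using assms(2) by (rule uniform_timeE) blast
  let ?P = "uniform_measure M E"
  have em: "emeasure M E \<noteq> 0" "emeasure M E \<noteq> \<infinity>" using E_pos by (auto simp: emeasure_eq_measure)
  interpret P: prob_space ?P by (rule prob_space_uniform_measure) (use em in auto)
  note [measurable] = m1 m2
  have same: "(\<integral>\<omega>. f (\<tau>1' \<omega>) \<partial>?P) = (\<integral>\<omega>. f (\<tau>2' \<omega>) \<partial>?P)"
    if cont: "continuous_on UNIV f" and b: "\<And>x. \<bar>f x\<bar> \<le> 1" for f :: "real \<Rightarrow> real"
  proof -
    have [measurable]: "f \<in> borel_measurable borel" using cont by (rule borel_measurable_continuous_onI)
    have "continuous_on UNIV (f \<circ> snd)" by (intro continuous_on_compose continuous_intros continuous_on_subset[OF cont]) auto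
    then have c2: "continuous_on UNIV (\<lambda>(a :: real, b). f b)" by (simp add: comp_def split_beta')
    have "(\<integral>\<omega>. indicator E \<omega> * f (\<tau>1' \<omega>) \<partial>M) = (\<integral>\<omega>. indicator E \<omega> * f (\<tau>2' \<omega>) \<partial>M)"
      using u1[OF c2, of 1] u2[OF c2, of 1] b by simp
    then show ?thesis using em by (simp add: integral_uniform_measure)
  qed
  have char_eq: "char (distr ?P borel Y) t = Complex (\<integral>\<omega>. cos (t * Y \<omega>) \<partial>?P) (\<integral>\<omega>. sin (t * Y \<omega>) \<partial>?P)"
    if [measurable]: "Y \<in> borel_measurable M" for Y t
  proof -
    have int: "integrable ?P (\<lambda>\<omega>. iexp (t * Y \<omega>))"
      by (intro P.integrable_const_bound[of _ 1]) auto
    have "char (distr ?P borel Y) t = (CLINT \<omega>|?P. iexp (t * Y \<omega>))" by (simp add: char_def integral_distr)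
    moreover have "Re (CLINT \<omega>|?P. iexp (t * Y \<omega>)) = (\<integral>\<omega>. cos (t * Y \<omega>) \<partial>?P)"
      by (subst integral_Re[OF int, symmetric]) (simp add: Re_exp)
    moreover have "Im (CLINT \<omega>|?P. iexp (t * Y \<omega>)) = (\<integral>\<omega>. sin (t * Y \<omega>) \<partial>?P)"
      by (subst integral_Im[OF int, symmetric]) (simp add: Im_exp)
    ultimately show ?thesis by (simp add: complex_eq_iff)
  qed
  have "distr ?P borel \<tau>1' = distr ?P borel \<tau>2'"
  proof (rule Levy_uniqueness)
    show "real_distribution (distr ?P borel \<tau>1')" "real_distribution (distr ?P borel \<tau>2')"
      by (rule P.real_distribution_distr, measurable)+
    show "char (distr ?P borel \<tau>1') = char (distr ?P borel \<tau>2')"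
    proof
      fix t
      have "(\<integral>\<omega>. cos (t * \<tau>1' \<omega>) \<partial>?P) = (\<integral>\<omega>. cos (t * \<tau>2' \<omega>) \<partial>?P)"
        "(\<integral>\<omega>. sin (t * \<tau>1' \<omega>) \<partial>?P) = (\<integral>\<omega>. sin (t * \<tau>2' \<omega>) \<partial>?P)"
        by (rule same[of "\<lambda>y. cos (t * y)"], auto intro!: continuous_intros)
           (rule same[of "\<lambda>y. sin (t * y)"], auto intro!: continuous_intros)
      then show "char (distr ?P borel \<tau>1') t = char (distr ?P borel \<tau>2') t" by (simp add: char_eq m1 m2)
    qed
  qed
  from that[OF m1 ae1 m2 ae2 this] show ?thesis .
qed

text \<open>Outside a null set, exceeding \<open>y\<close> is the countable union of events provided by \<open>F_right_gt_iff\<close>.\<close>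

lemma F_right_measurable:
  assumes c: "c = 1 \<or> c = -1"
  shows "(\<lambda>\<omega>. F_right (\<lambda>t. c * X t \<omega>) (sigma \<omega>)) \<in> borel_measurable (completion M)"
proof (rule borel_measurableI_greater)
  fix y :: real
  obtain B where B: "countable B" "dense_times B" "AE \<omega> in M. no_ties B (\<lambda>t. X t \<omega>) \<and> no_ties B (\<lambda>t. - X t \<omega>)"
    by (rule no_ties_exists)
  show "{\<omega> \<in> space (completion M). y < F_right (\<lambda>t. c * X t \<omega>) (sigma \<omega>)} \<in> sets (completion M)"
  proof (cases "y < 0")
    case True
    have "F_right (\<lambda>t. c * X t \<omega>) (sigma \<omega>) \<ge> 0" if "\<omega> \<in> space M" for \<omega>
      using record_path.F_right_bounds[OF signed_record_path[OF c that] sigma_bounds(1)[OF that]] by simp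
    then have "{\<omega> \<in> space (completion M). y < F_right (\<lambda>t. c * X t \<omega>) (sigma \<omega>)} = space (completion M)" using True by force
    then show ?thesis by (simp only: sets.top)
  next
    case False
    let ?S = "{\<omega> \<in> space M. \<exists>a\<in>\<rat>. \<exists>b\<in>B. y < a \<and> a \<le> b \<and> b < sigma \<omega> \<and>
      Inf ((\<lambda>t. c * X t \<omega>) ` {a..b}) < Inf ((\<lambda>t. c * X t \<omega>) ` {0..a})}"
    note [measurable] = Inf_measurable[OF c]
    have "?S = (\<Union>a\<in>\<rat>. \<Union>b\<in>B. {\<omega> \<in> space M. y < a \<and> a \<le> b \<and> b < sigma \<omega> \<and>
      Inf ((\<lambda>t. c * X t \<omega>) ` {a..b}) < Inf ((\<lambda>t. c * X t \<omega>) ` {0..a})})" by auto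
    also have "\<dots> \<in> sets M"
    proof (rule sets.countable_UN''[OF countable_rat], rule sets.countable_UN''[OF B(1)])
      fix a b
      show "{\<omega> \<in> space M. y < a \<and> a \<le> b \<and> b < sigma \<omega> \<and>
        Inf ((\<lambda>t. c * X t \<omega>) ` {a..b}) < Inf ((\<lambda>t. c * X t \<omega>) ` {0..a})} \<in> sets M" by measurable
    qed
    finally have "?S \<in> sets M" .
    then have S: "?S \<in> sets (completion M)" by (rule sets_completionI_sets)
    have "AE \<omega> in M. \<omega> \<in> ?S \<longleftrightarrow> y < F_right (\<lambda>t. c * X t \<omega>) (sigma \<omega>)"
      using B(3) AE_space
    proof eventually_elim
      case (elim \<omega>)
      interpret record_path "\<lambda>t. c * X t \<omega>" using c elim(2) by (rule signed_record_path)
      have "no_ties B (\<lambda>t. c * X t \<omega>)" using elim(1) c by auto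
      from F_right_gt_iff[OF B(2) this _ sigma_bounds(1)[OF elim(2)], of y] False elim(2) show ?case by simp
    qed
    from sets_completion_cong_AE[OF S this] show ?thesis by simp
  qed
qed

lemma occupation_measurable:
  assumes [measurable]: "A \<in> sets borel"
  shows "(\<lambda>\<omega>. LINT u:{0..sigma \<omega>}|lborel. (indicator {v. X v \<omega> \<in> A} u :: real)) \<in> borel_measurable M"
proof -
  have "(\<lambda>\<omega>. \<integral>u. (if 0 \<le> u \<and> u \<le> sigma \<omega> then 1 else (0::real)) * indicator A (X u \<omega>) \<partial>lborel) \<in> borel_measurable M"
    by measurable
  moreover have "(if 0 \<le> u \<and> u \<le> sigma \<omega> then 1 else 0) * indicator A (X u \<omega>) = (indicator {0..sigma \<omega>} u *\<^sub>R indicator {v. X v \<omega> \<in> A} u :: real)" for u \<omega>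
    by (auto simp: indicator_def)
  ultimately show ?thesis by (simp add: set_lebesgue_integral_def)
qed

lemma N_minus_measurable: "(\<lambda>\<omega>. N_minus (\<lambda>t. X t \<omega>) (sigma \<omega>)) \<in> borel_measurable M"
  and N_plus_measurable: "(\<lambda>\<omega>. N_plus (\<lambda>t. X t \<omega>) (sigma \<omega>)) \<in> borel_measurable M"
  using occupation_measurable[of "{..0}"] occupation_measurable[of "{0..}"] by (simp_all add: N_minus_def N_plus_def)

lemma uniform_time_N_minus: "uniform_time (\<lambda>\<omega>. N_minus (\<lambda>t. X t \<omega>) (sigma \<omega>))"
proof (rule uniform_time_cong[OF _ uniform_time_occupation])
  show "AE \<omega> in M. \<omega> \<in> E \<longrightarrow> measure lborel {t \<in> {0..<sigma \<omega>}. X t \<omega> \<le> 0} = N_minus (\<lambda>t. X t \<omega>) (sigma \<omega>)"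
    using AE_space by eventually_elim (simp add: N_minus_eq_occupation path_measurable)
qed

lemma uniform_time_N_plus: "uniform_time (\<lambda>\<omega>. N_plus (\<lambda>t. X t \<omega>) (sigma \<omega>))"
proof (rule uniform_time_cong[OF _ uniform_time_reverse[OF uniform_time_N_minus]])
  show "AE \<omega> in M. \<omega> \<in> E \<longrightarrow> sigma \<omega> - N_minus (\<lambda>t. X t \<omega>) (sigma \<omega>) = N_plus (\<lambda>t. X t \<omega>) (sigma \<omega>)"
    using AE_level_bridge AE_space
  proof (eventually_elim, intro impI)
    fix \<omega> assume a: "\<omega> \<in> E \<longrightarrow> (\<forall>c. emeasure lborel {t \<in> {0..<sigma \<omega>}. X t \<omega> = c} = 0 \<and>
     (AE t in lborel. 0 < t \<longrightarrow> t < sigma \<omega> \<longrightarrow> X t \<omega> \<noteq> c))" "\<omega> \<in> space M" "\<omega> \<in> E"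
    note [measurable] = path_measurable[OF a(2)]
    let ?s = "sigma \<omega>"
    have s: "0 \<le> ?s" using sigma_bounds[OF a(2)] by simp
    have i: "integrable lborel (\<lambda>t. indicator {0..?s} t * indicator {v. P v} t :: real)" if [measurable]: "{v. P v} \<in> sets borel" for P
    proof (rule Bochner_Integration.integrable_bound[of _ "\<lambda>t. indicator {0..?s} t :: real"])
      show "integrable lborel (\<lambda>t. indicator {0..?s} t :: real)"
        by (intro integrable_real_indicator) (auto simp: emeasure_lborel_Icc_eq)
      show "(\<lambda>t. indicator {0..?s} t * indicator {v. P v} t :: real) \<in> borel_measurable lborel"
        using that by (intro borel_measurable_times borel_measurable_indicator) auto
    qed (auto simp: indicator_def)
    have m: "{v. X v \<omega> \<le> 0} \<in> sets borel" "{v. 0 \<le> X v \<omega>} \<in> sets borel"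
    proof -
      have "{v \<in> space borel. X v \<omega> \<le> 0} \<in> sets borel" "{v \<in> space borel. 0 \<le> X v \<omega>} \<in> sets borel" by measurable
      then show "{v. X v \<omega> \<le> 0} \<in> sets borel" "{v. 0 \<le> X v \<omega>} \<in> sets borel" by simp_all
    qed
    have "N_minus (\<lambda>t. X t \<omega>) ?s + N_plus (\<lambda>t. X t \<omega>) ?s
      = (\<integral>t. indicator {0..?s} t * indicator {v. X v \<omega> \<le> 0} t + indicator {0..?s} t * indicator {v. 0 \<le> X v \<omega>} t \<partial>lborel)"
      using i[OF m(1)] i[OF m(2)] by (simp add: N_minus_def N_plus_def set_lebesgue_integral_def)
    also have "\<dots> = (\<integral>t. indicator {0..?s} t \<partial>lborel)"
    proof (rule integral_cong_AE)
      have "AE t in lborel. 0 < t \<longrightarrow> t < ?s \<longrightarrow> X t \<omega> \<noteq> 0" using a by blast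
      then show "AE t in lborel. indicator {0..?s} t * indicator {v. X v \<omega> \<le> 0} t + indicator {0..?s} t * indicator {v. 0 \<le> X v \<omega>} t = (indicator {0..?s} t :: real)"
        using AE_lborel_singleton[of "0::real"] AE_lborel_singleton[of ?s]
        by eventually_elim (auto simp: indicator_def)
    qed (use m in \<open>auto intro!: borel_measurable_add borel_measurable_times borel_measurable_indicator\<close>)
    also have "\<dots> = ?s" using s by simp
    finally show "?s - N_minus (\<lambda>t. X t \<omega>) ?s = N_plus (\<lambda>t. X t \<omega>) ?s" by simp
  qed
qed

lemma all_uniform_times:
  assumes "\<tau> \<in> {F_right, F_left, G_right, G_left, N_minus, N_plus}"
  shows "uniform_time (\<lambda>\<omega>. \<tau> (\<lambda>t. X t \<omega>) (sigma \<omega>))"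
    and "(\<lambda>\<omega>. \<tau> (\<lambda>t. X t \<omega>) (sigma \<omega>)) \<in> borel_measurable (completion M)"
proof -
  note F = uniform_time_F_right[of 1, simplified] and G = uniform_time_F_right[of "-1", simplified, folded G_right_eq_F_right]
  note Fm = F_right_measurable[of 1, simplified] and Gm = F_right_measurable[of "-1", simplified, folded G_right_eq_F_right]
  note sm = measurable_completion[OF sigma_measurable]
  show "uniform_time (\<lambda>\<omega>. \<tau> (\<lambda>t. X t \<omega>) (sigma \<omega>))"
    using assms F G uniform_time_reverse[OF F] uniform_time_reverse[OF G] uniform_time_N_minus uniform_time_N_plus
    by (auto simp: F_left_def[abs_def] G_left_def[abs_def])
  show "(\<lambda>\<omega>. \<tau> (\<lambda>t. X t \<omega>) (sigma \<omega>)) \<in> borel_measurable (completion M)"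
    using assms Fm Gm borel_measurable_diff[OF sm Fm] borel_measurable_diff[OF sm Gm]
      measurable_completion[OF N_minus_measurable] measurable_completion[OF N_plus_measurable]
    by (auto simp: F_left_def[abs_def] G_left_def[abs_def])
qed

end

section \<open>Reduction to regular paths\<close>

lemma levy_process_cong_AE:
  fixes M :: "'a measure"
  assumes "levy_process M X" and m: "\<And>t. Y t \<in> borel_measurable M"
    and AE: "AE \<omega> in M. \<forall>t\<ge>0. Y t \<omega> = X t \<omega>"
  shows "levy_process M Y"
proof -
  interpret levy_process M X by fact
  have incr: "distr M borel (\<lambda>\<omega>. Y b \<omega> - Y a \<omega>) = distr M borel (\<lambda>\<omega>. X b \<omega> - X a \<omega>)" if "0 \<le> a" "0 \<le> b" for a b
  proof (rule distr_cong_AE)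
    show "AE \<omega> in M. Y b \<omega> - Y a \<omega> = X b \<omega> - X a \<omega>" using AE by eventually_elim (use that in auto)
  qed (use m measurable_X that in auto)
  have one: "distr M borel (Y a) = distr M borel (X a)" if "0 \<le> a" for a
  proof (rule distr_cong_AE)
    show "AE \<omega> in M. Y a \<omega> = X a \<omega>" using AE by eventually_elim (use that in auto)
  qed (use m measurable_X that in auto)
  show ?thesis
  proof
    show "Y t \<in> borel_measurable M" for t by (rule m)
    show "AE \<omega> in M. Y 0 \<omega> = 0" using start_zero AE by eventually_elim auto
    show "AE \<omega> in M. cadlag (\<lambda>t. Y t \<omega>)" using cadlag_paths AE
    proof eventually_elim
      case (elim \<omega>)
      have eq: "X t \<omega> = Y t \<omega>" if "t \<ge> 0" for t using elim that by auto
      have r: "((\<lambda>t. Y t \<omega>) \<longlongrightarrow> L) (at_right t) \<longleftrightarrow> ((\<lambda>t. X t \<omega>) \<longlongrightarrow> L) (at_right t)" if "t \<ge> 0" for t L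
        using that by (intro filterlim_cong refl) (auto simp: eventually_at_right_field eq intro!: exI[of _ "t + 1"])
      have l: "((\<lambda>t. Y t \<omega>) \<longlongrightarrow> L) (at_left t) \<longleftrightarrow> ((\<lambda>t. X t \<omega>) \<longlongrightarrow> L) (at_left t)" if "t > 0" for t L
        using that by (intro filterlim_cong refl) (auto simp: eventually_at_left_field eq intro!: exI[of _ "0"])
      show ?case using elim(1) by (auto simp: cadlag_def continuous_within r l eq)
    qed
    show "indep_vars (\<lambda>_. borel) (\<lambda>i \<omega>. Y (t (Suc i)) \<omega> - Y (t i) \<omega>) {..<n}"
      if t: "0 \<le> t 0" "\<And>i. i < n \<Longrightarrow> t i < t (Suc i)" for n :: nat and t :: "nat \<Rightarrow> real"
    proof -
      have pos: "0 \<le> t i" if "i \<le> n" for i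
        using that by (induction i) (use t less_imp_le order_trans in \<open>auto simp: Suc_le_eq intro: order_trans[OF _ less_imp_le]\<close>)
      show ?thesis
      proof (cases "n = 0")
        case True
        then show ?thesis by (simp add: indep_vars_def indep_sets_def)
      next
        case False
        have X: "distr M (Pi\<^sub>M {..<n} (\<lambda>_. borel)) (\<lambda>\<omega>. \<lambda>i\<in>{..<n}. X (t (Suc i)) \<omega> - X (t i) \<omega>) =
          Pi\<^sub>M {..<n} (\<lambda>i. distr M borel (\<lambda>\<omega>. X (t (Suc i)) \<omega> - X (t i) \<omega>))"
        proof (rule indep_vars_iff_distr_eq_PiM'[THEN iffD1])
          show "indep_vars (\<lambda>_. borel) (\<lambda>i \<omega>. X (t (Suc i)) \<omega> - X (t i) \<omega>) {..<n}"
            by (rule indep_increments[OF t])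
        qed (use False pos measurable_X in \<open>auto simp: lessThan_empty_iff intro!: borel_measurable_diff\<close>)
        have "distr M (Pi\<^sub>M {..<n} (\<lambda>_. borel)) (\<lambda>\<omega>. \<lambda>i\<in>{..<n}. Y (t (Suc i)) \<omega> - Y (t i) \<omega>)
          = distr M (Pi\<^sub>M {..<n} (\<lambda>_. borel)) (\<lambda>\<omega>. \<lambda>i\<in>{..<n}. X (t (Suc i)) \<omega> - X (t i) \<omega>)"
        proof (rule distr_cong_AE)
          show "AE \<omega> in M. (\<lambda>i\<in>{..<n}. Y (t (Suc i)) \<omega> - Y (t i) \<omega>) = (\<lambda>i\<in>{..<n}. X (t (Suc i)) \<omega> - X (t i) \<omega>)"
            using AE by eventually_elim (use pos in \<open>auto simp: restrict_def\<close>)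
        qed (use m measurable_X pos in \<open>auto intro!: measurable_restrict borel_measurable_diff\<close>)
        also have "\<dots> = Pi\<^sub>M {..<n} (\<lambda>i. distr M borel (\<lambda>\<omega>. Y (t (Suc i)) \<omega> - Y (t i) \<omega>))"
          unfolding X using pos by (intro PiM_cong refl incr[symmetric]) auto
        finally show ?thesis using False m by (subst indep_vars_iff_distr_eq_PiM') auto
      qed
    qed
    show "distr M borel (\<lambda>\<omega>. Y (s + t) \<omega> - Y s \<omega>) = distr M borel (Y t)" if "s \<ge> 0" "t \<ge> 0" for s t
      using stationary_increments[OF that] that by (simp add: incr one)
  qed
qed

lemma path_functional_cong:
  assumes "\<tau> \<in> {F_right, F_left, G_right, G_left, N_minus, N_plus}" and eq: "\<And>t. 0 \<le> t \<Longrightarrow> x t = y t"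
  shows "\<tau> x s = \<tau> y s"
proof -
  have ri: "running_inf x t = running_inf y t" "running_sup x t = running_sup y t" if "0 \<le> t" for t
    unfolding running_inf_def running_sup_def using eq by (auto intro!: arg_cong[where f = Inf] arg_cong[where f = Sup] image_cong)
  have F: "F_right x s = F_right y s" "G_right x s = G_right y s"
    unfolding F_right_def G_right_def using eq ri by (auto intro!: arg_cong[where f = Sup])
  have N: "N_minus x s = N_minus y s" "N_plus x s = N_plus y s"
    unfolding N_minus_def N_plus_def set_lebesgue_integral_def using eq
    by (auto intro!: Bochner_Integration.integral_cong simp: indicator_def)
  show ?thesis using assms(1) F N by (auto simp: F_left_def G_left_def)
qed

theorem proposition1p2:
  fixes M :: "'a measure" and X :: "real \<Rightarrow> 'a \<Rightarrow> real" and T :: real and \<sigma> :: "'a \<Rightarrow> real"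
  assumes "T > 0"
    and "levy_process M X"
    and "no_positive_jumps M X"
    and "measure M {\<omega> \<in> space M. X T \<omega> > 0} > 0"
    and "\<And>\<omega>. \<omega> \<in> space M \<Longrightarrow> \<sigma> \<omega> = Sup {t \<in> {0..T}. X t \<omega> \<le> 0}"
  shows "(\<forall>\<tau> \<in> {F_right, F_left, G_right, G_left, N_minus, N_plus}.
           (\<lambda>\<omega>. \<tau> (\<lambda>t. X t \<omega>) (\<sigma> \<omega>)) \<in> borel_measurable (completion M)) \<and>
        (\<forall>\<tau> \<in> {F_right, F_left, G_right, G_left, N_minus, N_plus}.
         \<forall>\<tau>' \<in> {F_right, F_left, G_right, G_left, N_minus, N_plus}.
           cond_law M {\<omega> \<in> space M. X T \<omega> > 0} (\<lambda>\<omega>. \<tau> (\<lambda>t. X t \<omega>) (\<sigma> \<omega>)) =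
           cond_law M {\<omega> \<in> space M. X T \<omega> > 0} (\<lambda>\<omega>. \<tau>' (\<lambda>t. X t \<omega>) (\<sigma> \<omega>)))"
proof -
  interpret L: levy_process M X by fact
  let ?good = "\<lambda>\<omega>. X 0 \<omega> = 0 \<and> cadlag (\<lambda>t. X t \<omega>) \<and> (\<forall>t>0. jump (\<lambda>s. X s \<omega>) t \<le> 0)"
  have good_AE: "AE \<omega> in M. ?good \<omega>"
    using L.start_zero L.cadlag_paths assms(3)[unfolded no_positive_jumps_def] by eventually_elim auto
  obtain N where N: "{\<omega> \<in> space M. \<not> ?good \<omega>} \<subseteq> N" "N \<in> null_sets M"
    using good_AE unfolding eventually_ae_filter by blast
  have AEN: "AE \<omega> in M. \<omega> \<notin> N" using N(2) by (rule AE_not_in)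
  (* The exceptional paths are replaced by the zero path, which does not belong to the event. *)
  define Y where "Y t \<omega> = (if \<omega> \<in> N \<or> t < 0 then 0 else X t \<omega>)" for t \<omega>
  have Y_X: "Y t \<omega> = X t \<omega>" if "\<omega> \<notin> N" "0 \<le> t" for t \<omega> using that by (simp add: Y_def)
  have Ym: "Y t \<in> borel_measurable M" for t
  proof (cases "t < 0")
    case False
    have "N \<in> sets M" using N(2) by (simp add: null_sets_def)
    then have "(\<lambda>\<omega>. if \<omega> \<in> N then 0 else X t \<omega>) \<in> borel_measurable M"
      using L.measurable_X[of t] False by (intro measurable_If_set) auto
    then show ?thesis using False by (simp add: Y_def[abs_def])
  qed (simp add: Y_def[abs_def])
  have paths: "sn_path (\<lambda>t. Y t \<omega>)" if \<omega>: "\<omega> \<in> space M" for \<omega>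
  proof (cases "\<omega> \<in> N")
    case True
    then show ?thesis by (auto simp: Y_def sn_path_def right_cont_def)
  next
    case False
    then have good: "?good \<omega>" using N(1) \<omega> by blast
    have r: "((\<lambda>t. Y t \<omega>) \<longlongrightarrow> Y t \<omega>) (at_right t)" for t
    proof (cases "t < 0")
      case True
      have "\<forall>\<^sub>F u in at_right t. 0 = Y u \<omega>" using True by (auto simp: eventually_at_right_field Y_def intro!: exI[of _ 0])
      then show ?thesis using True by (intro Lim_transform_eventually[OF tendsto_const]) (simp add: Y_def)
    next
      case t: False
      have "((\<lambda>t. X t \<omega>) \<longlongrightarrow> X t \<omega>) (at_right t)" using good t by (auto simp: cadlag_def continuous_within)
      moreover have "\<forall>\<^sub>F u in at_right t. X u \<omega> = Y u \<omega>" using t False by (auto simp: eventually_at_right_field Y_def intro!: exI[of _ "t + 1"])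
      ultimately show ?thesis using t False by (auto simp: Y_def[of t] intro: Lim_transform_eventually)
    qed
    have l: "\<exists>l\<ge>Y t \<omega>. ((\<lambda>t. Y t \<omega>) \<longlongrightarrow> l) (at_left t)" for t
    proof (cases "t \<le> 0")
      case True
      have "\<forall>\<^sub>F u in at_left t. 0 = Y u \<omega>" using True by (auto simp: eventually_at_left_field Y_def intro!: exI[of _ "t - 1"])
      then have "((\<lambda>t. Y t \<omega>) \<longlongrightarrow> 0) (at_left t)" by (rule Lim_transform_eventually[OF tendsto_const])
      then show ?thesis using True good by (intro exI[of _ 0]) (auto simp: Y_def)
    next
      case t: False
      then have "0 < t" by simp
      with good obtain l where l: "((\<lambda>t. X t \<omega>) \<longlongrightarrow> l) (at_left t)" unfolding cadlag_def by blast
      then have "Lim (at_left t) (\<lambda>t. X t \<omega>) = l" by (intro tendsto_Lim) auto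
      then have "X t \<omega> \<le> l" using good t by (auto simp: jump_def dest!: spec[of _ t])
      moreover have "\<forall>\<^sub>F u in at_left t. X u \<omega> = Y u \<omega>" using t False by (auto simp: eventually_at_left_field Y_def intro!: exI[of _ 0])
      ultimately show ?thesis using l t False by (intro exI[of _ l]) (auto simp: Y_def[of t] intro: Lim_transform_eventually)
    qed
    have "Y t \<omega> = 0" if "t \<le> 0" for t using that good by (auto simp: Y_def)
    then show ?thesis using r l by (simp add: sn_path_def right_cont_def)
  qed
  have AEY: "AE \<omega> in M. \<forall>t\<ge>0. Y t \<omega> = X t \<omega>" using AEN by eventually_elim (use Y_X in auto)
  have XT: "{\<omega> \<in> space M. X T \<omega> > 0} \<in> sets M" using L.measurable_X[OF less_imp_le[OF assms(1)]] by measurable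
  have YT: "{\<omega> \<in> space M. Y T \<omega> > 0} \<in> sets M" using Ym[of T] by measurable
  have AEE: "AE \<omega> in M. \<omega> \<in> {\<omega> \<in> space M. X T \<omega> > 0} \<longleftrightarrow> \<omega> \<in> {\<omega> \<in> space M. Y T \<omega> > 0}"
    using AEY by eventually_elim (use assms(1) in auto)
  have "measure M {\<omega> \<in> space M. Y T \<omega> > 0} = measure M {\<omega> \<in> space M. X T \<omega> > 0}"
    using AEE XT YT by (intro measure_eq_AE[symmetric])
  then have up: "measure M {\<omega> \<in> space M. Y T \<omega> > 0} > 0" using assms(4) by simp
  interpret Y: levy_process M Y by (rule levy_process_cong_AE[OF assms(2) Ym AEY])
  interpret Y: sn_levy_up M Y T
    by unfold_locales (use paths assms(1) up in auto)
  let ?\<T> = "{F_right, F_left, G_right, G_left, N_minus, N_plus}"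
  have eq: "AE \<omega> in M. \<tau> (\<lambda>t. Y t \<omega>) (Y.sigma \<omega>) = \<tau> (\<lambda>t. X t \<omega>) (\<sigma> \<omega>)" if "\<tau> \<in> ?\<T>" for \<tau>
    using AEN AE_space
  proof eventually_elim
    case (elim \<omega>)
    have "{t \<in> {0..T}. X t \<omega> \<le> 0} = {t \<in> {0..T}. Y t \<omega> \<le> 0}" using Y_X[OF elim(1)] by auto
    then have "\<sigma> \<omega> = Y.sigma \<omega>" using assms(5)[OF elim(2)] by (simp add: Y.sigma_def)
    then show ?case using path_functional_cong[OF that Y_X[OF elim(1)]] by simp
  qed
  have meas: "(\<lambda>\<omega>. \<tau> (\<lambda>t. X t \<omega>) (\<sigma> \<omega>)) \<in> borel_measurable (completion M)" if "\<tau> \<in> ?\<T>" for \<tau>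
    by (rule borel_measurable_completion_cong_AE[OF Y.all_uniform_times(2)[OF that] eq[OF that]])
  have law: "cond_law M {\<omega> \<in> space M. X T \<omega> > 0} (\<lambda>\<omega>. \<tau> (\<lambda>t. X t \<omega>) (\<sigma> \<omega>)) =
      cond_law M {\<omega> \<in> space M. X T \<omega> > 0} (\<lambda>\<omega>. \<tau>' (\<lambda>t. X t \<omega>) (\<sigma> \<omega>))" if \<tau>: "\<tau> \<in> ?\<T>" "\<tau>' \<in> ?\<T>" for \<tau> \<tau>'
  proof -
    obtain t1 t2 where t: "t1 \<in> borel_measurable M" "AE \<omega> in M. \<omega> \<in> Y.E \<longrightarrow> t1 \<omega> = \<tau> (\<lambda>t. Y t \<omega>) (Y.sigma \<omega>)"
      "t2 \<in> borel_measurable M" "AE \<omega> in M. \<omega> \<in> Y.E \<longrightarrow> t2 \<omega> = \<tau>' (\<lambda>t. Y t \<omega>) (Y.sigma \<omega>)"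
      "distr (uniform_measure M Y.E) borel t1 = distr (uniform_measure M Y.E) borel t2"
      by (rule Y.uniform_time_law[OF Y.all_uniform_times(1)[OF \<tau>(1)] Y.all_uniform_times(1)[OF \<tau>(2)]])
    have AE1: "AE \<omega> in M. \<omega> \<in> Y.E \<longrightarrow> t1 \<omega> = \<tau> (\<lambda>t. X t \<omega>) (\<sigma> \<omega>)" using t(2) eq[OF \<tau>(1)] by eventually_elim auto
    have AE2: "AE \<omega> in M. \<omega> \<in> Y.E \<longrightarrow> t2 \<omega> = \<tau>' (\<lambda>t. X t \<omega>) (\<sigma> \<omega>)" using t(4) eq[OF \<tau>(2)] by eventually_elim auto
    show ?thesis
      unfolding cond_law_cong_AE[OF XT Y.E_sets meas[OF \<tau>(1)] t(1) AEE[folded Y.E_def] AE1]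
        cond_law_cong_AE[OF XT Y.E_sets meas[OF \<tau>(2)] t(3) AEE[folded Y.E_def] AE2]
      by (rule t(5))
  qed
  show ?thesis using meas law by blast
qed

end
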